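(* There is a constant $C$ such that every solution $u=\{u_n(t)\}_{n\in\mathbb Z}$ of the one-dimensional homogeneous discrete Klein-Gordon equation $$\partial_t^2u_n(t)-(\Delta_d u)_n(t)+u_n(t)=0,\quad n\in\mathbb Z,\qquad u_n(0)=f_n,\quad \partial_tu_n(0)=g_n,\qquad \{f_n\},\{g_n\}\in l^2(\mathbb Z),$$ satisfies, for all $t>0$, $$\|\{u_n(t)\}\|_{l^2}\le C\big(\|\{f_n\}\|_{l^2}+\|\{g_n\}\|_{l^2}\big),$$ $$\|\{u_n(t)\}\|_{l^\infty}\le C\,t^{-1/3}\big(\|\{f_n\}\|_{l^1}+\|\{g_n\}\|_{l^1}\big).$$ Moreover, let $(q,r)$ and $(\tilde q,\tilde r)$ be pairs of exponents in $[2,\infty]^2$ with $$\frac1q+\frac1{3r}\le\frac16,\qquad \frac1{\tilde q}+\frac1{3\tilde r}\le\frac16 .$$ Then there is a constant $C$ such that every solution of the inhomogeneous equation $$\partial_t^2u_n(t)-(\Delta_d u)_n(t)+u_n(t)+F_n(t)=0,\quad n\in\mathbb Z,\qquad u_n(0)=f_n,\quad \partial_tu_n(0)=g_n,\qquad \{f_n\},\{g_n\}\in l^2(\mathbb Z),$$ satisfies $$\left(\int_0^\infty\Big(\sum_{n\in\mathbb Z}|u_n(t)|^r\Big)^{q/r}dt\right)^{1/q}\le C\Big(\sum_{n\in\mathbb Z}|f_n|^2+|g_n|^2\Big)^{1/2}+C\left(\int_0^\infty\Big(\sum_{n\in\mathbb Z}|F_n(t)|^{\tilde r'}\Big)^{\tilde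 q'/\tilde r'}dt\right)^{1/\tilde q'} .$$
   Context: The one-dimensional discrete Laplacian (lattice spacing $1$) is $(\Delta_d u)_n=u_{n+1}+u_{n-1}-2u_n$, $n\in\mathbb Z$. For an exponent $a$, $a'$ denotes its Hölder conjugate, $1/a+1/a'=1$. When an exponent is infinite, the corresponding sum or integral norm is replaced by a supremum. Solutions of the inhomogeneous equation are understood in the integral (Duhamel) sense, with $F$ such that the right-hand side is finite. *)

theory Defs
  imports "HOL-Analysis.Analysis"
begin

text \<open>
  Sequences on the integer lattice have type \<open>int \<Rightarrow> complex\<close>; a time-dependent sequence is
  \<open>u :: real \<Rightarrow> int \<Rightarrow> complex\<close>, with \<open>u t n\<close> standing for $u_n(t)$.
\<close>

definition discrete_laplacian :: "(int \<Rightarrow> complex) \<Rightarrow> int \<Rightarrow> complex" where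
  "discrete_laplacian a n = a (n + 1) + a (n - 1) - 2 * a n"


subsection \<open>Norms\<close>

text \<open>
  Norms take values in \<^typ>\<open>ennreal\<close>, so that an infinite right-hand side makes an estimate
  void. Exponents are in \<^typ>\<open>ennreal\<close> as well, where \<open>1 / \<infinity> = 0\<close>. The power below is meant
  for a base in $[0,\infty]$ and a positive real exponent.
\<close>

definition ennreal_powr :: "ennreal \<Rightarrow> real \<Rightarrow> ennreal" where
  "ennreal_powr x s = (if x = \<infinity> then \<infinity> else ennreal (enn2real x powr s))"

definition lp_norm :: "ennreal \<Rightarrow> (int \<Rightarrow> complex) \<Rightarrow> ennreal" where
  "lp_norm p a =
    (if p = \<infinity> then (SUP n. ennreal (cmod (a n)))
     else ennreal_powr (\<Sum>\<^sub>\<infinity>n. ennreal (cmod (a n) powr enn2real p)) (1 / enn2real p))"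

text \<open>
  The norm of $L^q_t\, l^p_n$ over the times $t \ge 0$. For \<open>q = \<infinity>\<close> the supremum is over all
  times, not an essential supremum.
\<close>

definition mixed_norm :: "ennreal \<Rightarrow> ennreal \<Rightarrow> (real \<Rightarrow> int \<Rightarrow> complex) \<Rightarrow> ennreal" where
  "mixed_norm q p u =
    (if q = \<infinity> then (SUP t\<in>{0..}. lp_norm p (u t))
     else ennreal_powr
            (\<integral>\<^sup>+t\<in>{0..}. ennreal_powr (lp_norm p (u t)) (enn2real q) \<partial>lebesgue)
            (1 / enn2real q))"


subsection \<open>The homogeneous equation\<close>

text \<open>
  The equation holds classically at every site (with one-sided time derivatives at \<open>0\<close>), and
  the $l^2$ norm of the solution is bounded on bounded time intervals. Some growth condition in
  \<open>n\<close> is implicit in solving the problem in $l^2$: without one, solutions of the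
  infinite system are not determined by their data. Every solution that is continuous in time
  with values in $l^2$ meets this one.
\<close>

definition kg_homogeneous_solution ::
  "(int \<Rightarrow> complex) \<Rightarrow> (int \<Rightarrow> complex) \<Rightarrow> (real \<Rightarrow> int \<Rightarrow> complex) \<Rightarrow> bool" where
  "kg_homogeneous_solution f g u \<longleftrightarrow>
    (\<exists>v w.
      (\<forall>n. \<forall>t\<ge>0. ((\<lambda>s. u s n) has_vector_derivative v t n) (at t within {0..})) \<and>
      (\<forall>n. \<forall>t\<ge>0. ((\<lambda>s. v s n) has_vector_derivative w t n) (at t within {0..})) \<and>
      (\<forall>n. \<forall>t\<ge>0. w t n - discrete_laplacian (u t) n + u t n = 0) \<and>
      (\<forall>n. u 0 n = f n \<and> v 0 n = g n)) \<and>
    (\<forall>T\<ge>0. (SUP t\<in>{0..T}. lp_norm 2 (u t)) < \<infinity>)"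


subsection \<open>The inhomogeneous equation\<close>

text \<open>
  The translation-invariant operator on $l^2$ with bounded even symbol \<open>m\<close> on $[-\pi,\pi]$,
  i.e. convolution with the Fourier coefficients of \<open>m\<close>.
\<close>

definition multiplier_kernel :: "(real \<Rightarrow> real) \<Rightarrow> int \<Rightarrow> complex" where
  "multiplier_kernel m n =
    (LINT \<xi>:{-pi..pi}|lebesgue. complex_of_real (m \<xi>) * cis (of_int n * \<xi>)) /
      complex_of_real (2 * pi)"

definition fourier_multiplier :: "(real \<Rightarrow> real) \<Rightarrow> (int \<Rightarrow> complex) \<Rightarrow> int \<Rightarrow> complex" where
  "fourier_multiplier m a n = (\<Sum>\<^sub>\<infinity>k. multiplier_kernel m (n - k) * a k)"

text \<open>The symbol of $\sqrt{1-\Delta_d}$.\<close>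

definition kg_symbol :: "real \<Rightarrow> real" where
  "kg_symbol \<xi> = sqrt (1 + 4 * (sin (\<xi> / 2))\<^sup>2)"

lemma kg_symbol_square:
  "cis (of_int n * \<xi>) - discrete_laplacian (\<lambda>k. cis (of_int k * \<xi>)) n =
    complex_of_real ((kg_symbol \<xi>)\<^sup>2) * cis (of_int n * \<xi>)"
proof -
  have "cis (of_int (n + 1) * \<xi>) + cis (of_int (n - 1) * \<xi>)
      = cis (of_int n * \<xi>) * (cis \<xi> + cis (- \<xi>))"
    by (simp add: cis_mult algebra_simps)
  moreover have "cis \<xi> + cis (- \<xi>) = complex_of_real (2 * cos \<xi>)"
    by (simp add: complex_eq_iff)
  moreover have "cos \<xi> = 1 - 2 * (sin (\<xi> / 2))\<^sup>2"
    using cos_double_sin[of "\<xi> / 2"] by simp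
  moreover have "(kg_symbol \<xi>)\<^sup>2 = 1 + 4 * (sin (\<xi> / 2))\<^sup>2"
    by (simp add: kg_symbol_def)
  ultimately show ?thesis
    by (simp add: discrete_laplacian_def algebra_simps)
qed

text \<open>The propagators $\cos(t\sqrt{1-\Delta_d})$ and $\sin(t\sqrt{1-\Delta_d})/\sqrt{1-\Delta_d}$.\<close>

definition kg_cos :: "real \<Rightarrow> (int \<Rightarrow> complex) \<Rightarrow> int \<Rightarrow> complex" where
  "kg_cos t = fourier_multiplier (\<lambda>\<xi>. cos (t * kg_symbol \<xi>))"

definition kg_sin :: "real \<Rightarrow> (int \<Rightarrow> complex) \<Rightarrow> int \<Rightarrow> complex" where
  "kg_sin t = fourier_multiplier (\<lambda>\<xi>. sin (t * kg_symbol \<xi>) / kg_symbol \<xi>)"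

definition kg_duhamel_solution ::
  "(int \<Rightarrow> complex) \<Rightarrow> (int \<Rightarrow> complex) \<Rightarrow> (real \<Rightarrow> int \<Rightarrow> complex) \<Rightarrow>
    (real \<Rightarrow> int \<Rightarrow> complex) \<Rightarrow> bool" where
  "kg_duhamel_solution f g F u \<longleftrightarrow>
    (\<forall>t\<ge>0. \<forall>n. u t n =
      kg_cos t f n + kg_sin t g n - (LINT s:{0..t}|lebesgue. kg_sin (t - s) (F s) n))"

end

theory Submission
  imports Defs
begin

text \<open>
  The phase $t\omega(\xi) + n\xi$ of the propagator, $\omega(\xi)^2 = 3 - 2\cos\xi$, has its second and
  third derivatives in $\xi$ bounded below by $ct$ in sum on $[0,\pi]$, so van der Corput's lemma bounds
  the kernels by $C(1 + |t|)^{-1/3}$. All mixed norm estimates reduce by Hoelder's inequality to the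
  endpoints $(q,r) = (\infty,2)$ and $(6,\infty)$. The endpoint $(6,\infty)$ is tested against
  $\psi(t)\delta_{\nu(t)}$, where $\nu(t)$ is a measurable choice of the site at which $|u_n(t)|$ is
  largest and $\psi = \overline{u}|u|^4$; by Bessel's inequality the dual estimate becomes
  $\int\!\int |\psi(t)||\psi(s)|(1+|t-s|)^{-1/3}\,ds\,dt \le C\|\psi\|_{6/5}^2$. For the Duhamel term the
  same test function leads to $G(s) = \int_s^\infty \psi(t) K_{t-s}(\nu(t) - \cdot)\, dt$, which obeys
  both endpoint bounds, so its pairing with $F$ is again handled by Hoelder's inequality and no
  Christ-Kiselev argument is needed. Solutions of the homogeneous equation are identified with the
  propagators by comparing Taylor expansions in time.
\<close>

section \<open>Oscillatory integrals\<close>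

text \<open>What limits the decay is the point where \<omega>'' vanishes, cos \<xi> = (3 - sqrt
  5)/2: there \<omega>''' is nonzero, which leaves t^(-1/3) instead of t^(-1/2). This rate fixes the
  time exponents, since the bilinear form with kernel |t - s|^(-1/3) scales correctly on L^(6/5) x
  L^(6/5) by 5/6 + 5/6 + 1/3 = 2, and 6 is dual to 6/5. The operators cos(t\<omega>) and
  sin(t\<omega>)/\<omega> form no unitary group: squaring the dual operator produces kernels at the
  times t - s and t + s. The second is harmless because both times are nonnegative, so that |t + s|
  is at least |t - s|. Data are first cut to finitely many sites, so that exchanges of sum and
  integral are elementary and maximising sites exist; bounded time intervals give the a priori
  finiteness needed to cancel a power of the unknown norm. All constants are independent of these
  cut-offs, and limits are taken last. The solution itself is only compared with a Borel function of
  time, so its norm is never integrated as a measurable function.\<close>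

lemma van_der_corput_1:
  fixes \<phi> \<phi>1 :: "real \<Rightarrow> real"
  assumes "a \<le> b" "0 < l"
    and d1: "\<And>x. x \<in> {a..b} \<Longrightarrow> (\<phi> has_real_derivative \<phi>1 x) (at x)"
    and mono: "\<And>x y. a \<le> x \<Longrightarrow> x \<le> y \<Longrightarrow> y \<le> b \<Longrightarrow> \<phi>1 x \<le> \<phi>1 y"
    and low: "(\<forall>x\<in>{a..b}. l \<le> \<phi>1 x) \<or> (\<forall>x\<in>{a..b}. \<phi>1 x \<le> - l)"
  shows "\<bar>integral {a..b} (\<lambda>x. cos (\<phi> x))\<bar> \<le> 4 / l"
proof -
  \<comment> \<open>Since cos \<phi> = - g * (\<phi>' cos \<phi>) with g monotone, the second mean
    value theorem takes the place of integration by parts. The minus sign makes g nondecreasing, as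
    that theorem requires. Two pieces, each at most (1/l) * 2, give the constant 4.\<close>
  define g where "g x = - 1 / \<phi>1 x" for x
  have nz: "\<phi>1 x \<noteq> 0" if "x \<in> {a..b}" for x
    using low that \<open>0 < l\<close> by force
  have ftc: "((\<lambda>x. cos (\<phi> x) * \<phi>1 x) has_integral (sin (\<phi> d) - sin (\<phi> c))) {c..d}"
    if "a \<le> c" "c \<le> d" "d \<le> b" for c d
  proof (rule fundamental_theorem_of_calculus)
    fix x assume "x \<in> {c..d}"
    then have "((\<lambda>x. sin (\<phi> x)) has_real_derivative cos (\<phi> x) * \<phi>1 x) (at x)"
      using that by (intro DERIV_fun_sin d1) auto
    then show "((\<lambda>x. sin (\<phi> x)) has_vector_derivative cos (\<phi> x) * \<phi>1 x) (at x within {c..d})"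
      by (simp add: has_field_derivative_at_within has_real_derivative_iff_has_vector_derivative[symmetric])
  qed (use that in auto)
  have bnd: "\<bar>integral {c..d} (\<lambda>x. cos (\<phi> x) * \<phi>1 x)\<bar> \<le> 2"
    if "a \<le> c" "c \<le> d" "d \<le> b" for c d
  proof -
    have "integral {c..d} (\<lambda>x. cos (\<phi> x) * \<phi>1 x) = sin (\<phi> d) - sin (\<phi> c)"
      using ftc[OF that] by (rule integral_unique)
    then show ?thesis
      using sin_le_one[of "\<phi> d"] sin_ge_minus_one[of "\<phi> d"] sin_le_one[of "\<phi> c"] sin_ge_minus_one[of "\<phi> c"]
      by linarith
  qed
  have gb: "\<bar>g x\<bar> \<le> 1 / l" if "x \<in> {a..b}" for x
  proof -
    have "l \<le> \<bar>\<phi>1 x\<bar>" using low that by force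
    then show ?thesis using \<open>0 < l\<close> by (simp add: g_def frac_le)
  qed
  have gmono: "g x \<le> g y" if "a \<le> x" "x \<le> y" "y \<le> b" for x y
    using low
  proof
    assume "\<forall>x\<in>{a..b}. l \<le> \<phi>1 x"
    then have "l \<le> \<phi>1 x" using that by auto
    moreover have "\<phi>1 x \<le> \<phi>1 y" using mono that by auto
    ultimately show ?thesis using \<open>0 < l\<close> by (simp add: g_def frac_le)
  next
    assume "\<forall>x\<in>{a..b}. \<phi>1 x \<le> - l"
    then have "\<phi>1 y \<le> - l" using that by auto
    moreover have "\<phi>1 x \<le> \<phi>1 y" using mono that by auto
    ultimately show ?thesis using \<open>0 < l\<close> by (simp add: g_def divide_simps)
  qed
  obtain c where c: "c \<in> {a..b}" and
    eq: "integral {a..b} (\<lambda>x. g x * (cos (\<phi> x) * \<phi>1 x)) =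
       g a * integral {a..c} (\<lambda>x. cos (\<phi> x) * \<phi>1 x) + g b * integral {c..b} (\<lambda>x. cos (\<phi> x) * \<phi>1 x)"
    using second_mean_value_theorem[of "\<lambda>x. cos (\<phi> x) * \<phi>1 x" a b g]
      ftc[of a b] \<open>a \<le> b\<close> gmono by (auto simp: integrable_on_def)
  have "integral {a..b} (\<lambda>x. cos (\<phi> x)) = integral {a..b} (\<lambda>x. - (g x * (cos (\<phi> x) * \<phi>1 x)))"
    by (rule integral_cong) (use nz in \<open>auto simp: g_def\<close>)
  also have "\<dots> = - (g a * integral {a..c} (\<lambda>x. cos (\<phi> x) * \<phi>1 x) + g b * integral {c..b} (\<lambda>x. cos (\<phi> x) * \<phi>1 x))"
    by (simp add: eq)
  finally have "\<bar>integral {a..b} (\<lambda>x. cos (\<phi> x))\<bar> \<le> \<bar>g a\<bar> * \<bar>integral {a..c} (\<lambda>x. cos (\<phi> x) * \<phi>1 x)\<bar>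
     + \<bar>g b\<bar> * \<bar>integral {c..b} (\<lambda>x. cos (\<phi> x) * \<phi>1 x)\<bar>"
    by (simp add: abs_mult[symmetric])
  also have "\<dots> \<le> 1 / l * 2 + 1 / l * 2"
    using c \<open>0 < l\<close> by (intro add_mono mult_mono bnd gb) (auto simp: \<open>a \<le> b\<close>)
  finally show ?thesis by simp
qed

text \<open>Turns a lower bound on one derivative into a lower bound on the preceding one away from
  a single point. The point is a zero of \<open>f\<close> or, if \<open>f\<close> keeps one sign,
  the end of the interval nearest to where a zero would lie; the mean value theorem does the
  rest.\<close>

lemma expanding_zero:
  fixes f f' :: "real \<Rightarrow> real"
  assumes "a \<le> b" "0 \<le> l"
    and d: "\<And>x. x \<in> {a..b} \<Longrightarrow> (f has_real_derivative f' x) (at x)"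
    and low: "\<And>x. x \<in> {a..b} \<Longrightarrow> l \<le> f' x"
  shows "\<exists>c\<in>{a..b}. (\<forall>x. c < x \<and> x \<le> b \<longrightarrow> l * (x - c) \<le> f x) \<and>
    (\<forall>x. a \<le> x \<and> x < c \<longrightarrow> f x \<le> - (l * (c - x)))"
proof -
  have inc: "l * (y - x) \<le> f y - f x" if "a \<le> x" "x \<le> y" "y \<le> b" for x y
  proof (cases "x = y")
    case False
    with that have "x < y" by simp
    then have "\<exists>z>x. z < y \<and> f y - f x = (y - x) * f' z"
      by (rule MVT2) (intro d, use that in auto)
    then obtain z where z: "x < z" "z < y" "f y - f x = (y - x) * f' z"
      by blast
    moreover have "l \<le> f' z" using low[of z] z that by auto
    ultimately show ?thesis using \<open>x < y\<close> by (simp add: mult.commute mult_left_mono)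
  qed simp
  have cont: "continuous_on {a..b} f"
    by (rule DERIV_continuous_on[of _ _ f']) (use d in \<open>auto intro: has_field_derivative_at_within\<close>)
  consider "f a \<ge> 0" | "f b \<le> 0" | "f a \<le> 0" "0 \<le> f b" by linarith
  then show ?thesis
  proof cases
    case 1
    show ?thesis proof (intro bexI[of _ a] conjI allI impI; (elim conjE)?)
      show "l * (x - a) \<le> f x" if "a < x" "x \<le> b" for x
        using 1 that inc[of a x] by simp
    qed (use \<open>a \<le> b\<close> in auto)
  next
    case 2
    show ?thesis proof (intro bexI[of _ b] conjI allI impI; (elim conjE)?)
      show "f x \<le> - (l * (b - x))" if "a \<le> x" "x < b" for x
        using 2 that inc[of x b] by simp
    qed (use \<open>a \<le> b\<close> in auto)
  next
    case 3
    obtain c where c: "a \<le> c" "c \<le> b" "f c = 0"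
      using IVT'[of f a 0 b] 3 \<open>a \<le> b\<close> cont by auto
    show ?thesis
    proof (intro bexI[of _ c] conjI allI impI; (elim conjE)?)
      show "l * (x - c) \<le> f x" if "c < x" "x \<le> b" for x
        using c that inc[of c x] by auto
      show "f x \<le> - (l * (c - x))" if "a \<le> x" "x < c" for x
        using c that inc[of x c] by auto
    qed (use c in auto)
  qed
qed

text \<open>A \<delta>-neighbourhood of the bad point is estimated trivially by its length. The end
  points are clipped to the interval; a side piece that falls outside is empty and contributes
  0.\<close>

lemma integral_split_around:
  fixes F :: "real \<Rightarrow> real"
  assumes c: "c \<in> {a..b}" and \<delta>: "0 < \<delta>" and cont: "continuous_on {a..b} F"
    and F1: "\<And>x. \<bar>F x\<bar> \<le> 1" and B: "0 \<le> B"
    and left: "a < c - \<delta> \<Longrightarrow> \<bar>integral {a..c - \<delta>} F\<bar> \<le> B"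
    and right: "c + \<delta> < b \<Longrightarrow> \<bar>integral {c + \<delta>..b} F\<bar> \<le> B"
  shows "\<bar>integral {a..b} F\<bar> \<le> 2 * B + 2 * \<delta>"
proof -
  define p q where "p = max a (c - \<delta>)" and "q = min b (c + \<delta>)"
  have ord: "a \<le> p" "p \<le> q" "q \<le> b" using c \<delta> by (auto simp: p_def q_def)
  have int: "F integrable_on {x..y}" if "a \<le> x" "y \<le> b" for x y
    by (rule integrable_continuous_interval, rule continuous_on_subset[OF cont]) (use that in auto)
  have split: "integral {a..b} F = integral {a..p} F + integral {p..q} F + integral {q..b} F"
    using Henstock_Kurzweil_Integration.integral_combine[of a p b F]
      Henstock_Kurzweil_Integration.integral_combine[of p q b F] ord int by auto
  have "\<bar>integral {a..p} F\<bar> \<le> B"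
    using left B by (cases "a < c - \<delta>") (auto simp: p_def max_def)
  moreover have "\<bar>integral {q..b} F\<bar> \<le> B"
    using right B by (cases "c + \<delta> < b") (auto simp: q_def min_def)
  moreover have "\<bar>integral {p..q} F\<bar> \<le> 1 * (q - p)"
    using integral_bound[OF ord(2), of F 1] continuous_on_subset[OF cont, of "{p..q}"] ord F1 by auto
  moreover have "q - p \<le> 2 * \<delta>" using c \<delta> by (auto simp: p_def q_def)
  moreover have "\<bar>x + y + z\<bar> \<le> \<bar>x\<bar> + \<bar>y\<bar> + \<bar>z\<bar>" for x y z :: real
    by linarith
  ultimately show ?thesis unfolding split by (smt (verit))
qed

lemma van_der_corput_2_pos:
  fixes \<phi> \<phi>1 \<phi>2 :: "real \<Rightarrow> real"
  assumes "a \<le> b" "0 < l"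
    and d1: "\<And>x. x \<in> {a..b} \<Longrightarrow> (\<phi> has_real_derivative \<phi>1 x) (at x)"
    and d2: "\<And>x. x \<in> {a..b} \<Longrightarrow> (\<phi>1 has_real_derivative \<phi>2 x) (at x)"
    and low: "\<And>x. x \<in> {a..b} \<Longrightarrow> l \<le> \<phi>2 x"
  shows "\<bar>integral {a..b} (\<lambda>x. cos (\<phi> x))\<bar> \<le> 10 * l powr (- 1 / 2)"
proof -
  have "\<exists>c\<in>{a..b}. (\<forall>x. c < x \<and> x \<le> b \<longrightarrow> l * (x - c) \<le> \<phi>1 x) \<and> (\<forall>x. a \<le> x \<and> x < c \<longrightarrow> \<phi>1 x \<le> - (l * (c - x)))"
    by (intro expanding_zero[of a b l \<phi>1 \<phi>2] d2 low assms(1) less_imp_le[OF \<open>0 < l\<close>])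
  then obtain c where c: "c \<in> {a..b}"
    and ud: "(\<forall>x. c < x \<and> x \<le> b \<longrightarrow> l * (x - c) \<le> \<phi>1 x) \<and> (\<forall>x. a \<le> x \<and> x < c \<longrightarrow> \<phi>1 x \<le> - (l * (c - x)))"
    by (elim bexE)
  have up: "l * (x - c) \<le> \<phi>1 x" if "c < x" "x \<le> b" for x using ud that by blast
  have dn: "\<phi>1 x \<le> - (l * (c - x))" if "a \<le> x" "x < c" for x using ud that by blast
  have cont: "continuous_on {a..b} (\<lambda>x. cos (\<phi> x))"
    by (rule DERIV_continuous_on[of _ _ "\<lambda>x. - sin (\<phi> x) * \<phi>1 x"])
       (rule has_field_derivative_at_within, rule DERIV_fun_cos, erule d1)
  have mono: "\<phi>1 x \<le> \<phi>1 y" if "a \<le> x" "x \<le> y" "y \<le> b" for x y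
    by (rule DERIV_nonneg_imp_nondecreasing[OF that(2)]) (meson atLeastAtMost_iff d2 low less_imp_le \<open>0 < l\<close> order_trans that)
  \<comment> \<open>This width balances the side pieces 4/(l \<delta>) = 4 \<delta> against the
    neighbourhood 2 \<delta>, so the total is 2 * 4 + 2 = 10 times \<delta>.\<close>
  define \<delta> where "\<delta> = l powr (- 1 / 2)"
  have \<delta>: "0 < \<delta>" using \<open>0 < l\<close> by (simp add: \<delta>_def)
  have l\<delta>: "4 / (l * \<delta>) = 4 * \<delta>"
    using \<open>0 < l\<close> by (simp add: \<delta>_def powr_minus field_simps powr_half_sqrt)
  have "\<bar>integral {a..b} (\<lambda>x. cos (\<phi> x))\<bar> \<le> 2 * (4 * \<delta>) + 2 * \<delta>"
  proof (rule integral_split_around[OF c \<delta> cont])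
  show "\<bar>integral {a..c - \<delta>} (\<lambda>x. cos (\<phi> x))\<bar> \<le> 4 * \<delta>" if "a < c - \<delta>"
  proof -
    have "\<phi>1 x \<le> - (l * \<delta>)" if "x \<in> {a..c - \<delta>}" for x
    proof -
      have "l * \<delta> \<le> l * (c - x)"
        using that \<open>0 < l\<close> by auto
      then show ?thesis using dn[of x] that \<delta> by auto
    qed
    then have "\<bar>integral {a..c - \<delta>} (\<lambda>x. cos (\<phi> x))\<bar> \<le> 4 / (l * \<delta>)"
      by (intro van_der_corput_1[of _ _ _ _ \<phi>1]) (use c that \<open>0 < l\<close> \<delta> d1 mono in auto)
    then show ?thesis unfolding l\<delta> .
  qed
  show "\<bar>integral {c + \<delta>..b} (\<lambda>x. cos (\<phi> x))\<bar> \<le> 4 * \<delta>" if "c + \<delta> < b"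
  proof -
    have "l * \<delta> \<le> \<phi>1 x" if "x \<in> {c + \<delta>..b}" for x
    proof -
      have "l * \<delta> \<le> l * (x - c)"
        using that \<open>0 < l\<close> by auto
      then show ?thesis using up[of x] that \<delta> by auto
    qed
    then have "\<bar>integral {c + \<delta>..b} (\<lambda>x. cos (\<phi> x))\<bar> \<le> 4 / (l * \<delta>)"
      by (intro van_der_corput_1[of _ _ _ _ \<phi>1]) (use c that \<open>0 < l\<close> \<delta> d1 mono in auto)
    then show ?thesis unfolding l\<delta> .
  qed
  qed (use \<delta> in auto)
  then show ?thesis by (simp add: \<delta>_def)
qed

lemma van_der_corput_2:
  fixes \<phi> \<phi>1 \<phi>2 :: "real \<Rightarrow> real"
  assumes "a \<le> b" "0 < l"
    and d1: "\<And>x. x \<in> {a..b} \<Longrightarrow> (\<phi> has_real_derivative \<phi>1 x) (at x)"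
    and d2: "\<And>x. x \<in> {a..b} \<Longrightarrow> (\<phi>1 has_real_derivative \<phi>2 x) (at x)"
    and low: "(\<forall>x\<in>{a..b}. l \<le> \<phi>2 x) \<or> (\<forall>x\<in>{a..b}. \<phi>2 x \<le> - l)"
  shows "\<bar>integral {a..b} (\<lambda>x. cos (\<phi> x))\<bar> \<le> 10 * l powr (- 1 / 2)"
  using low
proof
  assume "\<forall>x\<in>{a..b}. l \<le> \<phi>2 x"
  then show ?thesis using van_der_corput_2_pos[of a b l \<phi> \<phi>1 \<phi>2] assms by blast
next
  assume "\<forall>x\<in>{a..b}. \<phi>2 x \<le> - l"
  then have "l \<le> - \<phi>2 x" if "x \<in> {a..b}" for x using that by force
  then have "\<bar>integral {a..b} (\<lambda>x. cos (- \<phi> x))\<bar> \<le> 10 * l powr (- 1 / 2)"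
    by (intro van_der_corput_2_pos[of _ _ _ _ "\<lambda>x. - \<phi>1 x" "\<lambda>x. - \<phi>2 x"] DERIV_minus d1 d2 assms(1,2)) auto
  then show ?thesis by simp
qed

lemma van_der_corput_3_pos:
  fixes \<phi> \<phi>1 \<phi>2 \<phi>3 :: "real \<Rightarrow> real"
  assumes "a \<le> b" "0 < l"
    and d1: "\<And>x. x \<in> {a..b} \<Longrightarrow> (\<phi> has_real_derivative \<phi>1 x) (at x)"
    and d2: "\<And>x. x \<in> {a..b} \<Longrightarrow> (\<phi>1 has_real_derivative \<phi>2 x) (at x)"
    and d3: "\<And>x. x \<in> {a..b} \<Longrightarrow> (\<phi>2 has_real_derivative \<phi>3 x) (at x)"
    and low: "\<And>x. x \<in> {a..b} \<Longrightarrow> l \<le> \<phi>3 x"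
  shows "\<bar>integral {a..b} (\<lambda>x. cos (\<phi> x))\<bar> \<le> 22 * l powr (- 1 / 3)"
proof -
  have "\<exists>c\<in>{a..b}. (\<forall>x. c < x \<and> x \<le> b \<longrightarrow> l * (x - c) \<le> \<phi>2 x) \<and> (\<forall>x. a \<le> x \<and> x < c \<longrightarrow> \<phi>2 x \<le> - (l * (c - x)))"
    by (intro expanding_zero[of a b l \<phi>2 \<phi>3] d2 d3 low assms(1) less_imp_le[OF \<open>0 < l\<close>])
  then obtain c where c: "c \<in> {a..b}"
    and ud: "(\<forall>x. c < x \<and> x \<le> b \<longrightarrow> l * (x - c) \<le> \<phi>2 x) \<and> (\<forall>x. a \<le> x \<and> x < c \<longrightarrow> \<phi>2 x \<le> - (l * (c - x)))"
    by (elim bexE)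
  have up: "l * (x - c) \<le> \<phi>2 x" if "c < x" "x \<le> b" for x using ud that by blast
  have dn: "\<phi>2 x \<le> - (l * (c - x))" if "a \<le> x" "x < c" for x using ud that by blast
  have cont: "continuous_on {a..b} (\<lambda>x. cos (\<phi> x))"
    by (rule DERIV_continuous_on[of _ _ "\<lambda>x. - sin (\<phi> x) * \<phi>1 x"])
       (rule has_field_derivative_at_within, rule DERIV_fun_cos, erule d1)
  \<comment> \<open>Off the neighbourhood the second derivative is at least l \<delta> in size, so
    the previous case gives 10 (l \<delta>)^(-1/2), which is 10 \<delta> for this width. The
    constant is 2 * 10 + 2 = 22.\<close>
  define \<delta> where "\<delta> = l powr (- 1 / 3)"
  have \<delta>: "0 < \<delta>" using \<open>0 < l\<close> by (simp add: \<delta>_def)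
  have "l * \<delta> = l powr (2 / 3)"
    using \<open>0 < l\<close> powr_add[of l 1 "-1/3"] by (simp add: \<delta>_def)
  then have l\<delta>: "(l * \<delta>) powr (- 1 / 2) = \<delta>"
    by (simp add: \<delta>_def powr_powr)
  have "\<bar>integral {a..b} (\<lambda>x. cos (\<phi> x))\<bar> \<le> 2 * (10 * \<delta>) + 2 * \<delta>"
  proof (rule integral_split_around[OF c \<delta> cont])
  show "\<bar>integral {a..c - \<delta>} (\<lambda>x. cos (\<phi> x))\<bar> \<le> 10 * \<delta>" if "a < c - \<delta>"
  proof -
    have "\<phi>2 x \<le> - (l * \<delta>)" if "x \<in> {a..c - \<delta>}" for x
    proof -
      have "l * \<delta> \<le> l * (c - x)"
        using that \<open>0 < l\<close> by auto
      then show ?thesis using dn[of x] that \<delta> by auto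
    qed
    then have "\<bar>integral {a..c - \<delta>} (\<lambda>x. cos (\<phi> x))\<bar> \<le> 10 * (l * \<delta>) powr (- 1 / 2)"
      by (intro van_der_corput_2[of _ _ _ _ \<phi>1 \<phi>2]) (use c that \<open>0 < l\<close> \<delta> d1 d2 in auto)
    then show ?thesis unfolding l\<delta> .
  qed
  show "\<bar>integral {c + \<delta>..b} (\<lambda>x. cos (\<phi> x))\<bar> \<le> 10 * \<delta>" if "c + \<delta> < b"
  proof -
    have "l * \<delta> \<le> \<phi>2 x" if "x \<in> {c + \<delta>..b}" for x
    proof -
      have "l * \<delta> \<le> l * (x - c)"
        using that \<open>0 < l\<close> by auto
      then show ?thesis using up[of x] that \<delta> by auto
    qed
    then have "\<bar>integral {c + \<delta>..b} (\<lambda>x. cos (\<phi> x))\<bar> \<le> 10 * (l * \<delta>) powr (- 1 / 2)"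
      by (intro van_der_corput_2[of _ _ _ _ \<phi>1 \<phi>2]) (use c that \<open>0 < l\<close> \<delta> d1 d2 in auto)
    then show ?thesis unfolding l\<delta> .
  qed
  qed (use \<delta> in auto)
  then show ?thesis by (simp add: \<delta>_def)
qed

lemma van_der_corput_3_neg:
  fixes \<phi> \<phi>1 \<phi>2 \<phi>3 :: "real \<Rightarrow> real"
  assumes "a \<le> b" "0 < l"
    and d1: "\<And>x. x \<in> {a..b} \<Longrightarrow> (\<phi> has_real_derivative \<phi>1 x) (at x)"
    and d2: "\<And>x. x \<in> {a..b} \<Longrightarrow> (\<phi>1 has_real_derivative \<phi>2 x) (at x)"
    and d3: "\<And>x. x \<in> {a..b} \<Longrightarrow> (\<phi>2 has_real_derivative \<phi>3 x) (at x)"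
    and up: "\<And>x. x \<in> {a..b} \<Longrightarrow> \<phi>3 x \<le> - l"
  shows "\<bar>integral {a..b} (\<lambda>x. cos (\<phi> x))\<bar> \<le> 22 * l powr (- 1 / 3)"
proof -
  have "l \<le> - \<phi>3 x" if "x \<in> {a..b}" for x using up[OF that] by simp
  then have "\<bar>integral {a..b} (\<lambda>x. cos (- \<phi> x))\<bar> \<le> 22 * l powr (- 1 / 3)"
    by (intro van_der_corput_3_pos[of _ _ _ _ "\<lambda>x. - \<phi>1 x" "\<lambda>x. - \<phi>2 x" "\<lambda>x. - \<phi>3 x"]
          DERIV_minus d1 d2 d3 assms(1,2)) auto
  then show ?thesis by simp
qed

section \<open>The dispersion relation and its derivatives up to order three\<close>

lemma kg_symbol_eq: "kg_symbol \<xi> = sqrt (3 - 2 * cos \<xi>)"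
proof -
  have "cos \<xi> = 1 - 2 * (sin (\<xi> / 2))\<^sup>2"
    using cos_double_sin[of "\<xi> / 2"] by simp
  then show ?thesis by (simp add: kg_symbol_def)
qed

lemma kg_symbol_sq: "(kg_symbol \<xi>)\<^sup>2 = 3 - 2 * cos \<xi>"
proof -
  have "0 \<le> 3 - 2 * cos \<xi>" using cos_le_one[of \<xi>] by linarith
  then show ?thesis by (simp add: kg_symbol_eq)
qed

lemma kg_symbol_ge_1: "1 \<le> kg_symbol \<xi>"
  by (simp add: kg_symbol_def)

lemma kg_symbol_pos: "0 < kg_symbol \<xi>"
  using kg_symbol_ge_1[of \<xi>] by linarith

lemma kg_symbol_nz: "kg_symbol \<xi> \<noteq> 0"
  using kg_symbol_pos[of \<xi>] by linarith

lemma kg_symbol_le_3: "kg_symbol \<xi> \<le> 3"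
proof -
  have "3 - 2 * cos \<xi> \<le> 3\<^sup>2"
    using cos_ge_minus_one[of \<xi>] by (simp only: power2_eq_square)
  then show ?thesis unfolding kg_symbol_eq by (intro real_le_lsqrt) auto
qed

lemma kg_symbol_minus [simp]: "kg_symbol (- \<xi>) = kg_symbol \<xi>"
  by (simp add: kg_symbol_eq)

lemma continuous_on_kg_symbol [continuous_intros]: "continuous_on A kg_symbol"
  unfolding kg_symbol_def by (intro continuous_intros) simp_all

lemma kg_symbol_measurable [measurable]: "kg_symbol \<in> borel_measurable borel"
  by (rule borel_measurable_continuous_onI) (rule continuous_on_kg_symbol)

lemma kg_symbol_mono: "0 \<le> x \<Longrightarrow> x \<le> y \<Longrightarrow> y \<le> pi \<Longrightarrow> kg_symbol x \<le> kg_symbol y"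
  unfolding kg_symbol_eq by (intro real_sqrt_le_mono) (simp add: cos_monotone_0_pi_le)

lemma DERIV_kg_symbol:
  "(kg_symbol has_real_derivative sin x / kg_symbol x) (at x)"
proof -
  have "3 - 2 * cos x \<noteq> 0" "0 < 3 - 2 * cos x" using cos_le_one[of x] by linarith+
  then have "((\<lambda>x. sqrt (3 - 2 * cos x)) has_real_derivative sin x / sqrt (3 - 2 * cos x)) (at x)"
    by (auto intro!: derivative_eq_intros simp: field_simps)
  then show ?thesis by (simp add: kg_symbol_eq[abs_def])
qed

text \<open>The numerator has its only zero in [-1,1] at cos x = (3 - sqrt 5)/2, about 0.38. The
  cuts at cos x = 2/3 and cos x = 0 used below enclose it.\<close>

lemma DERIV_kg_symbol_2:
  "((\<lambda>x. sin x / kg_symbol x) has_real_derivative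
     - ((cos x)\<^sup>2 - 3 * cos x + 1) / kg_symbol x ^ 3) (at x)"
proof -
  define w where "w = kg_symbol x"
  have w: "w \<noteq> 0" "w ^ 2 = 3 - 2 * cos x" "(sin x)\<^sup>2 = 1 - (cos x)\<^sup>2"
    by (simp_all add: w_def kg_symbol_nz kg_symbol_sq sin_squared_eq)
  have "((\<lambda>x. sin x / kg_symbol x) has_real_derivative
     (cos x * w - sin x * (sin x / w)) / (w * w)) (at x)"
    unfolding w_def by (intro DERIV_divide DERIV_sin DERIV_kg_symbol kg_symbol_nz)
  also have "(cos x * w - sin x * (sin x / w)) / (w * w) = (cos x * w\<^sup>2 - (sin x)\<^sup>2) / w ^ 3"
    using w(1) by (simp add: divide_simps) (simp add: power2_eq_square power3_eq_cube algebra_simps)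
  also have "cos x * w\<^sup>2 - (sin x)\<^sup>2 = - ((cos x)\<^sup>2 - 3 * cos x + 1)"
    unfolding w by (simp add: algebra_simps power2_eq_square)
  finally show ?thesis by (simp add: w_def)
qed

lemma DERIV_kg_symbol_3:
  "((\<lambda>x. - ((cos x)\<^sup>2 - 3 * cos x + 1) / kg_symbol x ^ 3) has_real_derivative
     - (sin x * ((cos x)\<^sup>2 - 3 * cos x + 6)) / kg_symbol x ^ 5) (at x)"
proof -
  define w c s where "w = kg_symbol x" and "c = cos x" and "s = sin x"
  have w: "w \<noteq> 0" "w ^ 2 = 3 - 2 * c"
    by (simp_all add: w_def c_def kg_symbol_nz kg_symbol_sq)
  have a: "((\<lambda>x. - ((cos x)\<^sup>2 - 3 * cos x + 1)) has_real_derivative s * (2 * c - 3)) (at x)"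
    by (auto intro!: derivative_eq_intros simp: c_def s_def algebra_simps)
  have b: "((\<lambda>x. kg_symbol x ^ 3) has_real_derivative (3 * w ^ 2 * (s / w))) (at x)"
    by (auto intro!: derivative_eq_intros DERIV_kg_symbol simp: w_def s_def)
  have nz: "kg_symbol x ^ 3 \<noteq> 0" by (simp add: kg_symbol_nz)
  have "((\<lambda>x. - ((cos x)\<^sup>2 - 3 * cos x + 1) / kg_symbol x ^ 3) has_real_derivative
      ((s * (2 * c - 3)) * w ^ 3 - (- (c\<^sup>2 - 3 * c + 1)) * (3 * w ^ 2 * (s / w))) / (w ^ 3 * w ^ 3)) (at x)"
    using DERIV_divide[OF a b nz] unfolding w_def c_def s_def .
  also have "((s * (2 * c - 3)) * w ^ 3 - (- (c\<^sup>2 - 3 * c + 1)) * (3 * w ^ 2 * (s / w))) / (w ^ 3 * w ^ 3)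
      = (s * ((2 * c - 3) * w\<^sup>2 + 3 * (c\<^sup>2 - 3 * c + 1))) / w ^ 5"
    using w(1) by (simp add: divide_simps) (simp add: algebra_simps eval_nat_numeral)
  also have "s * ((2 * c - 3) * w\<^sup>2 + 3 * (c\<^sup>2 - 3 * c + 1)) = - (s * (c\<^sup>2 - 3 * c + 6))"
    unfolding w by (simp add: algebra_simps power2_eq_square)
  finally show ?thesis by (simp add: w_def c_def s_def)
qed

lemma kg_symbol_2_bound_inner:
  assumes "2 / 3 \<le> cos x"
  shows "1 / 54 \<le> - ((cos x)\<^sup>2 - 3 * cos x + 1) / kg_symbol x ^ 3"
proof -
  \<comment> \<open>The square lies below its chord on [2/3, 1], which makes the numerator linear in
    cos x and at least 5/9. The bound 1/54 is (1/2)/27 with \<open>kg_symbol x\<close> at most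
    3.\<close>
  have "0 \<le> (cos x - 2 / 3) * (1 - cos x)" using assms by simp
  moreover have "(cos x - 2 / 3) * (1 - cos x) = 5 / 3 * cos x - (cos x)\<^sup>2 - 2 / 3"
    by (simp add: field_simps power2_eq_square)
  ultimately have "1 / 2 \<le> - ((cos x)\<^sup>2 - 3 * cos x + 1)"
    using assms by linarith
  moreover have "kg_symbol x ^ 3 \<le> 3 ^ 3"
    using kg_symbol_le_3[of x] kg_symbol_pos[of x] by (intro power_mono) auto
  ultimately have "(1 / 2) / 27 \<le> - ((cos x)\<^sup>2 - 3 * cos x + 1) / kg_symbol x ^ 3"
    using kg_symbol_pos[of x] by (intro frac_le) auto
  then show ?thesis by simp
qed

lemma kg_symbol_2_bound_outer:
  assumes "cos x \<le> 0"
  shows "- ((cos x)\<^sup>2 - 3 * cos x + 1) / kg_symbol x ^ 3 \<le> - (1 / 54)"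
proof -
  have "1 / 2 \<le> (cos x)\<^sup>2 - 3 * cos x + 1"
    using assms zero_le_power2[of "cos x"] by linarith
  moreover have "kg_symbol x ^ 3 \<le> 3 ^ 3"
    using kg_symbol_le_3[of x] kg_symbol_pos[of x] by (intro power_mono) auto
  ultimately have "(1 / 2) / 27 \<le> ((cos x)\<^sup>2 - 3 * cos x + 1) / kg_symbol x ^ 3"
    using kg_symbol_pos[of x] by (intro frac_le) auto
  then show ?thesis unfolding minus_divide_left[symmetric] by simp
qed

text \<open>Covers the range containing the inflection point of the dispersion relation. Here sin x
  is at least 2/3 and the quadratic at least 4, and (8/3)/3^5 exceeds 1/100.\<close>

lemma kg_symbol_3_bound:
  assumes "0 \<le> cos x" "cos x \<le> 2 / 3" "0 \<le> sin x"
  shows "- (sin x * ((cos x)\<^sup>2 - 3 * cos x + 6)) / kg_symbol x ^ 5 \<le> - (1 / 100)"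
proof -
  have "(cos x)\<^sup>2 \<le> (2 / 3)\<^sup>2" using assms by (intro power_mono) auto
  then have "(2 / 3)\<^sup>2 \<le> (sin x)\<^sup>2" unfolding sin_squared_eq by (simp add: power2_eq_square)
  then have "2 / 3 \<le> sin x" using assms(3) by (rule power2_le_imp_le)
  moreover have "4 \<le> (cos x)\<^sup>2 - 3 * cos x + 6"
    using assms zero_le_power2[of "cos x"] by linarith
  ultimately have "(2 / 3) * 4 \<le> sin x * ((cos x)\<^sup>2 - 3 * cos x + 6)"
    by (intro mult_mono) auto
  moreover have "kg_symbol x ^ 5 \<le> 3 ^ 5"
    using kg_symbol_le_3[of x] kg_symbol_pos[of x] by (intro power_mono) auto
  ultimately have "((2 / 3) * 4) / 243 \<le> (sin x * ((cos x)\<^sup>2 - 3 * cos x + 6)) / kg_symbol x ^ 5"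
    using kg_symbol_pos[of x] by (intro frac_le) auto
  then show ?thesis unfolding minus_divide_left[symmetric] by simp
qed

text \<open>The term \<open>x * \<xi>\<close> disappears after two derivatives, so the bound is
  uniform in x and hence in the lattice site. Arbitrary subintervals of [0, pi] are allowed because
  removing an amplitude by the second mean value theorem produces them.\<close>

lemma oscillatory_integral_bound:
  fixes t x \<theta> :: real
  assumes t: "0 < t" and ab: "0 \<le> a" "a \<le> b" "b \<le> pi"
  shows "\<bar>integral {a..b} (\<lambda>\<xi>. cos (t * kg_symbol \<xi> + x * \<xi> + \<theta>))\<bar>
     \<le> 20 * (t / 54) powr (- 1 / 2) + 22 * (t / 100) powr (- 1 / 3)"
proof -
  define \<phi> where "\<phi> \<xi> = t * kg_symbol \<xi> + x * \<xi> + \<theta>" for \<xi>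
  define \<phi>1 where "\<phi>1 \<xi> = t * (sin \<xi> / kg_symbol \<xi>) + x" for \<xi>
  define \<phi>2 where "\<phi>2 \<xi> = t * (- ((cos \<xi>)\<^sup>2 - 3 * cos \<xi> + 1) / kg_symbol \<xi> ^ 3)" for \<xi>
  define \<phi>3 where "\<phi>3 \<xi> = t * (- (sin \<xi> * ((cos \<xi>)\<^sup>2 - 3 * cos \<xi> + 6)) / kg_symbol \<xi> ^ 5)" for \<xi>
  have d1: "(\<phi> has_real_derivative \<phi>1 \<xi>) (at \<xi>)" for \<xi>
    unfolding \<phi>_def[abs_def] \<phi>1_def
    by (rule derivative_eq_intros DERIV_kg_symbol refl)+ simp
  have d2: "(\<phi>1 has_real_derivative \<phi>2 \<xi>) (at \<xi>)" for \<xi>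
    unfolding \<phi>1_def[abs_def] \<phi>2_def
    using DERIV_add[OF DERIV_cmult[OF DERIV_kg_symbol_2[of \<xi>], of t] DERIV_const[of x]] by simp
  have d3: "(\<phi>2 has_real_derivative \<phi>3 \<xi>) (at \<xi>)" for \<xi>
    unfolding \<phi>2_def[abs_def] \<phi>3_def by (intro DERIV_cmult DERIV_kg_symbol_3)
  define J where "J u v = integral {u..v} (\<lambda>\<xi>. cos (\<phi> \<xi>))" for u v
  \<comment> \<open>The cut points arccos(2/3) and pi/2, clipped to [a, b]. The outer pieces use the
    second derivative and the middle one the third.\<close>
  define p q where "p = min b (max a (arccos (2 / 3)))" and "q = min b (max a (pi / 2))"
  have ac: "0 \<le> arccos (2 / 3)" "arccos (2 / 3) \<le> pi / 2"
    using arccos_lbound[of "2/3"] arccos_le_pi2[of "2/3"] by auto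
  have ord: "a \<le> p" "p \<le> q" "q \<le> b" using ab ac by (auto simp: p_def q_def)
  have cont: "continuous_on A (\<lambda>\<xi>. cos (\<phi> \<xi>))" for A
    unfolding \<phi>_def by (intro continuous_intros)
  have split: "J a b = J a p + J p q + J q b"
    using Henstock_Kurzweil_Integration.integral_combine[of a p b "\<lambda>\<xi>. cos (\<phi> \<xi>)"]
      Henstock_Kurzweil_Integration.integral_combine[of p q b "\<lambda>\<xi>. cos (\<phi> \<xi>)"] ord
      integrable_continuous_interval[OF cont] by (simp add: J_def)
  have 1: "\<bar>J a p\<bar> \<le> 10 * (t / 54) powr (- 1 / 2)"
  proof (cases "a < arccos (2 / 3)")
    case True
    have "t / 54 \<le> \<phi>2 \<xi>" if "\<xi> \<in> {a..p}" for \<xi>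
    proof -
      have "cos (arccos (2 / 3)) \<le> cos \<xi>"
        using that ab ac True by (intro cos_monotone_0_pi_le) (auto simp: p_def)
      then have "t * (1 / 54) \<le> \<phi>2 \<xi>"
        unfolding \<phi>2_def using t by (intro mult_left_mono kg_symbol_2_bound_inner) auto
      then show ?thesis by simp
    qed
    then show ?thesis unfolding J_def
      using ord t by (intro van_der_corput_2[OF _ _ d1 d2]) auto
  qed (use ab in \<open>auto simp: J_def p_def\<close>)
  have 2: "\<bar>J p q\<bar> \<le> 22 * (t / 100) powr (- 1 / 3)"
  proof (cases "p = q")
    case False
    have "\<phi>3 \<xi> \<le> - (t / 100)" if "\<xi> \<in> {p..q}" for \<xi>
    proof -
      have "arccos (2 / 3) \<le> \<xi>" "\<xi> \<le> pi / 2"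
        using that False ord ab ac by (auto simp: p_def q_def min_def max_def split: if_splits)
      then have "cos \<xi> \<le> cos (arccos (2 / 3))" "cos (pi / 2) \<le> cos \<xi>" "0 \<le> sin \<xi>"
        using ac by (intro cos_monotone_0_pi_le sin_ge_zero; simp)+
      then have "\<phi>3 \<xi> \<le> t * (- (1 / 100))"
        unfolding \<phi>3_def using t by (intro mult_left_mono kg_symbol_3_bound) auto
      then show ?thesis by simp
    qed
    then show ?thesis unfolding J_def
      using ord t by (intro van_der_corput_3_neg[OF _ _ d1 d2 d3]) auto
  qed (auto simp: J_def)
  have 3: "\<bar>J q b\<bar> \<le> 10 * (t / 54) powr (- 1 / 2)"
  proof (cases "pi / 2 < b")
    case True
    have "\<phi>2 \<xi> \<le> - (t / 54)" if "\<xi> \<in> {q..b}" for \<xi>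
    proof -
      have "cos \<xi> \<le> cos (pi / 2)"
        using that ab ac True by (intro cos_monotone_0_pi_le) (auto simp: q_def)
      then have "\<phi>2 \<xi> \<le> t * (- (1 / 54))"
        unfolding \<phi>2_def using t by (intro mult_left_mono kg_symbol_2_bound_outer) auto
      then show ?thesis by simp
    qed
    then show ?thesis unfolding J_def
      using ord t by (intro van_der_corput_2[OF _ _ d1 d2]) auto
  qed (use ab in \<open>auto simp: J_def q_def\<close>)
  have "\<bar>J a b\<bar> \<le> \<bar>J a p\<bar> + \<bar>J p q\<bar> + \<bar>J q b\<bar>" unfolding split by linarith
  also have "\<dots> \<le> 20 * (t / 54) powr (- 1 / 2) + 22 * (t / 100) powr (- 1 / 3)"
    using 1 2 3 by linarith
  finally show ?thesis by (simp add: J_def \<phi>_def)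
qed

text \<open>The value at t = 1 of the preceding bound. For larger t it dominates after t^(-1/2) is
  replaced by t^(-1/3).\<close>

definition osc_const :: real where
  "osc_const = 20 * (1 / 54) powr (- 1 / 2) + 22 * (1 / 100) powr (- 1 / 3)"

lemma osc_const_ge_1: "1 \<le> osc_const"
proof -
  have "(1::real) = 1 powr (- 1 / 3)" by simp
  also have "\<dots> \<le> (1 / 100) powr (- 1 / 3)" by (intro powr_mono2') auto
  finally have "1 \<le> (1 / 100 :: real) powr (- 1 / 3)" .
  moreover have "0 \<le> (1 / 54 :: real) powr (- 1 / 2)" by simp
  ultimately show ?thesis unfolding osc_const_def by linarith
qed

lemma oscillatory_integral_bound':
  fixes t x \<theta> :: real
  assumes t: "1 \<le> t" and ab: "0 \<le> a" "a \<le> b" "b \<le> pi"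
  shows "\<bar>integral {a..b} (\<lambda>\<xi>. cos (t * kg_symbol \<xi> + x * \<xi> + \<theta>))\<bar> \<le> osc_const * t powr (- 1 / 3)"
proof -
  have e: "(t / c) powr s = (1 / c) powr s * t powr s" if "c > 0" for c s :: real
    using that t powr_mult[of "1 / c" t s] by (simp add: mult.commute)
  have "t powr (- 1 / 2) \<le> t powr (- 1 / 3)" using t by (intro powr_mono) auto
  then have "20 * (t / 54) powr (- 1 / 2) + 22 * (t / 100) powr (- 1 / 3) \<le> osc_const * t powr (- 1 / 3)"
    unfolding osc_const_def e[of 54, simplified] e[of 100, simplified] distrib_right
    by (simp add: mult.assoc mult_left_mono)
  with oscillatory_integral_bound[of t a b x \<theta>] t ab show ?thesis by linarith
qed

section \<open>Fourier multipliers and the dispersive estimate\<close>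

text \<open>Normalised to total mass 1, so that the characters are orthonormal, every bounded Borel
  function is integrable, and \<open>multiplier_kernel\<close> is a plain integral.\<close>

definition circle_measure :: "real measure" where
  "circle_measure = density lborel (\<lambda>x. ennreal (indicator {-pi..pi} x / (2 * pi)))"

lemma sets_circle_measure [measurable_cong, simp]: "sets circle_measure = sets borel"
  by (simp add: circle_measure_def)

lemma space_circle_measure [simp]: "space circle_measure = UNIV"
  by (simp add: circle_measure_def)

lemma emeasure_circle_measure: "emeasure circle_measure UNIV = 1"
proof -
  have "emeasure circle_measure UNIV = (\<integral>\<^sup>+x. ennreal (1 / (2 * pi)) * indicator {-pi..pi} x \<partial>lborel)"
    unfolding circle_measure_def
    by (subst emeasure_density) (auto intro!: nn_integral_cong split: split_indicator)
  also have "\<dots> = ennreal (1 / (2 * pi)) * ennreal (2 * pi)"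
    by (subst nn_integral_cmult_indicator) auto
  also have "\<dots> = 1" by (simp add: ennreal_mult[symmetric])
  finally show ?thesis .
qed

interpretation circle: finite_measure circle_measure
  by (rule finite_measureI) (simp add: emeasure_circle_measure)

lemma circle_integral:
  fixes F :: "real \<Rightarrow> 'b :: {banach, second_countable_topology}"
  assumes [measurable]: "F \<in> borel_measurable borel"
  shows "(\<integral>\<xi>. F \<xi> \<partial>circle_measure) = (LINT \<xi>:{-pi..pi}|lborel. F \<xi>) /\<^sub>R (2 * pi)"
proof -
  have "(\<integral>\<xi>. F \<xi> \<partial>circle_measure) = (\<integral>\<xi>. (indicator {-pi..pi} \<xi> / (2 * pi)) *\<^sub>R F \<xi> \<partial>lborel)"
    unfolding circle_measure_def by (subst integral_density) auto
  also have "\<dots> = (\<integral>\<xi>. (1 / (2 * pi)) *\<^sub>R (indicator {-pi..pi} \<xi> *\<^sub>R F \<xi>) \<partial>lborel)"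
    by (simp add: field_simps)
  also have "\<dots> = (LINT \<xi>:{-pi..pi}|lborel. F \<xi>) /\<^sub>R (2 * pi)"
    unfolding set_lebesgue_integral_def by (subst integral_scaleR_right) (simp add: field_simps)
  finally show ?thesis .
qed

lemma circle_integrable_bounded:
  fixes F :: "real \<Rightarrow> 'b :: {banach, second_countable_topology}"
  assumes "F \<in> borel_measurable borel" "\<And>\<xi>. norm (F \<xi>) \<le> B"
  shows "integrable circle_measure F"
  by (rule circle.integrable_const_bound[of _ B])
     (use assms in \<open>auto simp: measurable_cong_sets[OF sets_circle_measure refl]\<close>)

lemma circle_integral_le:
  assumes "F \<in> borel_measurable borel" "\<And>\<xi>. \<bar>F \<xi>\<bar> \<le> (B::real)"
  shows "(\<integral>\<xi>. F \<xi> \<partial>circle_measure) \<le> B"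
proof -
  have "(\<integral>\<xi>. F \<xi> \<partial>circle_measure) \<le> (\<integral>\<xi>. B \<partial>circle_measure)"
    using assms by (intro integral_mono circle_integrable_bounded[OF assms(1), of B] circle.integrable_const)
      (auto intro: order_trans[OF abs_ge_self])
  then show ?thesis by (simp add: measure_def emeasure_circle_measure)
qed

lemma cis_measurable [measurable (raw)]:
  assumes "f \<in> borel_measurable M"
  shows "(\<lambda>x. cis (f x)) \<in> borel_measurable M"
  by (rule measurable_compose[OF assms]) (intro borel_measurable_continuous_onI continuous_intros)

lemma multiplier_kernel_circle:
  assumes [measurable]: "m \<in> borel_measurable borel"
  shows "multiplier_kernel m n = (\<integral>\<xi>. complex_of_real (m \<xi>) * cis (of_int n * \<xi>) \<partial>circle_measure)"
proof -
  have "(LINT \<xi>:{-pi..pi}|lebesgue. complex_of_real (m \<xi>) * cis (of_int n * \<xi>))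
      = (LINT \<xi>:{-pi..pi}|lborel. complex_of_real (m \<xi>) * cis (of_int n * \<xi>))"
    unfolding set_lebesgue_integral_def by (subst integral_completion) auto
  moreover have "(\<integral>\<xi>. complex_of_real (m \<xi>) * cis (of_int n * \<xi>) \<partial>circle_measure)
      = (LINT \<xi>:{-pi..pi}|lborel. complex_of_real (m \<xi>) * cis (of_int n * \<xi>)) /\<^sub>R (2 * pi)"
    by (rule circle_integral) measurable
  ultimately show ?thesis
    by (simp only: multiplier_kernel_def scaleR_conv_of_real divide_inverse of_real_inverse mult.commute)
qed

text \<open>The sine parts cancel under reflection. What remains lives on [0, pi], where
  \<open>kg_symbol\<close> is increasing and the oscillatory bounds apply.\<close>

lemma multiplier_kernel_even:
  assumes cont: "continuous_on UNIV m" and even: "\<And>\<xi>. m (- \<xi>) = m \<xi>"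
  shows "multiplier_kernel m n = complex_of_real (integral {0..pi} (\<lambda>\<xi>. m \<xi> * cos (of_int n * \<xi>)) / pi)"
proof -
  define F where "F \<xi> = complex_of_real (m \<xi>) * cis (of_int n * \<xi>)" for \<xi>
  have contF: "continuous_on A F" for A
    unfolding F_def by (intro continuous_intros continuous_on_subset[OF cont]) auto
  have Fi: "F integrable_on {a..b}" for a b
    by (rule integrable_continuous_interval) (rule contF)
  have Fm: "F absolutely_integrable_on {-pi..pi}"
    by (rule absolutely_integrable_continuous_real) (rule contF)
  have "(LINT \<xi>:{-pi..pi}|lebesgue. F \<xi>) = integral {-pi..pi} F"
    by (rule set_lebesgue_integral_eq_integral(2)[OF Fm])
  also have "\<dots> = integral {-pi..0} F + integral {0..pi} F"
    using Henstock_Kurzweil_Integration.integral_combine[of "-pi" 0 pi F] Fi by auto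
  also have "integral {-pi..0} F = integral {0..pi} (\<lambda>\<xi>. F (- \<xi>))"
    using Henstock_Kurzweil_Integration.integral_reflect_real[of pi 0 "\<lambda>\<xi>. F (-\<xi>)"] by simp
  also have "integral {0..pi} (\<lambda>\<xi>. F (- \<xi>)) + integral {0..pi} F = integral {0..pi} (\<lambda>\<xi>. F (- \<xi>) + F \<xi>)"
    by (rule integral_add[symmetric])
       (intro integrable_continuous_interval continuous_intros continuous_on_compose2[OF contF[of UNIV]]; auto)+
  also have "(\<lambda>\<xi>. F (- \<xi>) + F \<xi>) = (\<lambda>\<xi>. complex_of_real (2 * (m \<xi> * cos (of_int n * \<xi>))))"
    by (auto simp: F_def even complex_eq_iff fun_eq_iff)
  also have "integral {0..pi} \<dots> = complex_of_real (integral {0..pi} (\<lambda>\<xi>. 2 * (m \<xi> * cos (of_int n * \<xi>))))"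
  proof -
    have "(\<lambda>\<xi>. 2 * (m \<xi> * cos (of_int n * \<xi>))) integrable_on {0..pi}"
      by (intro integrable_continuous_interval continuous_intros continuous_on_subset[OF cont]) auto
    from integral_linear[OF this bounded_linear_of_real[where 'a = complex]] show ?thesis by (simp add: o_def)
  qed
  finally show ?thesis
    unfolding multiplier_kernel_def F_def by (simp add: divide_simps)
qed

lemma multiplier_kernel_sym:
  assumes "continuous_on UNIV m" "\<And>\<xi>. m (- \<xi>) = m \<xi>"
  shows "multiplier_kernel m (- n) = multiplier_kernel m n"
  by (simp add: multiplier_kernel_even[OF assms])

text \<open>One family for everything that occurs: j = 0, \<theta> = 0 is the cosine propagator, j =
  1, \<theta> = -pi/2 is the sine propagator, and doubled values of j and \<theta> arise from
  products of two such symbols.\<close>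

definition osc_symbol :: "nat \<Rightarrow> real \<Rightarrow> real \<Rightarrow> real \<Rightarrow> real" where
  "osc_symbol j \<theta> t \<xi> = cos (t * kg_symbol \<xi> + \<theta>) / kg_symbol \<xi> ^ j"

lemma osc_symbol_even [simp]: "osc_symbol j \<theta> t (- \<xi>) = osc_symbol j \<theta> t \<xi>"
  by (simp add: osc_symbol_def)

lemma continuous_on_osc_symbol: "continuous_on A (osc_symbol j \<theta> t)"
  unfolding osc_symbol_def by (intro continuous_intros) (simp add: kg_symbol_nz)

lemma osc_symbol_bound: "\<bar>osc_symbol j \<theta> t \<xi>\<bar> \<le> 1"
proof -
  have "1 \<le> kg_symbol \<xi> ^ j" by (rule one_le_power) (rule kg_symbol_ge_1)
  then show ?thesis
    using abs_cos_le_one[of "t * kg_symbol \<xi> + \<theta>"]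
    by (auto simp: osc_symbol_def abs_divide divide_le_eq simp del: abs_cos_le_one)
qed

text \<open>The substitute for the group law: a product of two propagators is an average of
  propagators at the difference and at the sum of the times.\<close>

lemma osc_symbol_prod:
  "osc_symbol j \<theta> t \<xi> * osc_symbol j \<theta> s \<xi> =
    (osc_symbol (2 * j) 0 (t - s) \<xi> + osc_symbol (2 * j) (2 * \<theta>) (t + s) \<xi>) / 2"
proof -
  let ?w = "kg_symbol \<xi> ^ j"
  have "kg_symbol \<xi> ^ (2 * j) = ?w * ?w" by (simp add: mult_2 power_add)
  moreover have "cos (t * kg_symbol \<xi> + \<theta>) * cos (s * kg_symbol \<xi> + \<theta>)
     = (cos ((t - s) * kg_symbol \<xi>) + cos ((t + s) * kg_symbol \<xi> + 2 * \<theta>)) / 2"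
    by (simp add: cos_times_cos) (simp add: algebra_simps)
  ultimately show ?thesis
    by (simp only: osc_symbol_def times_divide_times_eq add_0_right add_divide_distrib[symmetric] divide_divide_eq_left mult.commute)
qed

text \<open>Shifting |t| by 1 merges the trivial bound for small times with the dispersive bound for
  large ones and removes the singularity at 0.\<close>

definition decay :: "real \<Rightarrow> real" where
  "decay t = (1 + \<bar>t\<bar>) powr (- 1 / 3)"

lemma decay_pos: "0 < decay t" by (simp add: decay_def)
lemma decay_nonneg [simp]: "0 \<le> decay t" by (simp add: decay_def)
lemma decay_le_1: "decay t \<le> 1"
  using powr_mono2'[of "- 1/3" 1 "1 + \<bar>t\<bar>"] by (simp add: decay_def)
lemma decay_minus [simp]: "decay (- t) = decay t" by (simp add: decay_def)
lemma decay_mono: "\<bar>s\<bar> \<le> \<bar>t\<bar> \<Longrightarrow> decay t \<le> decay s"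
  unfolding decay_def by (intro powr_mono2') auto
lemma decay_le_powr: "t \<noteq> 0 \<Longrightarrow> decay t \<le> \<bar>t\<bar> powr (- 1 / 3)"
  unfolding decay_def by (intro powr_mono2') auto
lemma decay_measurable [measurable]: "decay \<in> borel_measurable borel"
  unfolding decay_def[abs_def] by measurable

lemma decay_small: "\<bar>t\<bar> \<le> 1 \<Longrightarrow> 1 \<le> 2 * decay t"
proof -
  assume "\<bar>t\<bar> \<le> 1"
  then have "2 powr (- 1 / 3) \<le> decay t" unfolding decay_def by (intro powr_mono2') auto
  moreover have "(2::real) powr (- 1) \<le> 2 powr (- 1 / 3)" by (intro powr_mono) auto
  ultimately show ?thesis by simp
qed

lemma decay_large: "1 \<le> t \<Longrightarrow> t powr (- 1 / 3) \<le> 2 * decay t"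
proof -
  assume t: "1 \<le> t"
  have "(2 * t) powr (- 1 / 3) \<le> decay t" unfolding decay_def using t by (intro powr_mono2') auto
  moreover have "(2 * t) powr (- 1 / 3) = 2 powr (- 1 / 3) * t powr (- 1 / 3)"
    by (rule powr_mult)
  moreover have "(2::real) powr (- 1) \<le> 2 powr (- 1 / 3)" by (intro powr_mono) auto
  ultimately have "2 powr (- 1) * t powr (- 1 / 3) \<le> decay t"
    by (smt (verit) mult_right_mono powr_ge_zero)
  then show ?thesis by simp
qed

text \<open>The amplitude is monotone on [0, pi] and at most 1, so the second mean value theorem
  reduces to the pure phase on two subintervals. The sign in \<open>g\<close> again serves to make
  it nondecreasing.\<close>

lemma amplitude_bound:
  assumes t: "1 \<le> t"
  shows "\<bar>integral {0..pi} (\<lambda>\<xi>. cos (t * kg_symbol \<xi> + x * \<xi> + \<theta>) / kg_symbol \<xi> ^ j)\<bar>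
     \<le> 2 * osc_const * t powr (- 1 / 3)"
proof -
  define g where "g \<xi> = - 1 / kg_symbol \<xi> ^ j" for \<xi>
  define f where "f \<xi> = cos (t * kg_symbol \<xi> + x * \<xi> + \<theta>)" for \<xi>
  have int: "f integrable_on {0..pi}"
    unfolding f_def by (intro integrable_continuous_interval continuous_intros)
  have mono: "g u \<le> g v" if "0 \<le> u" "u \<le> v" "v \<le> pi" for u v
  proof -
    have "kg_symbol u ^ j \<le> kg_symbol v ^ j"
      using that kg_symbol_pos[of u] by (intro power_mono kg_symbol_mono) auto
    then show ?thesis using kg_symbol_pos[of u] by (simp add: g_def frac_le)
  qed
  have g1: "\<bar>g u\<bar> \<le> 1" for u
    using one_le_power[OF kg_symbol_ge_1, of u j] by (simp add: g_def)
  obtain c where c: "c \<in> {0..pi}" and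
    eq: "integral {0..pi} (\<lambda>x. g x * f x) = g 0 * integral {0..c} f + g pi * integral {c..pi} f"
    using second_mean_value_theorem[of f 0 pi g] int mono by auto
  have b: "\<bar>integral {u..v} f\<bar> \<le> osc_const * t powr (- 1 / 3)" if "0 \<le> u" "u \<le> v" "v \<le> pi" for u v
    unfolding f_def using oscillatory_integral_bound'[OF t that] .
  have "integral {0..pi} (\<lambda>\<xi>. cos (t * kg_symbol \<xi> + x * \<xi> + \<theta>) / kg_symbol \<xi> ^ j)
     = integral {0..pi} (\<lambda>\<xi>. - (g \<xi> * f \<xi>))"
    by (intro arg_cong[where f="integral _"]) (auto simp: g_def f_def)
  also have "\<dots> = - (g 0 * integral {0..c} f + g pi * integral {c..pi} f)"
    by (simp add: eq)
  finally have "\<bar>integral {0..pi} (\<lambda>\<xi>. cos (t * kg_symbol \<xi> + x * \<xi> + \<theta>) / kg_symbol \<xi> ^ j)\<bar>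
     \<le> \<bar>g 0\<bar> * \<bar>integral {0..c} f\<bar> + \<bar>g pi\<bar> * \<bar>integral {c..pi} f\<bar>"
    by (simp add: abs_mult[symmetric])
  also have "\<dots> \<le> 1 * (osc_const * t powr (- 1 / 3)) + 1 * (osc_const * t powr (- 1 / 3))"
    using c by (intro add_mono mult_mono b g1) auto
  finally show ?thesis by simp
qed

lemma multiplier_kernel_bound:
  assumes [measurable]: "m \<in> borel_measurable borel" and b: "\<And>\<xi>. \<bar>m \<xi>\<bar> \<le> B"
  shows "cmod (multiplier_kernel m n) \<le> B"
proof -
  have "cmod (multiplier_kernel m n) \<le> (\<integral>\<xi>. cmod (complex_of_real (m \<xi>) * cis (of_int n * \<xi>)) \<partial>circle_measure)"
    unfolding multiplier_kernel_circle[OF assms(1)] by (rule integral_norm_bound)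
  also have "\<dots> \<le> B" using b by (intro circle_integral_le) (auto simp: norm_mult)
  finally show ?thesis .
qed

lemma osc_symbol_measurable1 [measurable]: "osc_symbol j \<theta> t \<in> borel_measurable borel"
  by (rule borel_measurable_continuous_onI) (rule continuous_on_osc_symbol)

lemma dispersive_pos:
  assumes t: "0 \<le> t"
  shows "cmod (multiplier_kernel (osc_symbol j \<theta> t) n) \<le> 2 * osc_const * decay t"
proof (cases "1 \<le> t")
  case True
  let ?n = "real_of_int n"
  define G where "G x \<xi> = cos (t * kg_symbol \<xi> + x * \<xi> + \<theta>) / kg_symbol \<xi> ^ j" for x \<xi>
  have avg: "\<bar>(x + y) / 2\<bar> \<le> b" if "\<bar>x\<bar> \<le> b" "\<bar>y\<bar> \<le> b" for x y b :: real
    using that by (auto simp: abs_le_iff)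
  have int: "G x integrable_on {0..pi}" for x
    unfolding G_def by (intro integrable_continuous_interval continuous_intros) (simp add: kg_symbol_nz)
  \<comment> \<open>Product to sum: the phases with +n and -n both fall under the bound that is
    uniform in the linear coefficient.\<close>
  have "osc_symbol j \<theta> t \<xi> * cos (?n * \<xi>) = (G ?n \<xi> + G (- ?n) \<xi>) / 2" for \<xi>
  proof -
    have eqs: "t * kg_symbol \<xi> + ?n * \<xi> + \<theta> = (t * kg_symbol \<xi> + \<theta>) + ?n * \<xi>"
      "t * kg_symbol \<xi> + - ?n * \<xi> + \<theta> = (t * kg_symbol \<xi> + \<theta>) - ?n * \<xi>"
      by simp_all
    show ?thesis
      unfolding osc_symbol_def G_def eqs cos_add[of "_ + \<theta>"] cos_diff[of "_ + \<theta>"]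
      by (simp add: add_divide_distrib diff_divide_distrib)
  qed
  then have "integral {0..pi} (\<lambda>\<xi>. osc_symbol j \<theta> t \<xi> * cos (?n * \<xi>))
      = integral {0..pi} (\<lambda>\<xi>. (G ?n \<xi> + G (- ?n) \<xi>) / 2)"
    by (simp only:)
  also have "\<dots> = (integral {0..pi} (G ?n) + integral {0..pi} (G (- ?n))) / 2"
    by (simp add: integral_add[OF int int])
  also have "\<bar>\<dots>\<bar> \<le> 2 * osc_const * t powr (- 1 / 3)"
    using amplitude_bound[OF True, of ?n \<theta> j] amplitude_bound[OF True, of "- ?n" \<theta> j]
    unfolding G_def[symmetric] by (rule avg)
  finally have *: "\<bar>integral {0..pi} (\<lambda>\<xi>. osc_symbol j \<theta> t \<xi> * cos (?n * \<xi>))\<bar>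
     \<le> 2 * osc_const * t powr (- 1 / 3)" .
  have "cmod (multiplier_kernel (osc_symbol j \<theta> t) n)
     = \<bar>integral {0..pi} (\<lambda>\<xi>. osc_symbol j \<theta> t \<xi> * cos (?n * \<xi>))\<bar> / pi"
    by (subst multiplier_kernel_even[OF continuous_on_osc_symbol]) (auto simp: norm_divide simp flip: of_real_divide)
  also have "\<dots> \<le> (2 * osc_const * t powr (- 1 / 3)) / 2"
    using * pi_ge_two by (intro frac_le) auto
  also have "\<dots> \<le> osc_const * (2 * decay t)"
    using decay_large[OF True] osc_const_ge_1 by simp
  finally show ?thesis by simp
next
  case False
  have "cmod (multiplier_kernel (osc_symbol j \<theta> t) n) \<le> 1"
    by (rule multiplier_kernel_bound) (auto simp: osc_symbol_bound)
  also have "1 \<le> osc_const * (2 * decay t)"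
    using mult_mono[of 1 osc_const 1 "2 * decay t"] decay_small[of t] osc_const_ge_1 False t by simp
  finally show ?thesis by simp
qed

text \<open>Cosine is even, so reversing time amounts to changing the sign of \<theta>.\<close>

lemma dispersive_estimate:
  "cmod (multiplier_kernel (osc_symbol j \<theta> t) n) \<le> 2 * osc_const * decay t"
proof (cases "0 \<le> t")
  case False
  have "osc_symbol j \<theta> t = osc_symbol j (- \<theta>) (- t)"
    by (auto simp: osc_symbol_def fun_eq_iff cos_minus[of "t * _ + \<theta>", symmetric] simp del: cos_minus)
  then show ?thesis using dispersive_pos[of "- t" j "- \<theta>" n] False by simp
qed (rule dispersive_pos)

section \<open>Orthogonality, Bessel's inequality and the l^2 bound for multipliers\<close>

lemma cnj_measurable [measurable (raw)]:
  assumes "f \<in> borel_measurable M"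
  shows "(\<lambda>x. cnj (f x)) \<in> borel_measurable M"
  by (rule measurable_compose[OF assms]) (intro borel_measurable_continuous_onI continuous_intros)

text \<open>This is the orthonormality of the characters, the source of the Parseval identity below.
  It also identifies the kernel of the identity operator for the Taylor expansion of the
  propagators.\<close>

lemma multiplier_kernel_one: "multiplier_kernel (\<lambda>_. 1) n = (if n = 0 then 1 else 0)"
proof -
  have eq: "multiplier_kernel (\<lambda>_. 1) n = complex_of_real (integral {0..pi} (\<lambda>\<xi>. cos (of_int n * \<xi>)) / pi)"
    by (subst multiplier_kernel_even) auto
  show ?thesis
  proof (cases "n = 0")
    case False
    have "((\<lambda>\<xi>. cos (of_int n * \<xi>)) has_integral (sin (of_int n * pi) / of_int n - sin (of_int n * 0) / of_int n)) {0..pi}"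
    proof (rule fundamental_theorem_of_calculus)
      fix x :: real
      have "((\<lambda>\<xi>. sin (of_int n * \<xi>) / of_int n) has_real_derivative cos (of_int n * x)) (at x within {0..pi})"
        using False by (auto intro!: derivative_eq_intros)
      then show "((\<lambda>\<xi>. sin (of_int n * \<xi>) / of_int n) has_vector_derivative cos (of_int n * x)) (at x within {0..pi})"
        by (simp add: has_real_derivative_iff_has_vector_derivative)
    qed simp
    then show ?thesis
      using False unfolding eq by (simp add: integral_unique sin_times_pi_eq_0)
  next
    case True
    show ?thesis unfolding eq by (simp add: True)
  qed
qed

lemma circle_integral_cis: "(\<integral>\<xi>. cis (of_int n * \<xi>) \<partial>circle_measure) = (if n = 0 then 1 else 0)"
  using multiplier_kernel_circle[of "\<lambda>_. 1" n] by (simp add: multiplier_kernel_one)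

lemma circle_integral_trig_poly:
  fixes a :: "int \<Rightarrow> complex"
  assumes "finite A"
  shows "(\<integral>\<xi>. (cmod (\<Sum>k\<in>A. a k * cis (of_int k * \<xi>)))\<^sup>2 \<partial>circle_measure) = (\<Sum>k\<in>A. (cmod (a k))\<^sup>2)"
proof -
  define S where "S \<xi> = (\<Sum>k\<in>A. a k * cis (of_int k * \<xi>))" for \<xi>
  have "complex_of_real ((cmod (S \<xi>))\<^sup>2) = (\<Sum>k\<in>A. \<Sum>l\<in>A. (a k * cnj (a l)) * cis (of_int (k - l) * \<xi>))" for \<xi>
    unfolding S_def complex_norm_square cnj_sum sum_product
    by (intro sum.cong refl) (simp add: cis_cnj cis_mult algebra_simps)
  then have "complex_of_real (\<integral>\<xi>. (cmod (S \<xi>))\<^sup>2 \<partial>circle_measure)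
     = (\<integral>\<xi>. (\<Sum>k\<in>A. \<Sum>l\<in>A. (a k * cnj (a l)) * cis (of_int (k - l) * \<xi>)) \<partial>circle_measure)"
    by (subst integral_complex_of_real[symmetric]) simp
  also have "\<dots> = (\<Sum>k\<in>A. \<Sum>l\<in>A. (a k * cnj (a l)) * (\<integral>\<xi>. cis (of_int (k - l) * \<xi>) \<partial>circle_measure))"
  proof -
    have int: "integrable circle_measure (\<lambda>\<xi>. (a k * cnj (a l)) * cis (of_int (k - l) * \<xi>))" for k l
      by (intro integrable_mult_right circle_integrable_bounded[of _ 1]) auto
    show ?thesis
      by (subst Bochner_Integration.integral_sum[OF Bochner_Integration.integrable_sum[OF int]],
          rule sum.cong[OF refl], subst Bochner_Integration.integral_sum[OF int],
          rule sum.cong[OF refl], rule Bochner_Integration.integral_mult_right_zero)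
  qed
  also have "\<dots> = (\<Sum>k\<in>A. a k * cnj (a k))"
    unfolding circle_integral_cis using assms
    by (intro sum.cong refl) (simp add: if_distrib[where f="\<lambda>x. _ * x"] cong: if_cong)
  also have "\<dots> = complex_of_real (\<Sum>k\<in>A. (cmod (a k))\<^sup>2)"
    unfolding of_real_sum complex_norm_square ..
  finally show ?thesis unfolding S_def of_real_eq_iff .
qed

text \<open>Expands the nonnegative integral of |H - T|^2, where T is the projection of H onto the
  chosen characters. The coefficient \<open>c k\<close> is taken against
  \<open>cis (k * \<xi>)\<close>, so T carries the frequency -k.\<close>

lemma circle_bessel:
  assumes [measurable]: "H \<in> borel_measurable borel" and B: "\<And>\<xi>. cmod (H \<xi>) \<le> B" and A: "finite A"
  shows "(\<Sum>k\<in>A. (cmod (\<integral>\<xi>. H \<xi> * cis (of_int k * \<xi>) \<partial>circle_measure))\<^sup>2)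
    \<le> (\<integral>\<xi>. (cmod (H \<xi>))\<^sup>2 \<partial>circle_measure)"
proof -
  define c where "c k = (\<integral>\<xi>. H \<xi> * cis (of_int k * \<xi>) \<partial>circle_measure)" for k
  define T where "T \<xi> = (\<Sum>k\<in>A. c k * cis (of_int (- k) * \<xi>))" for \<xi>
  define X where "X = (\<Sum>k\<in>A. (cmod (c k))\<^sup>2)"
  have [measurable]: "T \<in> borel_measurable borel" unfolding T_def by measurable
  have Tb: "cmod (T \<xi>) \<le> (\<Sum>k\<in>A. cmod (c k))" for \<xi>
    unfolding T_def by (rule order_trans[OF norm_sum]) (simp add: norm_mult)
  have iH2: "integrable circle_measure (\<lambda>\<xi>. (cmod (H \<xi>))\<^sup>2)"
    by (rule circle_integrable_bounded[of _ "B\<^sup>2"]) (auto intro!: power_mono B)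
  have iT2: "integrable circle_measure (\<lambda>\<xi>. (cmod (T \<xi>))\<^sup>2)"
    by (rule circle_integrable_bounded[of _ "(\<Sum>k\<in>A. cmod (c k))\<^sup>2"]) (auto intro!: power_mono Tb)
  have iHT: "integrable circle_measure (\<lambda>\<xi>. H \<xi> * cnj (T \<xi>))"
    using B Tb by (intro circle_integrable_bounded[of _ "B * (\<Sum>k\<in>A. cmod (c k))"])
      (auto simp: norm_mult intro!: mult_mono sum_nonneg order_trans[OF norm_ge_zero B])
  have T2: "(\<integral>\<xi>. (cmod (T \<xi>))\<^sup>2 \<partial>circle_measure) = X"
  proof -
    have "T \<xi> = (\<Sum>k\<in>uminus ` A. c (- k) * cis (of_int k * \<xi>))" for \<xi>
      unfolding T_def by (subst sum.reindex) (auto simp: inj_on_def)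
    then have "(\<integral>\<xi>. (cmod (T \<xi>))\<^sup>2 \<partial>circle_measure) = (\<Sum>k\<in>uminus ` A. (cmod (c (- k)))\<^sup>2)"
      using circle_integral_trig_poly[of "uminus ` A" "\<lambda>k. c (- k)"] A by simp
    also have "\<dots> = X" unfolding X_def by (subst sum.reindex) (auto simp: inj_on_def)
    finally show ?thesis .
  qed
  have "(\<integral>\<xi>. H \<xi> * cnj (T \<xi>) \<partial>circle_measure) = (\<integral>\<xi>. (\<Sum>k\<in>A. cnj (c k) * (H \<xi> * cis (of_int k * \<xi>))) \<partial>circle_measure)"
    by (intro Bochner_Integration.integral_cong) (auto simp: T_def sum_distrib_left cis_cnj algebra_simps)
  also have "\<dots> = (\<Sum>k\<in>A. cnj (c k) * c k)"
    unfolding c_def using B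
    by (subst Bochner_Integration.integral_sum)
       (auto intro!: integrable_mult_right circle_integrable_bounded[of _ B] simp: norm_mult)
  also have "\<dots> = complex_of_real X"
    unfolding X_def of_real_sum complex_norm_square by (simp add: mult.commute)
  finally have HT: "(\<integral>\<xi>. H \<xi> * cnj (T \<xi>) \<partial>circle_measure) = complex_of_real X" .
  have exp: "(cmod (H \<xi> - T \<xi>))\<^sup>2 = (cmod (H \<xi>))\<^sup>2 - 2 * Re (H \<xi> * cnj (T \<xi>)) + (cmod (T \<xi>))\<^sup>2" for \<xi>
    unfolding cmod_power2 by (simp add: power2_eq_square algebra_simps)
  have "0 \<le> (\<integral>\<xi>. (cmod (H \<xi> - T \<xi>))\<^sup>2 \<partial>circle_measure)"
    by (rule integral_nonneg_AE) simp
  also have "\<dots> = (\<integral>\<xi>. (cmod (H \<xi>))\<^sup>2 \<partial>circle_measure) - 2 * (\<integral>\<xi>. Re (H \<xi> * cnj (T \<xi>)) \<partial>circle_measure)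
      + (\<integral>\<xi>. (cmod (T \<xi>))\<^sup>2 \<partial>circle_measure)"
    unfolding exp using iH2 iT2 integrable_Re[OF iHT]
    by (simp add: Bochner_Integration.integral_add Bochner_Integration.integral_diff del: times_complex.sel)
  also have "(\<integral>\<xi>. Re (H \<xi> * cnj (T \<xi>)) \<partial>circle_measure) = X"
    by (subst integral_Re[OF iHT]) (simp add: HT)
  finally show ?thesis unfolding T2 by (simp add: X_def c_def)
qed

lemma circle_bessel_minus:
  assumes "H \<in> borel_measurable borel" "\<And>\<xi>. cmod (H \<xi>) \<le> B" "finite A"
  shows "(\<Sum>k\<in>A. (cmod (\<integral>\<xi>. H \<xi> * cis (of_int (- k) * \<xi>) \<partial>circle_measure))\<^sup>2)
    \<le> (\<integral>\<xi>. (cmod (H \<xi>))\<^sup>2 \<partial>circle_measure)"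
  using circle_bessel[OF assms(1,2), of "uminus ` A"] assms(3)
  by (simp add: sum.reindex inj_on_def)

text \<open>The output values are Fourier coefficients of m P with P the trigonometric polynomial of
  \<open>a\<close>; Bessel's inequality, |m| at most B and Parseval's identity for P give the bound,
  uniformly in the set of observed sites.\<close>

lemma multiplier_l2_finite:
  fixes a :: "int \<Rightarrow> complex"
  assumes [measurable]: "m \<in> borel_measurable borel" and b: "\<And>\<xi>. \<bar>m \<xi>\<bar> \<le> B"
    and A: "finite A" and N: "finite N"
  shows "(\<Sum>n\<in>N. (cmod (\<Sum>k\<in>A. multiplier_kernel m (n - k) * a k))\<^sup>2) \<le> B\<^sup>2 * (\<Sum>k\<in>A. (cmod (a k))\<^sup>2)"
proof -
  define P where "P \<xi> = (\<Sum>k\<in>A. a k * cis (of_int (- k) * \<xi>))" for \<xi>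
  have [measurable]: "P \<in> borel_measurable borel" unfolding P_def by measurable
  have Pb: "cmod (P \<xi>) \<le> (\<Sum>k\<in>A. cmod (a k))" for \<xi>
    unfolding P_def by (rule order_trans[OF norm_sum]) (simp add: norm_mult)
  have B0: "0 \<le> B" using b[of 0] by linarith
  have mPb: "cmod (complex_of_real (m \<xi>) * P \<xi>) \<le> B * (\<Sum>k\<in>A. cmod (a k))" for \<xi>
    using b[of \<xi>] Pb[of \<xi>] B0 by (auto simp: norm_mult intro!: mult_mono)
  have "(\<Sum>k\<in>A. multiplier_kernel m (n - k) * a k)
     = (\<integral>\<xi>. (complex_of_real (m \<xi>) * P \<xi>) * cis (of_int n * \<xi>) \<partial>circle_measure)" for n
  proof -
    have "(\<Sum>k\<in>A. multiplier_kernel m (n - k) * a k)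
      = (\<Sum>k\<in>A. (\<integral>\<xi>. a k * (complex_of_real (m \<xi>) * cis (of_int (n - k) * \<xi>)) \<partial>circle_measure))"
      by (simp add: multiplier_kernel_circle mult.commute)
    also have "\<dots> = (\<integral>\<xi>. (\<Sum>k\<in>A. a k * (complex_of_real (m \<xi>) * cis (of_int (n - k) * \<xi>))) \<partial>circle_measure)"
      using b by (intro Bochner_Integration.integral_sum[symmetric] integrable_mult_right circle_integrable_bounded[of _ B])
        (auto simp: norm_mult)
    also have "\<dots> = (\<integral>\<xi>. (complex_of_real (m \<xi>) * P \<xi>) * cis (of_int n * \<xi>) \<partial>circle_measure)"
      unfolding P_def sum_distrib_left sum_distrib_right
      by (intro Bochner_Integration.integral_cong refl sum.cong)
         (simp add: cis_mult algebra_simps)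
    finally show ?thesis .
  qed
  then have "(\<Sum>n\<in>N. (cmod (\<Sum>k\<in>A. multiplier_kernel m (n - k) * a k))\<^sup>2)
     \<le> (\<integral>\<xi>. (cmod (complex_of_real (m \<xi>) * P \<xi>))\<^sup>2 \<partial>circle_measure)"
    using circle_bessel[of "\<lambda>\<xi>. complex_of_real (m \<xi>) * P \<xi>", OF _ mPb N] by simp
  also have "\<dots> \<le> (\<integral>\<xi>. B\<^sup>2 * (cmod (P \<xi>))\<^sup>2 \<partial>circle_measure)"
  proof (rule integral_mono)
    show "integrable circle_measure (\<lambda>\<xi>. (cmod (complex_of_real (m \<xi>) * P \<xi>))\<^sup>2)"
      by (rule circle_integrable_bounded[of _ "(B * (\<Sum>k\<in>A. cmod (a k)))\<^sup>2"]) (auto intro!: power_mono mPb simp del: norm_mult)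
    show "integrable circle_measure (\<lambda>\<xi>. B\<^sup>2 * (cmod (P \<xi>))\<^sup>2)"
      by (intro integrable_mult_right circle_integrable_bounded[of _ "(\<Sum>k\<in>A. cmod (a k))\<^sup>2"]) (auto intro!: power_mono Pb)
    show "(cmod (complex_of_real (m \<xi>) * P \<xi>))\<^sup>2 \<le> B\<^sup>2 * (cmod (P \<xi>))\<^sup>2" for \<xi>
      using power_mono[OF b[of \<xi>], of 2] unfolding norm_mult power_mult_distrib by (intro mult_right_mono) auto
  qed
  also have "\<dots> = B\<^sup>2 * (\<Sum>k\<in>A. (cmod (a k))\<^sup>2)"
  proof -
    have "P \<xi> = (\<Sum>k\<in>uminus ` A. a (- k) * cis (of_int k * \<xi>))" for \<xi>
      unfolding P_def by (subst sum.reindex) (auto simp: inj_on_def)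
    then have "(\<integral>\<xi>. (cmod (P \<xi>))\<^sup>2 \<partial>circle_measure) = (\<Sum>k\<in>uminus ` A. (cmod (a (- k)))\<^sup>2)"
      using circle_integral_trig_poly[of "uminus ` A" "\<lambda>k. a (- k)"] A by simp
    also have "\<dots> = (\<Sum>k\<in>A. (cmod (a k))\<^sup>2)" by (subst sum.reindex) (auto simp: inj_on_def)
    finally show ?thesis by simp
  qed
  finally show ?thesis .
qed

section \<open>The Hardy-Littlewood-Sobolev inequality\<close>

lemma Youngs_inequality_nonneg:
  fixes x y :: real
  assumes "0 \<le> a" "a \<le> 1" "0 \<le> x" "0 \<le> y"
  shows "x powr a * y powr (1 - a) \<le> a * x + (1 - a) * y"
proof (cases "x = 0 \<or> y = 0")
  case False
  then show ?thesis using Youngs_inequality_0[of a "1 - a" x y] assms by simp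
qed (use assms in auto)

lemma nn_integral_Holder:
  fixes f g :: "'a \<Rightarrow> real"
  assumes [measurable]: "f \<in> borel_measurable M" "g \<in> borel_measurable M"
    and nn: "\<And>x. 0 \<le> f x" "\<And>x. 0 \<le> g x"
    and a: "0 \<le> a" "a \<le> 1" and AB: "0 \<le> A" "0 \<le> B"
    and f: "(\<integral>\<^sup>+x. f x \<partial>M) \<le> ennreal A" and g: "(\<integral>\<^sup>+x. g x \<partial>M) \<le> ennreal B"
  shows "(\<integral>\<^sup>+x. ennreal (f x powr a * g x powr (1 - a)) \<partial>M) \<le> ennreal (A powr a * B powr (1 - a))"
proof (cases "A = 0 \<or> B = 0")
  \<comment> \<open>Since \<open>0 powr 0 = 0\<close>, a function that vanishes almost everywhere
    makes the left side 0 even at the extreme exponents a = 0 and a = 1. The main case divides by A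
    and B.\<close>
  case True
  then have "(AE x in M. f x = 0) \<or> (AE x in M. g x = 0)"
  proof
    assume "A = 0"
    then have "(\<integral>\<^sup>+x. f x \<partial>M) = 0" using f by simp
    then have "AE x in M. ennreal (f x) = 0" by (subst (asm) nn_integral_0_iff_AE) auto
    then have "AE x in M. f x = 0"
      by eventually_elim (use nn in \<open>simp add: ennreal_eq_0_iff antisym\<close>)
    then show ?thesis by simp
  next
    assume "B = 0"
    then have "(\<integral>\<^sup>+x. g x \<partial>M) = 0" using g by simp
    then have "AE x in M. ennreal (g x) = 0" by (subst (asm) nn_integral_0_iff_AE) auto
    then have "AE x in M. g x = 0"
      by eventually_elim (use nn in \<open>simp add: ennreal_eq_0_iff antisym\<close>)
    then show ?thesis by simp
  qed
  then have "AE x in M. ennreal (f x powr a * g x powr (1 - a)) = 0" by auto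
  then have "(\<integral>\<^sup>+x. ennreal (f x powr a * g x powr (1 - a)) \<partial>M) = 0"
    by (subst nn_integral_0_iff_AE) auto
  then show ?thesis by simp
next
  case False
  with AB have pos: "0 < A" "0 < B" by auto
  let ?K = "A powr a * B powr (1 - a)"
  have pt: "f x powr a * g x powr (1 - a) \<le> ?K * (a / A) * f x + ?K * ((1 - a) / B) * g x" for x
  proof -
    have "f x powr a * g x powr (1 - a) = ?K * ((f x / A) powr a * (g x / B) powr (1 - a))"
      using pos nn by (simp add: powr_divide)
    also have "\<dots> \<le> ?K * (a * (f x / A) + (1 - a) * (g x / B))"
      using pos nn a by (intro mult_left_mono Youngs_inequality_nonneg) auto
    finally show ?thesis by (simp add: algebra_simps)
  qed
  have "(\<integral>\<^sup>+x. ennreal (f x powr a * g x powr (1 - a)) \<partial>M)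
     \<le> (\<integral>\<^sup>+x. ennreal (?K * (a / A)) * ennreal (f x) + ennreal (?K * ((1 - a) / B)) * ennreal (g x) \<partial>M)"
    using pos a nn pt
    by (intro nn_integral_mono) (simp add: ennreal_mult[symmetric] ennreal_plus[symmetric] ennreal_leI del: ennreal_plus)
  also have "\<dots> = ennreal (?K * (a / A)) * (\<integral>\<^sup>+x. f x \<partial>M) + ennreal (?K * ((1 - a) / B)) * (\<integral>\<^sup>+x. g x \<partial>M)"
    by (subst nn_integral_add) (auto simp: nn_integral_cmult)
  also have "\<dots> \<le> ennreal (?K * (a / A)) * ennreal A + ennreal (?K * ((1 - a) / B)) * ennreal B"
    by (intro add_mono mult_left_mono f g) auto
  also have "\<dots> = ennreal (?K * (a / A) * A + ?K * ((1 - a) / B) * B)"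
    using pos a by (simp only: ennreal_mult[symmetric] ennreal_plus[symmetric] mult_nonneg_nonneg
        divide_nonneg_nonneg powr_ge_zero less_imp_le diff_ge_0_iff_ge)
  also have "?K * (a / A) * A + ?K * ((1 - a) / B) * B = ?K"
    using pos by (simp add: field_simps)
  finally show ?thesis .
qed

text \<open>Normalise by 1 + R and use y at most y^s on [0, 1]. It absorbs the shift in
  \<open>decay\<close> when its integral over [-R, R] is bounded by a pure power of R.\<close>

lemma powr_one_plus_le:
  fixes R s :: real
  assumes "0 \<le> R" "0 < s" "s \<le> 1"
  shows "(1 + R) powr s \<le> 1 + R powr s"
proof -
  have le: "x \<le> x powr s" if "0 \<le> x" "x \<le> 1" for x :: real
    using powr_mono'[of s 1 x] that assms by auto
  have "1 = 1 / (1 + R) + R / (1 + R)" using assms by (simp add: add_divide_distrib[symmetric])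
  also have "\<dots> \<le> (1 / (1 + R)) powr s + (R / (1 + R)) powr s"
    using assms by (intro add_mono le) auto
  also have "\<dots> = (1 + R powr s) / (1 + R) powr s"
    using assms by (simp add: powr_divide add_divide_distrib)
  finally show ?thesis using assms by (simp add: pos_le_divide_eq)
qed

lemma decay_near:
  assumes R: "0 \<le> R"
  shows "(\<integral>\<^sup>+y. ennreal (decay y) * indicator {-R..R} y \<partial>lborel) \<le> ennreal (3 * R powr (2 / 3))"
proof -
  let ?I = "\<integral>\<^sup>+y. ennreal (decay y) * indicator {0..R} y \<partial>lborel"
  have "?I = (\<integral>\<^sup>+y. ennreal ((1 + y) powr (- 1 / 3)) * indicator {0..R} y \<partial>lborel)"
    by (intro nn_integral_cong) (auto simp: decay_def split: split_indicator)
  also have "\<dots> = ennreal (3 / 2 * (1 + R) powr (2 / 3) - 3 / 2 * (1 + 0) powr (2 / 3))"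
    by (rule nn_integral_FTC_Icc[OF _ _ _ R]) (use R in \<open>auto intro!: derivative_eq_intros\<close>)
  also have "\<dots> \<le> ennreal (3 / 2 * R powr (2 / 3))"
    using powr_one_plus_le[of R "2/3"] R by (intro ennreal_leI) auto
  finally have I: "?I \<le> ennreal (3 / 2 * R powr (2 / 3))" .
  have "(\<integral>\<^sup>+y. ennreal (decay y) * indicator {-R..R} y \<partial>lborel)
     \<le> (\<integral>\<^sup>+y. ennreal (decay y) * indicator {0..R} y + ennreal (decay y) * indicator {-R..0} y \<partial>lborel)"
    by (intro nn_integral_mono) (auto split: split_indicator)
  also have "\<dots> = ?I + (\<integral>\<^sup>+y. ennreal (decay y) * indicator {-R..0} y \<partial>lborel)"
    by (rule nn_integral_add) auto
  also have "(\<integral>\<^sup>+y. ennreal (decay y) * indicator {-R..0} y \<partial>lborel) = ?I"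
    by (subst nn_integral_real_affine[where c="-1" and t=0])
       (auto intro!: nn_integral_cong split: split_indicator)
  also have "?I + ?I \<le> ennreal (3 / 2 * R powr (2 / 3)) + ennreal (3 / 2 * R powr (2 / 3))"
    by (intro add_mono I)
  also have "\<dots> = ennreal (3 * R powr (2 / 3))"
    by (subst ennreal_plus[symmetric]) auto
  finally show ?thesis .
qed

text \<open>Six is the exponent dual to 6/5, and the sixth power of \<open>decay\<close> is (1 +
  |y|)^(-2), which is integrable at infinity with tail 1/R on each side.\<close>

lemma decay_far:
  assumes R: "0 < R"
  shows "(\<integral>\<^sup>+y. ennreal (decay y ^ 6) * indicator {y. R \<le> \<bar>y\<bar>} y \<partial>lborel) \<le> ennreal (2 / R)"
proof -
  let ?I = "\<integral>\<^sup>+y. ennreal (decay y ^ 6) * indicator {R..} y \<partial>lborel"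
  have d6: "decay y ^ 6 = 1 / (1 + \<bar>y\<bar>)\<^sup>2" for y
  proof -
    have "decay y ^ 6 = (1 + \<bar>y\<bar>) powr (- 2)"
      unfolding decay_def by (subst powr_realpow[symmetric]) (auto simp: powr_powr)
    also have "\<dots> = 1 / (1 + \<bar>y\<bar>)\<^sup>2"
      by (simp add: powr_minus_divide powr_numeral)
    finally show ?thesis .
  qed
  have lim: "((\<lambda>y::real. - 1 / (1 + y)) \<longlongrightarrow> 0) at_top"
    by (intro tendsto_divide_0[OF tendsto_const] filterlim_at_top_imp_at_infinity
        filterlim_tendsto_add_at_top[OF tendsto_const] filterlim_ident)
  have "?I = (\<integral>\<^sup>+y. ennreal (1 / (1 + y)\<^sup>2) * indicator {R..} y \<partial>lborel)"
    using R by (intro nn_integral_cong) (auto simp: d6 split: split_indicator)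
  also have "\<dots> = ennreal (0 - (- 1 / (1 + R)))"
    by (rule nn_integral_FTC_atLeast[OF _ _ _ lim])
       (use R in \<open>auto intro!: derivative_eq_intros simp: power2_eq_square\<close>)
  also have "\<dots> \<le> ennreal (1 / R)" using R by (intro ennreal_leI) (simp add: frac_le)
  finally have I: "?I \<le> ennreal (1 / R)" .
  have "(\<integral>\<^sup>+y. ennreal (decay y ^ 6) * indicator {y. R \<le> \<bar>y\<bar>} y \<partial>lborel)
     \<le> (\<integral>\<^sup>+y. ennreal (decay y ^ 6) * indicator {R..} y + ennreal (decay y ^ 6) * indicator {..-R} y \<partial>lborel)"
    by (intro nn_integral_mono) (auto split: split_indicator)
  also have "\<dots> = ?I + (\<integral>\<^sup>+y. ennreal (decay y ^ 6) * indicator {..-R} y \<partial>lborel)"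
    by (rule nn_integral_add) auto
  also have "(\<integral>\<^sup>+y. ennreal (decay y ^ 6) * indicator {..-R} y \<partial>lborel) = ?I"
    by (subst nn_integral_real_affine[where c="-1" and t=0])
       (auto intro!: nn_integral_cong split: split_indicator)
  also have "?I + ?I \<le> ennreal (1 / R) + ennreal (1 / R)"
    by (intro add_mono I)
  also have "\<dots> = ennreal (2 / R)"
    using R by (subst ennreal_plus[symmetric]) auto
  finally show ?thesis .
qed

text \<open>Near x the truncated function is bounded by the level a and only the mass of
  \<open>decay\<close> matters; far from x Hoelder's inequality with exponents 6/5 and 6 is
  used.\<close>

lemma hls_inner:
  fixes h :: "real \<Rightarrow> real"
  assumes [measurable]: "h \<in> borel_measurable borel" and nn: "\<And>y. 0 \<le> h y"
    and int: "(\<integral>\<^sup>+y. ennreal (h y powr (6 / 5)) \<partial>lborel) \<le> 1" and a: "0 < a"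
  shows "(\<integral>\<^sup>+y. ennreal (indicator {y. h y \<le> a} y * h y * decay (x - y)) \<partial>lborel) \<le> ennreal (5 * a powr (1 / 5))"
proof -
  \<comment> \<open>Balances the two regions: a R^(2/3) and R^(-1/6) both become a^(1/5).\<close>
  define R where "R = a powr (- 6 / 5)"
  have R: "0 < R" using a by (simp add: R_def)
  have shift: "(\<integral>\<^sup>+y. F (x - y) \<partial>lborel) = (\<integral>\<^sup>+y. F y \<partial>lborel)"
    if "F \<in> borel_measurable borel" for F :: "real \<Rightarrow> ennreal"
    using nn_integral_real_affine[OF that, of "-1" x] by simp
  have "(\<integral>\<^sup>+y. ennreal (indicator {y. h y \<le> a} y * h y * decay (x - y)) \<partial>lborel)
     \<le> (\<integral>\<^sup>+y. ennreal a * (ennreal (decay (x - y)) * indicator {-R..R} (x - y))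
          + ennreal (h y * (indicator {y. R \<le> \<bar>y\<bar>} (x - y) * decay (x - y))) \<partial>lborel)"
    using nn a
    by (intro nn_integral_mono)
       (auto split: split_indicator simp: ennreal_mult[symmetric] intro!: ennreal_leI mult_right_mono)
  also have "\<dots> = ennreal a * (\<integral>\<^sup>+y. ennreal (decay (x - y)) * indicator {-R..R} (x - y) \<partial>lborel)
      + (\<integral>\<^sup>+y. ennreal (h y * (indicator {y. R \<le> \<bar>y\<bar>} (x - y) * decay (x - y))) \<partial>lborel)"
    by (subst nn_integral_add) (auto simp: nn_integral_cmult)
  also have "(\<integral>\<^sup>+y. ennreal (decay (x - y)) * indicator {-R..R} (x - y) \<partial>lborel)
      = (\<integral>\<^sup>+y. ennreal (decay y) * indicator {-R..R} y \<partial>lborel)"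
    by (rule shift) measurable
  also have "ennreal a * \<dots> \<le> ennreal a * ennreal (3 * R powr (2 / 3))"
    using R by (intro mult_left_mono decay_near) auto
  also have "\<dots> = ennreal (3 * a powr (1 / 5))"
  proof -
    have "a * R powr (2 / 3) = a powr 1 * a powr (- 4 / 5)"
      using a by (simp add: R_def powr_powr)
    also have "\<dots> = a powr (1 / 5)" by (subst powr_add[symmetric]) simp
    finally show ?thesis using a by (subst ennreal_mult[symmetric]) auto
  qed
  also have "(\<integral>\<^sup>+y. ennreal (h y * (indicator {y. R \<le> \<bar>y\<bar>} (x - y) * decay (x - y))) \<partial>lborel)
     = (\<integral>\<^sup>+y. ennreal ((h y powr (6 / 5)) powr (5 / 6) *
           (indicator {y. R \<le> \<bar>y\<bar>} (x - y) * decay (x - y) ^ 6) powr (1 - 5 / 6)) \<partial>lborel)"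
  proof -
    have "(decay z ^ 6) powr (1 / 6) = (decay z powr 6) powr (1 / 6)" for z
      using decay_pos[of z] by (simp add: powr_numeral)
    then have "(decay z ^ 6) powr (1 / 6) = decay z" for z
      unfolding powr_powr by simp
    then show ?thesis using nn by (intro nn_integral_cong) (auto simp: powr_powr split: split_indicator)
  qed
  also have "\<dots> \<le> ennreal (1 powr (5 / 6) * (2 / R) powr (1 - 5 / 6))"
  proof (rule nn_integral_Holder)
    have "(\<integral>\<^sup>+y. ennreal (indicator {y. R \<le> \<bar>y\<bar>} (x - y) * decay (x - y) ^ 6) \<partial>lborel)
       = (\<integral>\<^sup>+y. ennreal (indicator {y. R \<le> \<bar>y\<bar>} y * decay y ^ 6) \<partial>lborel)"
      by (rule shift) measurable
    also have "\<dots> = (\<integral>\<^sup>+y. ennreal (decay y ^ 6) * indicator {y. R \<le> \<bar>y\<bar>} y \<partial>lborel)"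
      by (intro nn_integral_cong) (auto split: split_indicator)
    also have "\<dots> \<le> ennreal (2 / R)" by (rule decay_far[OF R])
    finally show "(\<integral>\<^sup>+y. ennreal (indicator {y. R \<le> \<bar>y\<bar>} (x - y) * decay (x - y) ^ 6) \<partial>lborel) \<le> ennreal (2 / R)" .
  qed (use R int in auto)
  also have "1 powr (5 / 6) * (2 / R) powr (1 - 5 / 6) = 2 powr (1 / 6) * a powr (1 / 5)"
    using a by (simp add: R_def powr_divide powr_powr powr_minus_divide powr_mult)
  also have "\<dots> \<le> 2 * a powr (1 / 5)"
    using powr_mono[of "1/6" 1 "2::real"] by (intro mult_right_mono) auto
  finally have "(\<integral>\<^sup>+y. ennreal (indicator {y. h y \<le> a} y * h y * decay (x - y)) \<partial>lborel)
     \<le> ennreal (3 * a powr (1 / 5)) + ennreal (2 * a powr (1 / 5))"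
    by (simp add: ennreal_leI)
  also have "\<dots> = ennreal (5 * a powr (1 / 5))"
    by (subst ennreal_plus[symmetric]) auto
  finally show ?thesis .
qed


text \<open>The plane is split according to which of f(x) and h(y) is larger. On one half the inner
  bound at level a = f(x) gives f(x) * 5 f(x)^(1/5) = 5 f(x)^(6/5), which integrates to at most 5;
  the other half is symmetric. Neither rearrangement nor interpolation of operators is
  involved.\<close>

lemma hls_unit:
  fixes f h :: "real \<Rightarrow> real"
  assumes [measurable]: "f \<in> borel_measurable borel" "h \<in> borel_measurable borel"
    and nn: "\<And>y. 0 \<le> f y" "\<And>y. 0 \<le> h y"
    and f: "(\<integral>\<^sup>+y. ennreal (f y powr (6 / 5)) \<partial>lborel) \<le> 1"
    and h: "(\<integral>\<^sup>+y. ennreal (h y powr (6 / 5)) \<partial>lborel) \<le> 1"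
  shows "(\<integral>\<^sup>+x. \<integral>\<^sup>+y. ennreal (f x * h y * decay (x - y)) \<partial>lborel \<partial>lborel) \<le> 10"
proof -
  have half: "(\<integral>\<^sup>+x. \<integral>\<^sup>+y. ennreal (indicator {y. v y \<le> u x} y * (u x * v y * decay (x - y))) \<partial>lborel \<partial>lborel) \<le> 5"
    if [measurable]: "u \<in> borel_measurable borel" "v \<in> borel_measurable borel"
      and nn: "\<And>y. 0 \<le> u y" "\<And>y. 0 \<le> v y"
      and u: "(\<integral>\<^sup>+y. ennreal (u y powr (6 / 5)) \<partial>lborel) \<le> 1"
      and v: "(\<integral>\<^sup>+y. ennreal (v y powr (6 / 5)) \<partial>lborel) \<le> 1" for u v :: "real \<Rightarrow> real"
  proof -
    have "(\<integral>\<^sup>+y. ennreal (indicator {y. v y \<le> u x} y * (u x * v y * decay (x - y))) \<partial>lborel)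
       \<le> 5 * ennreal (u x powr (6 / 5))" for x
    proof (cases "u x = 0")
      case False
      then have pos: "0 < u x" using nn(1)[of x] by simp
      have "(\<integral>\<^sup>+y. ennreal (indicator {y. v y \<le> u x} y * (u x * v y * decay (x - y))) \<partial>lborel)
         = (\<integral>\<^sup>+y. ennreal (u x) * ennreal (indicator {y. v y \<le> u x} y * v y * decay (x - y)) \<partial>lborel)"
        using nn by (intro nn_integral_cong) (simp add: ennreal_mult[symmetric] mult_ac)
      also have "\<dots> = ennreal (u x) * (\<integral>\<^sup>+y. ennreal (indicator {y. v y \<le> u x} y * v y * decay (x - y)) \<partial>lborel)"
        by (rule nn_integral_cmult) measurable
      also have "\<dots> \<le> ennreal (u x) * ennreal (5 * u x powr (1 / 5))"
        by (intro mult_left_mono hls_inner nn v pos) auto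
      also have "\<dots> = ennreal (5 * (u x powr 1 * u x powr (1 / 5)))"
        using pos by (simp add: ennreal_mult[symmetric] mult_ac)
      also have "\<dots> = 5 * ennreal (u x powr (6 / 5))"
        by (subst powr_add[symmetric]) (simp add: ennreal_mult)
      finally show ?thesis .
    qed simp
    then have "(\<integral>\<^sup>+x. \<integral>\<^sup>+y. ennreal (indicator {y. v y \<le> u x} y * (u x * v y * decay (x - y))) \<partial>lborel \<partial>lborel)
      \<le> (\<integral>\<^sup>+x. 5 * ennreal (u x powr (6 / 5)) \<partial>lborel)"
      by (rule nn_integral_mono)
    also have "\<dots> = 5 * (\<integral>\<^sup>+x. ennreal (u x powr (6 / 5)) \<partial>lborel)"
      by (rule nn_integral_cmult) measurable
    also have "\<dots> \<le> 5 * 1" by (intro mult_left_mono u) auto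
    finally show ?thesis by simp
  qed
  have "(\<integral>\<^sup>+x. \<integral>\<^sup>+y. ennreal (f x * h y * decay (x - y)) \<partial>lborel \<partial>lborel)
    \<le> (\<integral>\<^sup>+x. (\<integral>\<^sup>+y. ennreal (indicator {y. h y \<le> f x} y * (f x * h y * decay (x - y))) \<partial>lborel)
        + (\<integral>\<^sup>+y. ennreal (indicator {x. f x \<le> h y} x * (h y * f x * decay (y - x))) \<partial>lborel) \<partial>lborel)"
  proof (rule nn_integral_mono)
    fix x
    have sym: "decay (y - x) = decay (x - y)" for y
      using decay_minus[of "x - y"] by simp
    have "(\<integral>\<^sup>+y. ennreal (f x * h y * decay (x - y)) \<partial>lborel)
      \<le> (\<integral>\<^sup>+y. ennreal (indicator {y. h y \<le> f x} y * (f x * h y * decay (x - y)))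
        + ennreal (indicator {x. f x \<le> h y} x * (h y * f x * decay (y - x))) \<partial>lborel)"
      by (intro nn_integral_mono) (auto simp: sym mult_ac split: split_indicator)
    also have "\<dots> = (\<integral>\<^sup>+y. ennreal (indicator {y. h y \<le> f x} y * (f x * h y * decay (x - y))) \<partial>lborel)
        + (\<integral>\<^sup>+y. ennreal (indicator {x. f x \<le> h y} x * (h y * f x * decay (y - x))) \<partial>lborel)"
      by (rule nn_integral_add) measurable
    finally show "(\<integral>\<^sup>+y. ennreal (f x * h y * decay (x - y)) \<partial>lborel) \<le> \<dots>" .
  qed
  also have "\<dots> = (\<integral>\<^sup>+x. \<integral>\<^sup>+y. ennreal (indicator {y. h y \<le> f x} y * (f x * h y * decay (x - y))) \<partial>lborel \<partial>lborel)
        + (\<integral>\<^sup>+x. \<integral>\<^sup>+y. ennreal (indicator {x. f x \<le> h y} x * (h y * f x * decay (y - x))) \<partial>lborel \<partial>lborel)"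
    by (rule nn_integral_add) measurable
  also have "(\<integral>\<^sup>+x. \<integral>\<^sup>+y. ennreal (indicator {x. f x \<le> h y} x * (h y * f x * decay (y - x))) \<partial>lborel \<partial>lborel)
      = (\<integral>\<^sup>+y. \<integral>\<^sup>+x. ennreal (indicator {x. f x \<le> h y} x * (h y * f x * decay (y - x))) \<partial>lborel \<partial>lborel)"
    by (rule lborel_pair.Fubini') measurable
  also have "(\<integral>\<^sup>+x. \<integral>\<^sup>+y. ennreal (indicator {y. h y \<le> f x} y * (f x * h y * decay (x - y))) \<partial>lborel \<partial>lborel) + \<dots> \<le> 5 + 5"
    by (intro add_mono half nn f h) measurable
  finally show ?thesis by simp
qed

text \<open>Follows from the normalised case by homogeneity. A zero norm cannot be normalised, but
  then one factor vanishes almost everywhere.\<close>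

lemma hls:
  fixes f h :: "real \<Rightarrow> real"
  assumes [measurable]: "f \<in> borel_measurable borel" "h \<in> borel_measurable borel"
    and nn: "\<And>y. 0 \<le> f y" "\<And>y. 0 \<le> h y" and PQ: "0 \<le> P" "0 \<le> Q"
    and f: "(\<integral>\<^sup>+y. ennreal (f y powr (6 / 5)) \<partial>lborel) \<le> ennreal (P powr (6 / 5))"
    and h: "(\<integral>\<^sup>+y. ennreal (h y powr (6 / 5)) \<partial>lborel) \<le> ennreal (Q powr (6 / 5))"
  shows "(\<integral>\<^sup>+x. \<integral>\<^sup>+y. ennreal (f x * h y * decay (x - y)) \<partial>lborel \<partial>lborel) \<le> ennreal (10 * P * Q)"
proof (cases "P = 0 \<or> Q = 0")
  case True
  have z: "AE y in lborel. u y = 0" if "(\<integral>\<^sup>+y. ennreal (u y powr (6 / 5)) \<partial>lborel) \<le> 0"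
    and [measurable]: "u \<in> borel_measurable borel" for u :: "real \<Rightarrow> real"
  proof -
    have "(\<integral>\<^sup>+y. ennreal (u y powr (6 / 5)) \<partial>lborel) = 0" using that(1) by simp
    then have "AE y in lborel. ennreal (u y powr (6 / 5)) = 0" by (subst (asm) nn_integral_0_iff_AE) auto
    then show ?thesis by (auto simp: ennreal_eq_0_iff powr_nonneg_iff)
  qed
  from True have "(AE y in lborel. f y = 0) \<or> (AE y in lborel. h y = 0)"
    using z[of f] z[of h] f h by auto
  then have "AE x in lborel. (\<integral>\<^sup>+y. ennreal (f x * h y * decay (x - y)) \<partial>lborel) = 0"
  proof
    assume "AE y in lborel. h y = 0"
    then have "(\<integral>\<^sup>+y. ennreal (f x * h y * decay (x - y)) \<partial>lborel) = 0" for x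
      by (subst nn_integral_0_iff_AE) auto
    then show ?thesis by simp
  qed auto
  then have "(\<integral>\<^sup>+x. \<integral>\<^sup>+y. ennreal (f x * h y * decay (x - y)) \<partial>lborel \<partial>lborel) = 0"
    by (subst nn_integral_0_iff_AE) auto
  then show ?thesis by simp
next
  case False
  with PQ have pos: "0 < P" "0 < Q" by auto
  have norm: "(\<integral>\<^sup>+y. ennreal ((u y / S) powr (6 / 5)) \<partial>lborel) \<le> 1"
    if "(\<integral>\<^sup>+y. ennreal (u y powr (6 / 5)) \<partial>lborel) \<le> ennreal (S powr (6 / 5))" "0 < S" "\<And>y. 0 \<le> u y"
      and [measurable]: "u \<in> borel_measurable borel" for u :: "real \<Rightarrow> real" and S
  proof -
    have "(\<integral>\<^sup>+y. ennreal ((u y / S) powr (6 / 5)) \<partial>lborel)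
      = (\<integral>\<^sup>+y. ennreal (1 / S powr (6 / 5)) * ennreal (u y powr (6 / 5)) \<partial>lborel)"
      using that by (intro nn_integral_cong) (simp add: powr_divide ennreal_mult[symmetric])
    also have "\<dots> = ennreal (1 / S powr (6 / 5)) * (\<integral>\<^sup>+y. ennreal (u y powr (6 / 5)) \<partial>lborel)"
      by (rule nn_integral_cmult) measurable
    also have "\<dots> \<le> ennreal (1 / S powr (6 / 5)) * ennreal (S powr (6 / 5))"
      by (intro mult_left_mono that) auto
    also have "\<dots> = 1" using that by (simp add: ennreal_mult[symmetric])
    finally show ?thesis .
  qed
  have "(\<integral>\<^sup>+x. \<integral>\<^sup>+y. ennreal (f x * h y * decay (x - y)) \<partial>lborel \<partial>lborel)
     = (\<integral>\<^sup>+x. \<integral>\<^sup>+y. ennreal (P * Q) * ennreal ((f x / P) * (h y / Q) * decay (x - y)) \<partial>lborel \<partial>lborel)"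
    using pos nn by (intro nn_integral_cong) (simp add: ennreal_mult[symmetric])
  also have "\<dots> = ennreal (P * Q) * (\<integral>\<^sup>+x. \<integral>\<^sup>+y. ennreal ((f x / P) * (h y / Q) * decay (x - y)) \<partial>lborel \<partial>lborel)"
    by (simp add: nn_integral_cmult)
  also have "\<dots> \<le> ennreal (P * Q) * 10"
    using pos nn by (intro mult_left_mono hls_unit norm f h) auto
  also have "\<dots> = ennreal (10 * P * Q)"
    using pos by (simp add: ennreal_mult mult_ac)
  finally show ?thesis .
qed

section \<open>Strichartz estimates for finitely supported data\<close>

definition kg_kernel :: "nat \<Rightarrow> real \<Rightarrow> real \<Rightarrow> int \<Rightarrow> complex" where
  "kg_kernel j \<theta> t = multiplier_kernel (osc_symbol j \<theta> t)"

lemma kg_kernel_circle: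
  "kg_kernel j \<theta> t n = (\<integral>\<xi>. complex_of_real (osc_symbol j \<theta> t \<xi>) * cis (of_int n * \<xi>) \<partial>circle_measure)"
  unfolding kg_kernel_def by (rule multiplier_kernel_circle) measurable

lemma kg_kernel_decay: "cmod (kg_kernel j \<theta> t n) \<le> 2 * osc_const * decay t"
  unfolding kg_kernel_def by (rule dispersive_estimate)

lemma kg_kernel_minus: "kg_kernel j \<theta> t (- n) = kg_kernel j \<theta> t n"
  unfolding kg_kernel_def by (rule multiplier_kernel_sym[OF continuous_on_osc_symbol]) simp

lemma kg_kernel_l2_finite:
  assumes "finite A" "finite N"
  shows "(\<Sum>n\<in>N. (cmod (\<Sum>k\<in>A. kg_kernel j \<theta> t (n - k) * a k))\<^sup>2) \<le> (\<Sum>k\<in>A. (cmod (a k))\<^sup>2)"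
  using multiplier_l2_finite[of "osc_symbol j \<theta> t" 1 A N a] assms osc_symbol_bound
  by (simp add: kg_kernel_def)

lemma osc_symbol_measurable_raw [measurable (raw)]:
  assumes [measurable]: "f \<in> borel_measurable M" "g \<in> borel_measurable M"
  shows "(\<lambda>x. osc_symbol j \<theta> (f x) (g x)) \<in> borel_measurable M"
  unfolding osc_symbol_def by measurable

lemma kg_kernel_measurable [measurable (raw)]:
  assumes [measurable]: "\<tau> \<in> borel_measurable M" "\<nu> \<in> measurable M (count_space UNIV)"
  shows "(\<lambda>x. kg_kernel j \<theta> (\<tau> x) (\<nu> x)) \<in> borel_measurable M"
  unfolding kg_kernel_circle
  by (rule circle.borel_measurable_lebesgue_integral) measurable

interpretation lborel_circle: pair_sigma_finite lborel circle_measure ..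

lemma lborel_circle_integrable:
  fixes f :: "real \<Rightarrow> real \<Rightarrow> complex"
  assumes [measurable]: "case_prod f \<in> borel_measurable (borel \<Otimes>\<^sub>M borel)"
    and g: "integrable lborel g" and b: "\<And>x \<xi>. cmod (f x \<xi>) \<le> g x"
  shows "integrable (lborel \<Otimes>\<^sub>M circle_measure) (case_prod f)"
proof (rule lborel_circle.Fubini_integrable)
  have [measurable]: "f x \<in> borel_measurable borel" for x
  proof -
    have "(\<lambda>\<xi>. case_prod f (x, \<xi>)) \<in> borel_measurable borel" by measurable
    then show ?thesis by simp
  qed
  show "integrable lborel (\<lambda>x. \<integral>y. norm (case_prod f (x, y)) \<partial>circle_measure)"
  proof (rule Bochner_Integration.integrable_bound[OF g])
    show "(\<lambda>x. \<integral>y. norm (case_prod f (x, y)) \<partial>circle_measure) \<in> borel_measurable lborel"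
      by (rule circle.borel_measurable_lebesgue_integral) measurable
    have "(\<integral>y. norm (f x y) \<partial>circle_measure) \<le> g x" for x
      by (rule circle_integral_le) (use b in auto)
    moreover have "0 \<le> (\<integral>y. norm (f x y) \<partial>circle_measure)" for x
      by (rule integral_nonneg_AE) simp
    ultimately show "AE x in lborel. norm (\<integral>y. norm (case_prod f (x, y)) \<partial>circle_measure) \<le> norm (g x)"
      by (auto intro!: AE_I2 order_trans[OF _ abs_ge_self])
  qed
  show "AE x in lborel. integrable circle_measure (\<lambda>y. case_prod f (x, y))"
    by (intro AE_I2 circle_integrable_bounded) (auto intro: b)
qed measurable

text \<open>Its square is 2 \<open>osc_const\<close> from the dispersive estimate times 10 from the
  Hardy-Littlewood-Sobolev inequality; the root appears because the dual estimate bounds a square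
  norm.\<close>

definition strichartz_const :: real where
  "strichartz_const = sqrt (20 * osc_const)"

lemma strichartz_const_sq: "strichartz_const\<^sup>2 = 20 * osc_const"
  using osc_const_ge_1 by (simp add: strichartz_const_def)

lemma strichartz_const_ge_1: "1 \<le> strichartz_const"
  using osc_const_ge_1 by (simp add: strichartz_const_def)

text \<open>
  The operator $\psi \mapsto (\int \psi(t) K_{\tau(t)}(\nu(t) - k)\, dt)_k$ is dual to sampling a wave
  along the path $\nu$; its square norm is a double integral that the dispersive estimate controls.
\<close>

lemma dual_strichartz:
  fixes \<psi> :: "real \<Rightarrow> complex" and \<nu> :: "real \<Rightarrow> int" and \<tau> :: "real \<Rightarrow> real"
  assumes \<psi>: "integrable lborel \<psi>"
    and [measurable]: "\<nu> \<in> measurable borel (count_space UNIV)" "\<tau> \<in> borel_measurable borel"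
    and pos: "\<And>x. \<psi> x \<noteq> 0 \<Longrightarrow> 0 \<le> \<tau> x"
    and iso: "\<And>x y. \<bar>\<tau> x - \<tau> y\<bar> = \<bar>x - y\<bar>"
    and P: "0 \<le> P" "(\<integral>\<^sup>+x. ennreal (cmod (\<psi> x) powr (6 / 5)) \<partial>lborel) \<le> ennreal (P powr (6 / 5))"
    and A: "finite A"
  shows "(\<Sum>k\<in>A. (cmod (\<integral>x. \<psi> x * kg_kernel j \<theta> (\<tau> x) (\<nu> x - k) \<partial>lborel))\<^sup>2) \<le> (strichartz_const * P)\<^sup>2"
proof -
  have [measurable]: "\<psi> \<in> borel_measurable borel" using borel_measurable_integrable[OF \<psi>] by simp
  define s where "s x \<xi> = complex_of_real (osc_symbol j \<theta> (\<tau> x) \<xi>) * cis (of_int (\<nu> x) * \<xi>)" for x \<xi>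
  have s_meas [measurable]: "(\<lambda>(x, \<xi>). s x \<xi>) \<in> borel_measurable (borel \<Otimes>\<^sub>M borel)"
    unfolding s_def by measurable
  have sb: "cmod (s x \<xi>) \<le> 1" for x \<xi>
    using osc_symbol_bound by (simp add: s_def norm_mult)
  define H where "H \<xi> = (\<integral>x. \<psi> x * s x \<xi> \<partial>lborel)" for \<xi>
  have H_meas [measurable]: "H \<in> borel_measurable borel"
    unfolding H_def by (rule lborel.borel_measurable_lebesgue_integral) measurable
  have \<psi>n: "integrable lborel (\<lambda>x. cmod (\<psi> x))" using \<psi> by simp
  define L where "L = (\<integral>x. cmod (\<psi> x) \<partial>lborel)"
  have Hb: "cmod (H \<xi>) \<le> L" for \<xi>
  proof -
    have "cmod (H \<xi>) \<le> (\<integral>x. cmod (\<psi> x * s x \<xi>) \<partial>lborel)"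
      unfolding H_def by (rule integral_norm_bound)
    also have "\<dots> \<le> L"
      unfolding L_def
    proof (rule integral_mono')
      show "cmod (\<psi> x * s x \<xi>) \<le> cmod (\<psi> x)" for x
        using mult_left_mono[OF sb norm_ge_zero] by (simp add: norm_mult)
    qed (use \<psi>n in auto)
    finally show ?thesis .
  qed
  have L0: "0 \<le> L" using order_trans[OF norm_ge_zero Hb] .
  have fubini: "(\<integral>\<xi>. (\<integral>x. u x * s' x \<xi> \<partial>lborel) * c \<xi> \<partial>circle_measure)
       = (\<integral>x. u x * (\<integral>\<xi>. s' x \<xi> * c \<xi> \<partial>circle_measure) \<partial>lborel)"
    if u: "integrable lborel u" and [measurable]: "case_prod s' \<in> borel_measurable (borel \<Otimes>\<^sub>M borel)"
      "c \<in> borel_measurable borel" and b: "\<And>x \<xi>. cmod (s' x \<xi>) \<le> 1" "\<And>\<xi>. cmod (c \<xi>) \<le> C"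
    for u :: "real \<Rightarrow> complex" and s' c C
  proof -
    have [measurable]: "u \<in> borel_measurable borel" using borel_measurable_integrable[OF u] by simp
    have C0: "0 \<le> C" using order_trans[OF norm_ge_zero b(2)] .
    have "integrable (lborel \<Otimes>\<^sub>M circle_measure) (case_prod (\<lambda>x \<xi>. u x * s' x \<xi> * c \<xi>))"
    proof (rule lborel_circle_integrable)
      show "integrable lborel (\<lambda>x. cmod (u x) * C)" using u by simp
      have "cmod (u x) * cmod (s' x \<xi>) * cmod (c \<xi>) \<le> cmod (u x) * 1 * C" for x \<xi>
        using C0 by (intro mult_mono b) auto
      then show "cmod (u x * s' x \<xi> * c \<xi>) \<le> cmod (u x) * C" for x \<xi> by (simp add: norm_mult)
    qed measurable
    then have "(\<integral>\<xi>. (\<integral>x. u x * s' x \<xi> * c \<xi> \<partial>lborel) \<partial>circle_measure)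
       = (\<integral>x. (\<integral>\<xi>. u x * s' x \<xi> * c \<xi> \<partial>circle_measure) \<partial>lborel)"
      by (rule lborel_circle.Fubini_integral)
    then show ?thesis
      by (simp only: Bochner_Integration.integral_mult_left_zero)
         (simp only: mult.assoc Bochner_Integration.integral_mult_right_zero)
  qed
  \<comment> \<open>The site values are Fourier coefficients of one function H on the circle, so
    Bessel's inequality leaves only the square integral of H.\<close>
  have coeff: "(\<integral>x. \<psi> x * kg_kernel j \<theta> (\<tau> x) (\<nu> x - k) \<partial>lborel)
      = (\<integral>\<xi>. H \<xi> * cis (of_int (- k) * \<xi>) \<partial>circle_measure)" for k
  proof -
    have "(\<integral>\<xi>. H \<xi> * cis (of_int (- k) * \<xi>) \<partial>circle_measure)
       = (\<integral>x. \<psi> x * (\<integral>\<xi>. s x \<xi> * cis (of_int (- k) * \<xi>) \<partial>circle_measure) \<partial>lborel)"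
      unfolding H_def by (rule fubini[where C = 1, OF \<psi>]) (measurable, simp_all add: sb)
    also have "(\<lambda>x. (\<integral>\<xi>. s x \<xi> * cis (of_int (- k) * \<xi>) \<partial>circle_measure)) = (\<lambda>x. kg_kernel j \<theta> (\<tau> x) (\<nu> x - k))"
      unfolding kg_kernel_circle s_def
      by (intro ext Bochner_Integration.integral_cong) (auto simp: cis_mult algebra_simps)
    finally show ?thesis by (simp add: fun_eq_iff)
  qed
  define G where "G x = (\<integral>\<xi>. s x \<xi> * cnj (H \<xi>) \<partial>circle_measure)" for x
  \<comment> \<open>One of the two factors H is reopened as a time integral; the inner circle
    integral of the two symbols is then computed by \<open>osc_symbol_prod\<close> and seen by the
    dispersive estimate.\<close>
  have H2: "complex_of_real (\<integral>\<xi>. (cmod (H \<xi>))\<^sup>2 \<partial>circle_measure) = (\<integral>x. \<psi> x * G x \<partial>lborel)"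
  proof -
    have "complex_of_real (\<integral>\<xi>. (cmod (H \<xi>))\<^sup>2 \<partial>circle_measure) = (\<integral>\<xi>. H \<xi> * cnj (H \<xi>) \<partial>circle_measure)"
      by (subst integral_complex_of_real[symmetric]) (simp add: complex_norm_square del: of_real_power)
    also have "\<dots> = (\<integral>\<xi>. (\<integral>x. \<psi> x * s x \<xi> \<partial>lborel) * cnj (H \<xi>) \<partial>circle_measure)"
      by (simp add: H_def)
    also have "\<dots> = (\<integral>x. \<psi> x * G x \<partial>lborel)"
      unfolding G_def by (rule fubini[where C = L, OF \<psi>]) (measurable, simp_all add: sb Hb)
    finally show ?thesis .
  qed
  have G: "G x = (\<integral>y. cnj (\<psi> y) * ((kg_kernel (2 * j) 0 (\<tau> x - \<tau> y) (\<nu> x - \<nu> y)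
       + kg_kernel (2 * j) (2 * \<theta>) (\<tau> x + \<tau> y) (\<nu> x - \<nu> y)) / 2) \<partial>lborel)" for x
  proof -
    have "G x = (\<integral>\<xi>. (\<integral>y. cnj (\<psi> y) * cnj (s y \<xi>) \<partial>lborel) * s x \<xi> \<partial>circle_measure)"
    proof -
      have "cnj (H \<xi>) = (\<integral>y. cnj (\<psi> y) * cnj (s y \<xi>) \<partial>lborel)" for \<xi>
        unfolding H_def Bochner_Integration.integral_cnj[symmetric] by simp
      then show ?thesis unfolding G_def by (simp add: mult.commute)
    qed
    also have "\<dots> = (\<integral>y. cnj (\<psi> y) * (\<integral>\<xi>. cnj (s y \<xi>) * s x \<xi> \<partial>circle_measure) \<partial>lborel)"
      by (rule fubini[where C = 1]) (use \<psi> in simp, measurable, simp_all add: sb)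
    also have "(\<lambda>y. \<integral>\<xi>. cnj (s y \<xi>) * s x \<xi> \<partial>circle_measure) =
       (\<lambda>y. (kg_kernel (2 * j) 0 (\<tau> x - \<tau> y) (\<nu> x - \<nu> y)
          + kg_kernel (2 * j) (2 * \<theta>) (\<tau> x + \<tau> y) (\<nu> x - \<nu> y)) / 2)"
    proof
      fix y
      have int: "integrable circle_measure (\<lambda>\<xi>. complex_of_real (osc_symbol i \<eta> t \<xi>) * cis (of_int n * \<xi>))" for i \<eta> t n
        by (rule circle_integrable_bounded[of _ 1]) (auto simp: norm_mult osc_symbol_bound)
      have "cnj (s y \<xi>) * s x \<xi> = complex_of_real (osc_symbol j \<theta> (\<tau> x) \<xi> * osc_symbol j \<theta> (\<tau> y) \<xi>)
            * cis (of_int (\<nu> x - \<nu> y) * \<xi>)" for \<xi>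
        by (simp add: s_def cis_cnj cis_mult algebra_simps)
      also have "\<dots> \<xi> = (complex_of_real (osc_symbol (2 * j) 0 (\<tau> x - \<tau> y) \<xi>) * cis (of_int (\<nu> x - \<nu> y) * \<xi>)
          + complex_of_real (osc_symbol (2 * j) (2 * \<theta>) (\<tau> x + \<tau> y) \<xi>) * cis (of_int (\<nu> x - \<nu> y) * \<xi>)) / 2" for \<xi>
        unfolding osc_symbol_prod by (simp add: distrib_right)
      finally have "(\<integral>\<xi>. cnj (s y \<xi>) * s x \<xi> \<partial>circle_measure) =
        (\<integral>\<xi>. (complex_of_real (osc_symbol (2 * j) 0 (\<tau> x - \<tau> y) \<xi>) * cis (of_int (\<nu> x - \<nu> y) * \<xi>)
          + complex_of_real (osc_symbol (2 * j) (2 * \<theta>) (\<tau> x + \<tau> y) \<xi>) * cis (of_int (\<nu> x - \<nu> y) * \<xi>)) / 2 \<partial>circle_measure)"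
        by (simp only:)
      then show "(\<integral>\<xi>. cnj (s y \<xi>) * s x \<xi> \<partial>circle_measure) = (kg_kernel (2 * j) 0 (\<tau> x - \<tau> y) (\<nu> x - \<nu> y)
          + kg_kernel (2 * j) (2 * \<theta>) (\<tau> x + \<tau> y) (\<nu> x - \<nu> y)) / 2"
        using int by (simp only: kg_kernel_circle Bochner_Integration.integral_divide_zero Bochner_Integration.integral_add)
    qed
    finally show ?thesis by (simp add: fun_eq_iff)
  qed
  have bound: "ennreal (cmod (\<psi> x * G x)) \<le> (\<integral>\<^sup>+y. ennreal (2 * osc_const) * ennreal (cmod (\<psi> x) * cmod (\<psi> y) * decay (x - y)) \<partial>lborel)" for x
  proof (cases "\<psi> x = 0")
    case False
    let ?K = "\<lambda>y. (kg_kernel (2 * j) 0 (\<tau> x - \<tau> y) (\<nu> x - \<nu> y)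
       + kg_kernel (2 * j) (2 * \<theta>) (\<tau> x + \<tau> y) (\<nu> x - \<nu> y)) / 2"
    have K: "cmod (cnj (\<psi> y) * ?K y) \<le> cmod (\<psi> y) * (2 * osc_const * decay (x - y))" for y
    proof (cases "\<psi> y = 0")
      case nz: False
      \<comment> \<open>Nonnegative times make the kernel at \<tau> x + \<tau> y decay at least as
        fast as the one at the difference. The map \<tau> will be the identity, a reflection t - s,
        or a shift t - s in t, all of which preserve distances.\<close>
      have "\<bar>x - y\<bar> \<le> \<bar>\<tau> x + \<tau> y\<bar>"
        using iso[of x y, symmetric] pos[OF False] pos[OF nz] by linarith
      then have d2: "decay (\<tau> x + \<tau> y) \<le> decay (x - y)" by (rule decay_mono)
      have d1: "decay (\<tau> x - \<tau> y) = decay (x - y)"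
        using iso[of x y] by (simp add: decay_def)
      have "cmod (?K y) \<le> (cmod (kg_kernel (2 * j) 0 (\<tau> x - \<tau> y) (\<nu> x - \<nu> y)) +
           cmod (kg_kernel (2 * j) (2 * \<theta>) (\<tau> x + \<tau> y) (\<nu> x - \<nu> y))) / 2"
        by (simp add: norm_divide norm_triangle_ineq)
      also have "\<dots> \<le> (2 * osc_const * decay (x - y) + 2 * osc_const * decay (x - y)) / 2"
        using osc_const_ge_1 d2 d1
        by (intro divide_right_mono add_mono order_trans[OF kg_kernel_decay] mult_left_mono) auto
      also have "\<dots> = 2 * osc_const * decay (x - y)" by simp
      finally have le: "cmod (?K y) \<le> 2 * osc_const * decay (x - y)" .
      show ?thesis
        unfolding norm_mult complex_mod_cnj by (rule mult_left_mono[OF le norm_ge_zero])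
    qed simp
    have int: "integrable lborel (\<lambda>y. cnj (\<psi> y) * ?K y)"
    proof (rule Bochner_Integration.integrable_bound)
      show "integrable lborel (\<lambda>y. cmod (\<psi> y) * (2 * osc_const))" using \<psi> by simp
      have "cmod (\<psi> y) * (2 * osc_const * decay (x - y)) \<le> cmod (\<psi> y) * (2 * osc_const)" for y
        using osc_const_ge_1 decay_le_1[of "x - y"] by (intro mult_left_mono) auto
      from order_trans[OF K this] show "AE y in lborel. cmod (cnj (\<psi> y) * ?K y) \<le> norm (cmod (\<psi> y) * (2 * osc_const))"
        using osc_const_ge_1 by auto
    qed measurable
    have "ennreal (cmod (\<psi> x * G x)) = ennreal (cmod (\<psi> x)) * ennreal (cmod (G x))"
      by (simp add: norm_mult ennreal_mult)
    also have "ennreal (cmod (G x)) \<le> (\<integral>\<^sup>+y. ennreal (cmod (cnj (\<psi> y) * ?K y)) \<partial>lborel)"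
      unfolding G by (rule integral_norm_bound_ennreal[OF int])
    also have "\<dots> \<le> (\<integral>\<^sup>+y. ennreal (cmod (\<psi> y) * (2 * osc_const * decay (x - y))) \<partial>lborel)"
      by (intro nn_integral_mono ennreal_leI K)
    also have "ennreal (cmod (\<psi> x)) * \<dots> = (\<integral>\<^sup>+y. ennreal (cmod (\<psi> x)) * ennreal (cmod (\<psi> y) * (2 * osc_const * decay (x - y))) \<partial>lborel)"
      by (rule nn_integral_cmult[symmetric]) measurable
    also have "\<dots> = (\<integral>\<^sup>+y. ennreal (2 * osc_const) * ennreal (cmod (\<psi> x) * cmod (\<psi> y) * decay (x - y)) \<partial>lborel)"
      using osc_const_ge_1 by (intro nn_integral_cong) (simp add: ennreal_mult[symmetric] mult_ac)
    finally show ?thesis by (simp add: mult_left_mono)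
  qed simp
  have I0: "0 \<le> (\<integral>\<xi>. (cmod (H \<xi>))\<^sup>2 \<partial>circle_measure)" by (rule integral_nonneg_AE) simp
  have "ennreal (\<integral>\<xi>. (cmod (H \<xi>))\<^sup>2 \<partial>circle_measure) = ennreal (cmod (\<integral>x. \<psi> x * G x \<partial>lborel))"
    unfolding H2[symmetric] using I0 by simp
  \<comment> \<open>Where integrability is not known, the Bochner integral of a non-integrable
    function is 0 and the bound is trivial.\<close>
  also have "\<dots> \<le> (\<integral>\<^sup>+x. ennreal (cmod (\<psi> x * G x)) \<partial>lborel)"
    by (cases "integrable lborel (\<lambda>x. \<psi> x * G x)")
       (auto intro: integral_norm_bound_ennreal simp: not_integrable_integral_eq)
  also have "\<dots> \<le> (\<integral>\<^sup>+x. \<integral>\<^sup>+y. ennreal (2 * osc_const) * ennreal (cmod (\<psi> x) * cmod (\<psi> y) * decay (x - y)) \<partial>lborel \<partial>lborel)"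
    by (intro nn_integral_mono bound)
  also have "\<dots> = ennreal (2 * osc_const) * (\<integral>\<^sup>+x. \<integral>\<^sup>+y. ennreal (cmod (\<psi> x) * cmod (\<psi> y) * decay (x - y)) \<partial>lborel \<partial>lborel)"
    by (simp add: nn_integral_cmult)
  also have "\<dots> \<le> ennreal (2 * osc_const) * ennreal (10 * P * P)"
    by (intro mult_left_mono hls P) auto
  also have "\<dots> = ennreal ((strichartz_const * P)\<^sup>2)"
    unfolding power_mult_distrib strichartz_const_sq
    using osc_const_ge_1 P by (simp add: ennreal_mult[symmetric] power2_eq_square mult_ac)
  finally have "(\<integral>\<xi>. (cmod (H \<xi>))\<^sup>2 \<partial>circle_measure) \<le> (strichartz_const * P)\<^sup>2"
    by (subst (asm) ennreal_le_iff) auto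
  moreover have "(\<Sum>k\<in>A. (cmod (\<integral>x. \<psi> x * kg_kernel j \<theta> (\<tau> x) (\<nu> x - k) \<partial>lborel))\<^sup>2)
      \<le> (\<integral>\<xi>. (cmod (H \<xi>))\<^sup>2 \<partial>circle_measure)"
    unfolding coeff by (rule circle_bessel_minus[OF H_meas Hb A])
  ultimately show ?thesis by linarith
qed

text \<open>Candidates are compared one at a time, and a tie keeps the earlier choice. Each
  comparison is a measurable condition, so the selector stays measurable.\<close>

lemma exists_argmax:
  fixes v :: "real \<Rightarrow> int \<Rightarrow> real"
  assumes "finite B" "B \<noteq> {}" and v: "\<And>k. (\<lambda>s. v s k) \<in> borel_measurable borel"
  shows "\<exists>\<kappa>\<in>measurable borel (count_space UNIV). \<forall>s. \<kappa> s \<in> B \<and> (\<forall>k\<in>B. v s k \<le> v s (\<kappa> s))"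
  using assms(1,2)
proof (induction rule: finite_ne_induct)
  case (singleton k)
  show ?case by (intro bexI[of _ "\<lambda>_. k"]) auto
next
  case (insert b B)
  then obtain \<kappa> where [measurable]: "\<kappa> \<in> measurable borel (count_space UNIV)"
    and \<kappa>: "\<And>s. \<kappa> s \<in> B" "\<And>s k. k \<in> B \<Longrightarrow> v s k \<le> v s (\<kappa> s)" by blast
  have [measurable]: "(\<lambda>s. v s b) \<in> borel_measurable borel" "(\<lambda>s. v s (\<kappa> s)) \<in> borel_measurable borel"
    by (rule v) (rule measurable_compose_countable[of "\<lambda>k s. v s k"], rule v, measurable)
  show ?case
  proof (intro bexI[of _ "\<lambda>s. if v s (\<kappa> s) < v s b then b else \<kappa> s"] allI conjI ballI)
    show "(\<lambda>s. if v s (\<kappa> s) < v s b then b else \<kappa> s) \<in> measurable borel (count_space UNIV)"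
      by measurable
    show "v s k \<le> v s (if v s (\<kappa> s) < v s b then b else \<kappa> s)" if "k \<in> insert b B" for s k
      using that \<kappa>(2)[of k s] by auto
  qed (use \<kappa>(1) in auto)
qed

lemma sum_Holder:
  fixes f g :: "'a \<Rightarrow> real"
  assumes "finite A" "\<And>x. 0 \<le> f x" "\<And>x. 0 \<le> g x" "0 \<le> a" "a \<le> 1"
  shows "(\<Sum>x\<in>A. f x powr a * g x powr (1 - a)) \<le> (\<Sum>x\<in>A. f x) powr a * (\<Sum>x\<in>A. g x) powr (1 - a)"
proof -
  have e: "(\<integral>\<^sup>+x. ennreal (h x) \<partial>count_space A) = ennreal (\<Sum>x\<in>A. h x)" if "\<And>x. 0 \<le> h x" for h :: "'a \<Rightarrow> real"
    using assms(1) that by (simp add: nn_integral_count_space_finite)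
  have "(\<integral>\<^sup>+x. ennreal (f x powr a * g x powr (1 - a)) \<partial>count_space A)
     \<le> ennreal ((\<Sum>x\<in>A. f x) powr a * (\<Sum>x\<in>A. g x) powr (1 - a))"
    using assms by (intro nn_integral_Holder) (auto simp: e sum_nonneg)
  then show ?thesis
    using assms by (subst (asm) e) (auto simp: ennreal_le_iff)
qed

text \<open>
  With $1/q = v/6$ and $1/r = (1 - v)/2$, $0 \le v \le 1$, the pair $(q, r)$ runs through the sharp line
  $1/q + 1/(3r) = 1/6$, and the dual exponents are $q' = 6/(6 - v)$ and $r' = 2/(1 + v)$.
\<close>

lemma mixed_pairing_bound:
  fixes F G :: "real \<Rightarrow> int \<Rightarrow> complex" and \<Phi> \<gamma> :: "real \<Rightarrow> real"
  assumes A: "finite A" and v: "0 \<le> v" "v \<le> 1" and NM: "0 \<le> N" "0 \<le> M"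
    and [measurable]: "\<Phi> \<in> borel_measurable borel" "\<gamma> \<in> borel_measurable borel"
    and nn: "\<And>s. 0 \<le> \<Phi> s"
    and F: "\<And>s. (\<Sum>k\<in>A. cmod (F s k) powr (2 / (1 + v))) \<le> \<Phi> s powr (2 / (1 + v))"
    and \<Phi>: "(\<integral>\<^sup>+s. ennreal (\<Phi> s powr (6 / (6 - v))) \<partial>lborel) \<le> ennreal (N powr (6 / (6 - v)))"
    and G2: "\<And>s. (\<Sum>k\<in>A. (cmod (G s k))\<^sup>2) \<le> M\<^sup>2"
    and G\<gamma>: "\<And>s k. k \<in> A \<Longrightarrow> cmod (G s k) \<le> \<gamma> s" and \<gamma>0: "\<And>s. 0 \<le> \<gamma> s"
    and \<gamma>: "\<And>\<phi> P. \<phi> \<in> borel_measurable borel \<Longrightarrow> (\<And>s. 0 \<le> \<phi> s) \<Longrightarrow> 0 \<le> P \<Longrightarrow>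
       (\<integral>\<^sup>+s. ennreal (\<phi> s powr (6 / 5)) \<partial>lborel) \<le> ennreal (P powr (6 / 5)) \<Longrightarrow>
       (\<integral>\<^sup>+s. ennreal (\<phi> s * \<gamma> s) \<partial>lborel) \<le> ennreal (M * P)"
  shows "(\<integral>\<^sup>+s. ennreal (\<Sum>k\<in>A. cmod (F s k) * cmod (G s k)) \<partial>lborel) \<le> ennreal (N * M)"
proof -
  let ?p = "2 / (1 + v)" and ?b = "6 / (6 - v)"
  have split1: "x powr v * x powr (1 - v) = x" if "0 \<le> x" for x :: real
    using that by (cases "x = 0") (auto simp: powr_add[symmetric])
  have e1: "2 / (1 + v) * ((1 + v) / 2) = 1" using v by (simp add: field_simps)
  have e2: "2 * (1 - (1 + v) / 2) = 1 - v" by (simp add: field_simps)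
  have pt: "(\<Sum>k\<in>A. cmod (F s k) * cmod (G s k)) \<le> M powr (1 - v) * (\<Phi> s * \<gamma> s powr v)" for s
  proof -
    \<comment> \<open>The factor |G| is split as |G|^v |G|^(1-v), the first bounded by the sup bound
      \<gamma>. Hoelder's inequality in the site with weights (1+v)/2 and (1-v)/2 then meets exactly
      the l^p bound for F and the l^2 bound for G.\<close>
    have "(\<Sum>k\<in>A. cmod (F s k) * cmod (G s k))
       \<le> (\<Sum>k\<in>A. cmod (F s k) * (\<gamma> s powr v * cmod (G s k) powr (1 - v)))"
    proof (intro sum_mono mult_left_mono)
      fix k assume "k \<in> A"
      then have "cmod (G s k) powr v * cmod (G s k) powr (1 - v) \<le> \<gamma> s powr v * cmod (G s k) powr (1 - v)"
        using v by (intro mult_right_mono powr_mono2 G\<gamma>) auto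
      then show "cmod (G s k) \<le> \<gamma> s powr v * cmod (G s k) powr (1 - v)" by (simp add: split1)
    qed auto
    also have "\<dots> = \<gamma> s powr v * (\<Sum>k\<in>A. (cmod (F s k) powr ?p) powr ((1 + v) / 2) *
         ((cmod (G s k))\<^sup>2) powr (1 - (1 + v) / 2))"
    proof -
      have "(x\<^sup>2) powr (1 - (1 + v) / 2) = x powr (1 - v)" if "0 \<le> x" for x :: real
      proof -
        have "(x\<^sup>2) powr (1 - (1 + v) / 2) = (x powr 2) powr (1 - (1 + v) / 2)"
          using that by (cases "x = 0") (auto simp: powr_numeral)
        also have "\<dots> = x powr (1 - v)" unfolding powr_powr e2 ..
        finally show ?thesis .
      qed
      then show ?thesis
        using v by (simp add: sum_distrib_left powr_powr mult_ac)
    qed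
    also have "\<dots> \<le> \<gamma> s powr v * ((\<Sum>k\<in>A. cmod (F s k) powr ?p) powr ((1 + v) / 2) *
        (\<Sum>k\<in>A. (cmod (G s k))\<^sup>2) powr (1 - (1 + v) / 2))"
      using A v by (intro mult_left_mono sum_Holder) auto
    also have "\<dots> \<le> \<gamma> s powr v * ((\<Phi> s powr ?p) powr ((1 + v) / 2) * (M\<^sup>2) powr (1 - (1 + v) / 2))"
      using v by (intro mult_left_mono mult_mono powr_mono2 F G2) (auto intro!: sum_nonneg)
    also have "(\<Phi> s powr ?p) powr ((1 + v) / 2) = \<Phi> s"
      unfolding powr_powr e1 using nn by simp
    also have "(M\<^sup>2) powr (1 - (1 + v) / 2) = M powr (1 - v)"
    proof -
      have "(M\<^sup>2) powr (1 - (1 + v) / 2) = (M powr 2) powr (1 - (1 + v) / 2)"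
        using NM by (cases "M = 0") (auto simp: powr_numeral)
      also have "\<dots> = M powr (1 - v)" unfolding powr_powr e2 ..
      finally show ?thesis .
    qed
    finally show ?thesis by (simp add: mult_ac)
  qed
  \<comment> \<open>With b = 6/(6-v), the exponents satisfy (5/6) b v + b (1-v) = 1. So \<Phi> can
    be shared between a factor that pairs with \<gamma> and its own integrable power
    \<Phi>^b.\<close>
  have interp: "x = (x powr (5 / 6 * ?b)) powr v * (x powr ?b) powr (1 - v)" if "0 \<le> x" for x :: real
  proof (cases "x = 0")
    case False
    have "5 / 6 * (6 * d) * v + 6 * d * (1 - v) = (6 - v) * d" for d by (simp add: algebra_simps)
    from this[of "inverse (6 - v)"]
    have "5 / 6 * ?b * v + ?b * (1 - v) = (6 - v) * inverse (6 - v)"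
      by (simp only: divide_inverse)
    also have "\<dots> = 1" using v by simp
    finally have "5 / 6 * ?b * v + ?b * (1 - v) = 1" .
    then show ?thesis using False that unfolding powr_powr powr_add[symmetric] by simp
  qed simp
  have "(\<integral>\<^sup>+s. ennreal (\<Sum>k\<in>A. cmod (F s k) * cmod (G s k)) \<partial>lborel)
     \<le> (\<integral>\<^sup>+s. ennreal (M powr (1 - v)) *
          ennreal ((\<Phi> s powr (5 / 6 * ?b) * \<gamma> s) powr v * (\<Phi> s powr ?b) powr (1 - v)) \<partial>lborel)"
  proof (rule nn_integral_mono)
    fix s
    have "\<Phi> s * \<gamma> s powr v = (\<Phi> s powr (5 / 6 * ?b) * \<gamma> s) powr v * (\<Phi> s powr ?b) powr (1 - v)"
      using interp[OF nn[of s]] nn[of s] \<gamma>0[of s] by (simp add: powr_mult mult_ac)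
    then show "ennreal (\<Sum>k\<in>A. cmod (F s k) * cmod (G s k)) \<le> ennreal (M powr (1 - v)) *
          ennreal ((\<Phi> s powr (5 / 6 * ?b) * \<gamma> s) powr v * (\<Phi> s powr ?b) powr (1 - v))"
      using pt[of s] by (simp add: ennreal_mult[symmetric] ennreal_leI)
  qed
  also have "\<dots> = ennreal (M powr (1 - v)) *
      (\<integral>\<^sup>+s. ennreal ((\<Phi> s powr (5 / 6 * ?b) * \<gamma> s) powr v * (\<Phi> s powr ?b) powr (1 - v)) \<partial>lborel)"
    by (rule nn_integral_cmult) measurable
  also have "\<dots> \<le> ennreal (M powr (1 - v)) *
      ennreal ((M * N powr (5 / 6 * ?b)) powr v * (N powr ?b) powr (1 - v))"
  proof (intro mult_left_mono nn_integral_Holder)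
    show "(\<integral>\<^sup>+s. ennreal (\<Phi> s powr (5 / 6 * ?b) * \<gamma> s) \<partial>lborel) \<le> ennreal (M * N powr (5 / 6 * ?b))"
    \<comment> \<open>The assumption on \<gamma> is an L^6 bound in dual form. The test function
      \<Phi>^(5b/6) has 6/5-th power \<Phi>^b, whose integral is controlled by N.\<close>
    proof (rule \<gamma>)
      have "(x powr (5 / 6 * ?b)) powr (6 / 5) = x powr ?b" for x :: real
        unfolding powr_powr by (rule arg_cong[where f = "(powr) x"]) (simp only: divide_inverse, simp)
      then show "(\<integral>\<^sup>+s. ennreal ((\<Phi> s powr (5 / 6 * ?b)) powr (6 / 5)) \<partial>lborel)
        \<le> ennreal ((N powr (5 / 6 * ?b)) powr (6 / 5))"
        using \<Phi> by (simp only:)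
    qed auto
  qed (use nn \<gamma>0 v NM \<Phi> in auto)
  also have "\<dots> = ennreal ((M powr v * M powr (1 - v)) * ((N powr (5 / 6 * ?b)) powr v * (N powr ?b) powr (1 - v)))"
    using NM by (simp add: ennreal_mult[symmetric] powr_mult mult_ac)
  also have "\<dots> = ennreal (N * M)"
    using NM interp[of N] split1[of M] by (simp only: mult.commute)
  finally show ?thesis .
qed

lemma kg_kernel_le_1: "cmod (kg_kernel j \<theta> t n) \<le> 1"
  unfolding kg_kernel_def by (rule multiplier_kernel_bound) (auto simp: osc_symbol_bound)

lemma kg_kernel_integrable:
  assumes \<psi>: "integrable lborel \<psi>"
    and [measurable]: "\<tau> \<in> borel_measurable borel" "\<nu> \<in> measurable borel (count_space UNIV)"
  shows "integrable lborel (\<lambda>x. \<psi> x * kg_kernel j \<theta> (\<tau> x) (\<nu> x))"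
proof (rule Bochner_Integration.integrable_bound[OF \<psi>])
  show "AE x in lborel. norm (\<psi> x * kg_kernel j \<theta> (\<tau> x) (\<nu> x)) \<le> norm (\<psi> x)"
    using mult_left_mono[OF kg_kernel_le_1 norm_ge_zero] by (intro AE_I2) (simp add: norm_mult)
  show "(\<lambda>x. \<psi> x * kg_kernel j \<theta> (\<tau> x) (\<nu> x)) \<in> borel_measurable lborel"
    using borel_measurable_integrable[OF \<psi>] by measurable
qed

lemma sum_mult_le_l2:
  fixes a b :: "'a \<Rightarrow> complex"
  assumes "(\<Sum>k\<in>A. (cmod (a k))\<^sup>2) \<le> X\<^sup>2" "(\<Sum>k\<in>A. (cmod (b k))\<^sup>2) \<le> Y\<^sup>2" "0 \<le> X" "0 \<le> Y"
  shows "cmod (\<Sum>k\<in>A. a k * b k) \<le> X * Y"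
proof -
  have "(\<Sum>k\<in>A. cmod (a k) * cmod (b k))\<^sup>2 \<le> (\<Sum>k\<in>A. (cmod (a k))\<^sup>2) * (\<Sum>k\<in>A. (cmod (b k))\<^sup>2)"
    by (rule Cauchy_Schwarz_ineq_sum)
  also have "\<dots> \<le> X\<^sup>2 * Y\<^sup>2" using assms by (intro mult_mono) (auto intro: sum_nonneg)
  finally have "(\<Sum>k\<in>A. cmod (a k) * cmod (b k))\<^sup>2 \<le> (X * Y)\<^sup>2" by (simp add: power_mult_distrib)
  then have "(\<Sum>k\<in>A. cmod (a k) * cmod (b k)) \<le> X * Y"
    by (rule power2_le_imp_le) (simp add: assms(3,4))
  moreover have "cmod (\<Sum>k\<in>A. a k * b k) \<le> (\<Sum>k\<in>A. cmod (a k) * cmod (b k))"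
    by (rule order_trans[OF norm_sum]) (simp add: norm_mult)
  ultimately show ?thesis by linarith
qed

text \<open>Pointwise \<phi> is at most 1 + \<phi>^c, and the constant is integrable on a bounded
  interval. This supplies the integrability that Bochner integrals and Fubini's theorem ask
  for.\<close>

lemma locally_integrable_powr:
  fixes \<phi> :: "real \<Rightarrow> real"
  assumes [measurable]: "\<phi> \<in> borel_measurable borel" and nn: "\<And>s. 0 \<le> \<phi> s"
    and c: "1 \<le> c" and fin: "(\<integral>\<^sup>+s. ennreal (\<phi> s powr c) \<partial>lborel) < \<infinity>"
  shows "integrable lborel (\<lambda>s. indicator {a..b} s * \<phi> s)"
proof (rule integrableI_nonneg)
  have "(\<integral>\<^sup>+s. ennreal (indicator {a..b} s * \<phi> s) \<partial>lborel)
     \<le> (\<integral>\<^sup>+s. indicator {a..b} s + ennreal (\<phi> s powr c) \<partial>lborel)"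
  proof (intro nn_integral_mono)
    fix s
    have "\<phi> s \<le> 1 + \<phi> s powr c"
    proof (cases "\<phi> s \<le> 1")
      case False
      then have "\<phi> s powr 1 \<le> \<phi> s powr c" using c by (intro powr_mono) auto
      then show ?thesis using nn[of s] by simp
    qed (simp add: add_increasing2)
    then show "ennreal (indicator {a..b} s * \<phi> s) \<le> indicator {a..b} s + ennreal (\<phi> s powr c)"
      by (auto split: split_indicator simp: ennreal_plus[symmetric] ennreal_leI
          simp flip: ennreal_1 simp del: ennreal_plus)
  qed
  also have "\<dots> = emeasure lborel {a..b} + (\<integral>\<^sup>+s. ennreal (\<phi> s powr c) \<partial>lborel)"
    by (subst nn_integral_add) auto
  also have "\<dots> < \<infinity>" using fin by (simp add: emeasure_lborel_Icc_eq)
  finally show "(\<integral>\<^sup>+s. ennreal (indicator {a..b} s * \<phi> s) \<partial>lborel) < \<infinity>" .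
qed (use nn in auto)

text \<open>The norms enter as upper bounds: \<Phi>(s) for the space norm of F(s) with exponent
  2/(1+v), N for the time norm of \<Phi> with exponent 6/(6-v), and E1, E2 for the initial data.
  Such bounds pass unchanged to any window of sites.\<close>

locale kg_finite_data =
  fixes A :: "int set" and f g :: "int \<Rightarrow> complex" and F :: "real \<Rightarrow> int \<Rightarrow> complex"
    and \<Phi> :: "real \<Rightarrow> real" and v N E1 E2 :: real
  assumes A: "finite A" and v: "0 \<le> v" "v \<le> 1" and nonneg: "0 \<le> N" "0 \<le> E1" "0 \<le> E2"
    and F_meas [measurable]: "\<And>k. (\<lambda>s. F s k) \<in> borel_measurable borel"
    and \<Phi>_meas [measurable]: "\<Phi> \<in> borel_measurable borel" and \<Phi>_nonneg: "\<And>s. 0 \<le> \<Phi> s"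
    and F_le: "\<And>s. (\<Sum>k\<in>A. cmod (F s k) powr (2 / (1 + v))) \<le> \<Phi> s powr (2 / (1 + v))"
    and \<Phi>_le: "(\<integral>\<^sup>+s. ennreal (\<Phi> s powr (6 / (6 - v))) \<partial>lborel) \<le> ennreal (N powr (6 / (6 - v)))"
    and f_le: "(\<Sum>k\<in>A. (cmod (f k))\<^sup>2) \<le> E1\<^sup>2" and g_le: "(\<Sum>k\<in>A. (cmod (g k))\<^sup>2) \<le> E2\<^sup>2"
begin

abbreviation C :: real where "C \<equiv> strichartz_const"

lemma C_facts: "0 < C" "1 \<le> C" "C \<le> C\<^sup>2" "1 \<le> C\<^sup>2"
  using strichartz_const_ge_1 self_le_power[of C 2] by auto

definition wave :: "nat \<Rightarrow> real \<Rightarrow> (int \<Rightarrow> complex) \<Rightarrow> real \<Rightarrow> int \<Rightarrow> complex" where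
  "wave j \<theta> a t n = (\<Sum>k\<in>A. kg_kernel j \<theta> t (n - k) * a k)"

definition duhamel :: "real \<Rightarrow> int \<Rightarrow> complex" where
  "duhamel t n = (\<integral>s. (if 0 \<le> s \<and> s \<le> t then \<Sum>k\<in>A. kg_kernel 1 (- pi / 2) (t - s) (n - k) * F s k else 0) \<partial>lborel)"

definition sol :: "real \<Rightarrow> int \<Rightarrow> complex" where
  "sol t n = wave 0 0 f t n + wave 1 (- pi / 2) g t n - duhamel t n"

text \<open>The factor C^2, which is at least 1, is inserted so that the wave and Duhamel
  contributions share one constant in \<open>E\<close>.\<close>

lemma wave_pairing_space:
  assumes B: "finite B" and h: "(\<Sum>n\<in>B. (cmod (h n))\<^sup>2) \<le> X\<^sup>2" "0 \<le> X"
    and a: "(\<Sum>k\<in>A. (cmod (a k))\<^sup>2) \<le> Y\<^sup>2" "0 \<le> Y"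
  shows "cmod (\<Sum>n\<in>B. h n * wave j \<theta> a t n) \<le> C\<^sup>2 * X * Y"
proof -
  have "(\<Sum>n\<in>B. (cmod (wave j \<theta> a t n))\<^sup>2) \<le> Y\<^sup>2"
    unfolding wave_def using kg_kernel_l2_finite[OF A B] a(1) by (rule order_trans)
  then have "cmod (\<Sum>n\<in>B. h n * wave j \<theta> a t n) \<le> X * Y"
    using h a by (intro sum_mult_le_l2) auto
  also have "\<dots> \<le> C\<^sup>2 * (X * Y)"
    using mult_right_mono[OF C_facts(4), of "X * Y"] h a by simp
  finally show ?thesis by (simp add: mult.assoc)
qed

text \<open>Cauchy-Schwarz over the sites after the dual estimate. The time map and the set of sites
  are left free because the Duhamel term uses it with a test sequence in place of data and with
  reversed time.\<close>

lemma path_pairing: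
  assumes \<psi>: "integrable lborel \<psi>"
    and \<nu>: "\<nu> \<in> measurable borel (count_space UNIV)" and \<tau>: "\<tau> \<in> borel_measurable borel"
    and pos: "\<And>x. \<psi> x \<noteq> 0 \<Longrightarrow> 0 \<le> \<tau> x" and iso: "\<And>x y. \<bar>\<tau> x - \<tau> y\<bar> = \<bar>x - y\<bar>"
    and P: "0 \<le> P" "(\<integral>\<^sup>+x. ennreal (cmod (\<psi> x) powr (6 / 5)) \<partial>lborel) \<le> ennreal (P powr (6 / 5))"
    and B: "finite B" and a: "(\<Sum>k\<in>B. (cmod (a k))\<^sup>2) \<le> Y\<^sup>2" "0 \<le> Y"
  shows "cmod (\<integral>x. \<psi> x * (\<Sum>k\<in>B. kg_kernel j \<theta> (\<tau> x) (\<nu> x - k) * a k) \<partial>lborel) \<le> C * P * Y"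
proof -
  note [measurable] = \<nu> \<tau>
  have int: "integrable lborel (\<lambda>x. (\<psi> x * kg_kernel j \<theta> (\<tau> x) (\<nu> x - k)) * a k)" for k
    by (intro integrable_mult_left kg_kernel_integrable \<psi>) measurable
  have "(\<integral>x. \<psi> x * (\<Sum>k\<in>B. kg_kernel j \<theta> (\<tau> x) (\<nu> x - k) * a k) \<partial>lborel)
      = (\<integral>x. (\<Sum>k\<in>B. (\<psi> x * kg_kernel j \<theta> (\<tau> x) (\<nu> x - k)) * a k) \<partial>lborel)"
    by (simp add: sum_distrib_left mult.assoc)
  also have "\<dots> = (\<Sum>k\<in>B. (\<integral>x. \<psi> x * kg_kernel j \<theta> (\<tau> x) (\<nu> x - k) \<partial>lborel) * a k)"
    by (subst Bochner_Integration.integral_sum[OF int]) simp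
  also have "cmod \<dots> \<le> (C * P) * Y"
    using dual_strichartz[OF \<psi> \<nu> \<tau> pos iso P B] P a C_facts by (intro sum_mult_le_l2) auto
  finally show ?thesis .
qed

lemma wave_pairing_path:
  assumes "integrable lborel \<psi>" "\<nu> \<in> measurable borel (count_space UNIV)"
    and "\<And>x. \<psi> x \<noteq> 0 \<Longrightarrow> 0 \<le> x"
    and P: "0 \<le> P" "(\<integral>\<^sup>+x. ennreal (cmod (\<psi> x) powr (6 / 5)) \<partial>lborel) \<le> ennreal (P powr (6 / 5))"
    and a: "(\<Sum>k\<in>A. (cmod (a k))\<^sup>2) \<le> Y\<^sup>2" "0 \<le> Y"
  shows "cmod (\<integral>x. \<psi> x * wave j \<theta> a x (\<nu> x) \<partial>lborel) \<le> C\<^sup>2 * P * Y"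
proof -
  have "cmod (\<integral>x. \<psi> x * wave j \<theta> a x (\<nu> x) \<partial>lborel) \<le> C * P * Y"
    unfolding wave_def by (rule path_pairing) (use assms A in auto)
  also have "\<dots> \<le> C\<^sup>2 * P * Y" using C_facts P a by (intro mult_right_mono) auto
  finally show ?thesis .
qed

lemma F_le_\<Phi>: "k \<in> A \<Longrightarrow> cmod (F s k) \<le> \<Phi> s"
proof -
  assume "k \<in> A"
  then have "cmod (F s k) powr (2 / (1 + v)) \<le> (\<Sum>k\<in>A. cmod (F s k) powr (2 / (1 + v)))"
    using A by (intro member_le_sum) auto
  also note F_le
  finally have "\<not> \<Phi> s < cmod (F s k)"
    using v \<Phi>_nonneg[of s] powr_less_mono2[of "2 / (1 + v)" "\<Phi> s" "cmod (F s k)"] by auto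
  then show ?thesis by simp
qed

lemma \<Phi>_integrable: "integrable lborel (\<lambda>s. indicator {a..b} s * \<Phi> s)"
  using v \<Phi>_le by (intro locally_integrable_powr[of _ "6 / (6 - v)"] \<Phi>_nonneg) (auto simp: le_less_trans)

lemma duhamel_term_integrable:
  assumes "k \<in> A"
  shows "integrable lborel (\<lambda>s. if 0 \<le> s \<and> s \<le> t then kg_kernel j \<theta> (t - s) (n - k) * F s k else 0)"
proof (rule Bochner_Integration.integrable_bound[OF \<Phi>_integrable[of 0 t]])
  have "cmod (kg_kernel j \<theta> (t - s) (n - k)) * cmod (F s k) \<le> 1 * \<Phi> s" for s
    using assms by (intro mult_mono kg_kernel_le_1 F_le_\<Phi>) auto
  then show "AE s in lborel. norm (if 0 \<le> s \<and> s \<le> t then kg_kernel j \<theta> (t - s) (n - k) * F s k else 0)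
      \<le> norm (indicator {0..t} s * \<Phi> s)"
    using \<Phi>_nonneg by (intro AE_I2) (auto simp: norm_mult)
qed measurable

text \<open>The kernel is moved from F to the test sequence h, which yields the wave G issued from h
  and run backwards from time t. G satisfies the l^2 bound and, along its own maximising sites, the
  dual L^6 bound, so \<open>mixed_pairing_bound\<close> applies.\<close>

lemma duhamel_pairing_space:
  assumes B: "finite B" and h: "(\<Sum>n\<in>B. (cmod (h n))\<^sup>2) \<le> X\<^sup>2" "0 \<le> X"
  shows "cmod (\<Sum>n\<in>B. h n * duhamel t n) \<le> C\<^sup>2 * X * N"
proof (cases "A = {}")
  \<comment> \<open>An empty set of sites has no maximising site and is treated apart.\<close>
  case True
  have "duhamel t n = 0" for n unfolding duhamel_def by (simp add: True cong: if_cong)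
  then show ?thesis using h nonneg by simp
next
  case False
  define K where "K = kg_kernel 1 (- pi / 2)"
  have K_meas [measurable]: "(\<lambda>x. K (\<tau> x) (\<nu> x)) \<in> borel_measurable M"
    if [measurable]: "\<tau> \<in> borel_measurable M" "\<nu> \<in> measurable M (count_space UNIV)" for \<tau> \<nu> and M :: "real measure"
    unfolding K_def by measurable
  define G where "G s k = (if 0 \<le> s \<and> s \<le> t then \<Sum>n\<in>B. K (t - s) (k - n) * h n else 0)" for s k
  have G_meas: "(\<lambda>s. cmod (G s k)) \<in> borel_measurable borel" for k
    unfolding G_def by measurable
  obtain \<kappa> where \<kappa>_meas [measurable]: "\<kappa> \<in> measurable borel (count_space UNIV)"
    and \<kappa>: "\<And>s. \<kappa> s \<in> A" "\<And>s k. k \<in> A \<Longrightarrow> cmod (G s k) \<le> cmod (G s (\<kappa> s))"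
    using exists_argmax[of A "\<lambda>s k. cmod (G s k)", OF A False G_meas] by blast
  have G\<kappa>_meas [measurable]: "(\<lambda>s. G s (\<kappa> s)) \<in> borel_measurable borel"
    unfolding G_def by measurable
  have "(\<integral>\<^sup>+s. ennreal (\<Sum>k\<in>A. cmod (F s k) * cmod (G s k)) \<partial>lborel) \<le> ennreal (N * (C * X))"
  proof (rule mixed_pairing_bound[where \<Phi> = \<Phi> and \<gamma> = "\<lambda>s. cmod (G s (\<kappa> s))" and v = v])
    show "(\<Sum>k\<in>A. (cmod (G s k))\<^sup>2) \<le> (C * X)\<^sup>2" for s
    proof (cases "0 \<le> s \<and> s \<le> t")
      case True
      then have "(\<Sum>k\<in>A. (cmod (G s k))\<^sup>2) \<le> X\<^sup>2"
        using order_trans[OF kg_kernel_l2_finite[OF B A] h(1)] by (simp add: G_def K_def)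
      also have "\<dots> \<le> (C * X)\<^sup>2"
        using h(2) mult_right_mono[OF C_facts(2), of X] by (intro power_mono) auto
      finally show ?thesis .
    qed (auto simp: G_def)
    fix \<phi> :: "real \<Rightarrow> real" and P
    assume \<phi>_meas [measurable]: "\<phi> \<in> borel_measurable borel" and \<phi>: "\<And>s. 0 \<le> \<phi> s" "0 \<le> P"
      "(\<integral>\<^sup>+s. ennreal (\<phi> s powr (6 / 5)) \<partial>lborel) \<le> ennreal (P powr (6 / 5))"
    \<comment> \<open>The conjugate phase of G along \<kappa> turns the nonnegative integrand \<phi>
      |G| into the product \<psi> G, to which \<open>path_pairing\<close> applies without
      loss.\<close>
    define \<psi> where "\<psi> s = complex_of_real (indicator {0..t} s * \<phi> s) * cnj (sgn (G s (\<kappa> s)))" for s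
    have sgn_meas [measurable]: "(\<lambda>s. sgn (G s (\<kappa> s))) \<in> borel_measurable borel"
      unfolding sgn_div_norm by measurable
    have \<psi>_meas [measurable]: "\<psi> \<in> borel_measurable borel" unfolding \<psi>_def by measurable
    have \<phi>int: "integrable lborel (\<lambda>s. indicator {0..t} s * \<phi> s)"
      using \<phi> by (intro locally_integrable_powr[of _ "6 / 5"]) (auto simp: le_less_trans)
    have \<psi>le: "cmod (\<psi> s) \<le> indicator {0..t} s * \<phi> s" for s
      using \<phi>(1)[of s] by (simp add: \<psi>_def norm_mult norm_sgn split: split_indicator)
    have \<psi>int: "integrable lborel \<psi>"
      by (rule Bochner_Integration.integrable_bound[OF \<phi>int])
         (use \<psi>le in \<open>auto intro!: AE_I2 order_trans[OF \<psi>le]\<close>)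
    have sg: "cnj (sgn z) * z = complex_of_real (cmod z)" for z :: complex
    proof (cases "z = 0")
      case False
      have "cnj (sgn z) * z = complex_of_real (inverse (cmod z)) * (z * cnj z)"
        by (simp add: sgn_div_norm scaleR_conv_of_real mult_ac)
      also have "\<dots> = complex_of_real (cmod z)"
        unfolding complex_norm_square[symmetric] using False
        by (simp add: power2_eq_square field_simps flip: of_real_mult)
      finally show ?thesis .
    qed simp
    have \<psi>G: "\<psi> s * G s (\<kappa> s) = complex_of_real (\<phi> s * cmod (G s (\<kappa> s)))" for s
    proof -
      have "\<psi> s * G s (\<kappa> s) = complex_of_real (indicator {0..t} s * \<phi> s) * complex_of_real (cmod (G s (\<kappa> s)))"
        unfolding \<psi>_def mult.assoc sg ..
      also have "\<dots> = complex_of_real (\<phi> s * cmod (G s (\<kappa> s)))"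
        by (auto simp: G_def split: split_indicator)
      finally show ?thesis .
    qed
    have eq: "\<psi> s * G s (\<kappa> s) = \<psi> s * (\<Sum>n\<in>B. K (t - s) (\<kappa> s - n) * h n)" for s
      by (auto simp: G_def \<psi>_def)
    have "integrable lborel (\<lambda>s. \<Sum>n\<in>B. (\<psi> s * K (t - s) (\<kappa> s - n)) * h n)"
      unfolding K_def
      by (intro Bochner_Integration.integrable_sum integrable_mult_left kg_kernel_integrable \<psi>int) measurable
    then have int: "integrable lborel (\<lambda>s. \<phi> s * cmod (G s (\<kappa> s)))"
      unfolding complex_of_real_integrable_eq[symmetric] \<psi>G[symmetric] eq
      by (simp add: sum_distrib_left mult.assoc)
    have "(\<integral>\<^sup>+s. ennreal (\<phi> s * cmod (G s (\<kappa> s))) \<partial>lborel) = ennreal (\<integral>s. \<phi> s * cmod (G s (\<kappa> s)) \<partial>lborel)"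
      by (rule nn_integral_eq_integral[OF int]) (use \<phi> in auto)
    also have "(\<integral>s. \<phi> s * cmod (G s (\<kappa> s)) \<partial>lborel) \<le> cmod (\<integral>s. complex_of_real (\<phi> s * cmod (G s (\<kappa> s))) \<partial>lborel)"
      unfolding integral_complex_of_real by simp
    also have "\<dots> = cmod (\<integral>s. \<psi> s * (\<Sum>n\<in>B. K (t - s) (\<kappa> s - n) * h n) \<partial>lborel)"
      unfolding \<psi>G[symmetric] eq ..
    also have "\<dots> \<le> C * P * X"
      unfolding K_def
    proof (rule path_pairing[OF \<psi>int])
      have "(\<integral>\<^sup>+s. ennreal (cmod (\<psi> s) powr (6 / 5)) \<partial>lborel) \<le> (\<integral>\<^sup>+s. ennreal (\<phi> s powr (6 / 5)) \<partial>lborel)"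
      proof (intro nn_integral_mono ennreal_leI powr_mono2)
        show "cmod (\<psi> s) \<le> \<phi> s" for s
          using \<psi>le[of s] \<phi>(1)[of s] by (auto split: split_indicator_asm)
      qed auto
      also note \<phi>(3)
      finally show "(\<integral>\<^sup>+s. ennreal (cmod (\<psi> s) powr (6 / 5)) \<partial>lborel) \<le> ennreal (P powr (6 / 5))" .
      show "\<And>s. \<psi> s \<noteq> 0 \<Longrightarrow> 0 \<le> t - s" by (auto simp: \<psi>_def split: split_indicator_asm)
    qed (use \<phi> B h in auto)
    finally show "(\<integral>\<^sup>+s. ennreal (\<phi> s * cmod (G s (\<kappa> s))) \<partial>lborel) \<le> ennreal (C * X * P)"
      by (simp add: ennreal_leI mult_ac)
  qed (use A v nonneg h C_facts F_le \<Phi>_le \<Phi>_nonneg \<kappa> in auto)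
  then have bound: "(\<integral>\<^sup>+s. ennreal (\<Sum>k\<in>A. cmod (F s k) * cmod (G s k)) \<partial>lborel) \<le> ennreal (N * (C * X))" .
  have "(\<Sum>n\<in>B. h n * duhamel t n)
     = (\<integral>s. (\<Sum>n\<in>B. h n * (\<Sum>k\<in>A. if 0 \<le> s \<and> s \<le> t then K (t - s) (n - k) * F s k else 0)) \<partial>lborel)"
  proof -
    have "duhamel t n = (\<integral>s. (\<Sum>k\<in>A. if 0 \<le> s \<and> s \<le> t then K (t - s) (n - k) * F s k else 0) \<partial>lborel)" for n
      unfolding duhamel_def K_def by (intro Bochner_Integration.integral_cong) auto
    then show ?thesis
      unfolding K_def
      by (subst Bochner_Integration.integral_sum)
         (auto intro!: integrable_mult_right Bochner_Integration.integrable_sum duhamel_term_integrable)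
  qed
  also have "\<dots> = (\<integral>s. (\<Sum>k\<in>A. F s k * G s k) \<partial>lborel)"
  proof (intro Bochner_Integration.integral_cong refl)
    fix s
    \<comment> \<open>Evenness of the kernel in the site makes the transposed operator equal to the
      operator itself.\<close>
    have sym: "K (t - s) (n - k) = K (t - s) (k - n)" for n k
      using kg_kernel_minus[of 1 "- pi / 2" "t - s" "k - n"] by (simp add: K_def)
    show "(\<Sum>n\<in>B. h n * (\<Sum>k\<in>A. if 0 \<le> s \<and> s \<le> t then K (t - s) (n - k) * F s k else 0)) = (\<Sum>k\<in>A. F s k * G s k)"
    proof (cases "0 \<le> s \<and> s \<le> t")
      case True
      have "(\<Sum>n\<in>B. h n * (\<Sum>k\<in>A. K (t - s) (n - k) * F s k)) = (\<Sum>k\<in>A. \<Sum>n\<in>B. h n * (K (t - s) (n - k) * F s k))"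
        unfolding sum_distrib_left by (rule sum.swap)
      also have "\<dots> = (\<Sum>k\<in>A. \<Sum>n\<in>B. F s k * (K (t - s) (k - n) * h n))"
        by (intro sum.cong refl) (subst sym, simp add: mult_ac)
      finally show ?thesis using True by (simp add: G_def sum_distrib_left)
    qed (auto simp: G_def)
  qed
  also have "ennreal (cmod \<dots>) \<le> (\<integral>\<^sup>+s. ennreal (cmod (\<Sum>k\<in>A. F s k * G s k)) \<partial>lborel)"
    by (cases "integrable lborel (\<lambda>s. \<Sum>k\<in>A. F s k * G s k)")
       (auto intro: integral_norm_bound_ennreal simp: not_integrable_integral_eq)
  also have "\<dots> \<le> (\<integral>\<^sup>+s. ennreal (\<Sum>k\<in>A. cmod (F s k) * cmod (G s k)) \<partial>lborel)"
    by (intro nn_integral_mono ennreal_leI order_trans[OF norm_sum]) (simp add: norm_mult)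
  also note bound
  finally have "cmod (\<Sum>n\<in>B. h n * duhamel t n) \<le> N * (C * X)"
    using nonneg h C_facts by (subst (asm) ennreal_le_iff) auto
  also have "\<dots> \<le> N * (C\<^sup>2 * X)"
    using nonneg h C_facts by (intro mult_left_mono mult_right_mono) auto
  finally show ?thesis by (simp add: mult_ac)
qed

end

context kg_finite_data
begin

lemma duhamel_pairing_path:
  assumes \<psi>: "integrable lborel \<psi>" and \<nu> [measurable]: "\<nu> \<in> measurable borel (count_space UNIV)"
    and T: "\<And>x. \<psi> x \<noteq> 0 \<Longrightarrow> 0 \<le> x \<and> x \<le> T"
    and P: "0 \<le> P" "(\<integral>\<^sup>+x. ennreal (cmod (\<psi> x) powr (6 / 5)) \<partial>lborel) \<le> ennreal (P powr (6 / 5))"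
  shows "cmod (\<integral>t. \<psi> t * duhamel t (\<nu> t) \<partial>lborel) \<le> C\<^sup>2 * P * N"
proof -
  have \<psi>_meas [measurable]: "\<psi> \<in> borel_measurable borel" using borel_measurable_integrable[OF \<psi>] by simp
  define K where "K = kg_kernel 1 (- pi / 2)"
  have K_meas [measurable]: "(\<lambda>x. K (\<tau> x) (\<mu> x)) \<in> borel_measurable M"
    if [measurable]: "\<tau> \<in> borel_measurable M" "\<mu> \<in> measurable M (count_space UNIV)" for \<tau> \<mu> and M :: "real measure"
    unfolding K_def by measurable
  have K_meas2 [measurable]: "(\<lambda>x. K (\<tau> x) (\<mu> x)) \<in> borel_measurable M"
    if [measurable]: "\<tau> \<in> borel_measurable M" "\<mu> \<in> measurable M (count_space UNIV)" for \<tau> \<mu> and M :: "(real \<times> real) measure"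
    unfolding K_def by measurable
  \<comment> \<open>The ordering s at most t is placed in the test function rather than in the
    kernel. Cutting \<psi> down does not increase its L^(6/5) norm, so the dual estimate holds for
    every s with the same constant.\<close>
  define w where "w t s = (if 0 \<le> s \<and> s \<le> t then \<psi> t else 0)" for t s
  have w_meas [measurable]: "(\<lambda>(t, s). w t s) \<in> borel_measurable (borel \<Otimes>\<^sub>M borel)"
    unfolding w_def by measurable
  have w_meas1 [measurable]: "(\<lambda>t. w t s) \<in> borel_measurable borel" for s
    unfolding w_def by measurable
  have w_int: "integrable lborel (\<lambda>t. w t s)" for s
    by (rule Bochner_Integration.integrable_bound[OF \<psi>]) (auto simp: w_def)
  define G where "G s k = (\<integral>t. w t s * K (t - s) (\<nu> t - k) \<partial>lborel)" for s k
  \<comment> \<open>A majorant of |G(s, k)| independent of k, from the dispersive estimate. Paired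
    with a test function it is the Hardy-Littlewood-Sobolev form, with constant 2
    \<open>osc_const\<close> * 10 = C^2.\<close>
  define \<gamma> where "\<gamma> s = (\<integral>t. cmod (\<psi> t) * (2 * osc_const * decay (t - s)) \<partial>lborel)" for s
  have \<gamma>_int: "integrable lborel (\<lambda>t. cmod (\<psi> t) * (2 * osc_const * decay (t - s)))" for s
  proof (rule Bochner_Integration.integrable_bound)
    show "integrable lborel (\<lambda>t. cmod (\<psi> t) * (2 * osc_const))" using \<psi> by simp
    have "cmod (\<psi> t) * (2 * osc_const * decay (t - s)) \<le> cmod (\<psi> t) * (2 * osc_const)" for t
      using osc_const_ge_1 decay_le_1[of "t - s"] by (intro mult_left_mono) auto
    then show "AE t in lborel. norm (cmod (\<psi> t) * (2 * osc_const * decay (t - s))) \<le> norm (cmod (\<psi> t) * (2 * osc_const))"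
      using osc_const_ge_1 by (auto simp: abs_mult)
  qed measurable
  have \<gamma>_meas [measurable]: "\<gamma> \<in> borel_measurable borel"
    unfolding \<gamma>_def by (rule lborel.borel_measurable_lebesgue_integral) measurable
  have \<gamma>0: "0 \<le> \<gamma> s" for s
    unfolding \<gamma>_def using osc_const_ge_1 by (intro integral_nonneg_AE) auto
  have "(\<integral>\<^sup>+s. ennreal (\<Sum>k\<in>A. cmod (F s k) * cmod (G s k)) \<partial>lborel) \<le> ennreal (N * (C\<^sup>2 * P))"
  proof (rule mixed_pairing_bound[where \<Phi> = \<Phi> and \<gamma> = \<gamma> and v = v])
    show "(\<Sum>k\<in>A. (cmod (G s k))\<^sup>2) \<le> (C\<^sup>2 * P)\<^sup>2" for s
    proof -
      have "(\<Sum>k\<in>A. (cmod (G s k))\<^sup>2) \<le> (C * P)\<^sup>2"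
        unfolding G_def K_def
      proof (rule dual_strichartz[OF w_int \<nu>])
        have "(\<integral>\<^sup>+x. ennreal (cmod (w x s) powr (6 / 5)) \<partial>lborel) \<le> (\<integral>\<^sup>+x. ennreal (cmod (\<psi> x) powr (6 / 5)) \<partial>lborel)"
          by (intro nn_integral_mono) (auto simp: w_def)
        also note P(2)
        finally show "(\<integral>\<^sup>+x. ennreal (cmod (w x s) powr (6 / 5)) \<partial>lborel) \<le> ennreal (P powr (6 / 5))" .
        show "\<And>t. w t s \<noteq> 0 \<Longrightarrow> 0 \<le> t - s" by (auto simp: w_def split: if_splits)
      qed (use P A in auto)
      also have "\<dots> \<le> (C\<^sup>2 * P)\<^sup>2"
        using P C_facts by (intro power_mono mult_right_mono) auto
      finally show ?thesis .
    qed
    show "cmod (G s k) \<le> \<gamma> s" for s k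
    proof -
      have "cmod (G s k) \<le> (\<integral>t. cmod (w t s * K (t - s) (\<nu> t - k)) \<partial>lborel)"
        unfolding G_def by (rule integral_norm_bound)
      also have "\<dots> \<le> \<gamma> s"
        unfolding \<gamma>_def
      proof (rule integral_mono'[OF \<gamma>_int])
        show "cmod (w t s * K (t - s) (\<nu> t - k)) \<le> cmod (\<psi> t) * (2 * osc_const * decay (t - s))" for t
          unfolding norm_mult K_def using osc_const_ge_1
          by (intro mult_mono kg_kernel_decay) (auto simp: w_def)
      qed (use osc_const_ge_1 in auto)
      finally show ?thesis .
    qed
    fix \<phi> :: "real \<Rightarrow> real" and Q
    assume \<phi>_meas [measurable]: "\<phi> \<in> borel_measurable borel" and \<phi>: "\<And>s. 0 \<le> \<phi> s" "0 \<le> Q"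
      "(\<integral>\<^sup>+s. ennreal (\<phi> s powr (6 / 5)) \<partial>lborel) \<le> ennreal (Q powr (6 / 5))"
    have "(\<integral>\<^sup>+s. ennreal (\<phi> s * \<gamma> s) \<partial>lborel)
        = (\<integral>\<^sup>+s. \<integral>\<^sup>+t. ennreal (2 * osc_const) * ennreal (\<phi> s * cmod (\<psi> t) * decay (s - t)) \<partial>lborel \<partial>lborel)"
    proof (intro nn_integral_cong)
      fix s
      have "ennreal (\<gamma> s) = (\<integral>\<^sup>+t. ennreal (cmod (\<psi> t) * (2 * osc_const * decay (t - s))) \<partial>lborel)"
        unfolding \<gamma>_def using osc_const_ge_1 by (intro nn_integral_eq_integral[symmetric] \<gamma>_int) auto
      then have "ennreal (\<phi> s * \<gamma> s) = ennreal (\<phi> s) * (\<integral>\<^sup>+t. ennreal (cmod (\<psi> t) * (2 * osc_const * decay (t - s))) \<partial>lborel)"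
        using \<phi> \<gamma>0 by (simp add: ennreal_mult)
      also have "\<dots> = (\<integral>\<^sup>+t. ennreal (\<phi> s) * ennreal (cmod (\<psi> t) * (2 * osc_const * decay (t - s))) \<partial>lborel)"
        by (rule nn_integral_cmult[symmetric]) measurable
      also have "\<dots> = (\<integral>\<^sup>+t. ennreal (2 * osc_const) * ennreal (\<phi> s * cmod (\<psi> t) * decay (s - t)) \<partial>lborel)"
        using osc_const_ge_1 \<phi>(1)[of s] decay_minus[of "s - _"]
        by (intro nn_integral_cong) (simp add: ennreal_mult[symmetric] mult_ac)
      finally show "ennreal (\<phi> s * \<gamma> s) = \<dots>" .
    qed
    also have "\<dots> = ennreal (2 * osc_const) * (\<integral>\<^sup>+s. \<integral>\<^sup>+t. ennreal (\<phi> s * cmod (\<psi> t) * decay (s - t)) \<partial>lborel \<partial>lborel)"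
      by (simp add: nn_integral_cmult)
    also have "\<dots> \<le> ennreal (2 * osc_const) * ennreal (10 * Q * P)"
      by (intro mult_left_mono hls P \<phi>) auto
    also have "\<dots> = ennreal (C\<^sup>2 * P * Q)"
      unfolding strichartz_const_sq
      using osc_const_ge_1 P \<phi> by (simp add: ennreal_mult[symmetric] mult_ac)
    finally show "(\<integral>\<^sup>+s. ennreal (\<phi> s * \<gamma> s) \<partial>lborel) \<le> ennreal (C\<^sup>2 * P * Q)" .
  qed (use A v nonneg P C_facts F_le \<Phi>_le \<Phi>_nonneg \<gamma>0 in auto)
  then have bound: "(\<integral>\<^sup>+s. ennreal (\<Sum>k\<in>A. cmod (F s k) * cmod (G s k)) \<partial>lborel) \<le> ennreal (N * (C\<^sup>2 * P))" .
  define J where "J k t s = w t s * K (t - s) (\<nu> t - k) * F s k" for k t s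
  have J_meas [measurable]: "(\<lambda>(t, s). J k t s) \<in> borel_measurable (borel \<Otimes>\<^sub>M borel)" for k
    unfolding J_def by measurable
  \<comment> \<open>Because \<psi> is supported in [0, T], the integrand is dominated by a product
    of an integrable function of t and one of s. This justifies Fubini's theorem.\<close>
  have J_le: "cmod (J k t s) \<le> cmod (\<psi> t) * (indicator {0..T} s * \<Phi> s)" if "k \<in> A" for k t s
  proof (cases "0 \<le> s \<and> s \<le> t \<and> \<psi> t \<noteq> 0")
    case True
    have "cmod (\<psi> t) * cmod (K (t - s) (\<nu> t - k)) * cmod (F s k) \<le> cmod (\<psi> t) * 1 * \<Phi> s"
      unfolding K_def using that by (intro mult_mono kg_kernel_le_1 F_le_\<Phi>) auto
    then show ?thesis using True T[of t] by (auto simp: J_def w_def norm_mult)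
  qed (auto simp: J_def w_def \<Phi>_nonneg)
  have J_int: "integrable (lborel \<Otimes>\<^sub>M lborel) (case_prod (J k))" if k: "k \<in> A" for k
  proof (rule Bochner_Integration.integrable_bound)
    show "integrable (lborel \<Otimes>\<^sub>M lborel) (\<lambda>(t, s). cmod (\<psi> t) * (indicator {0..T} s * \<Phi> s))"
    proof (rule lborel_pair.Fubini_integrable)
      show "AE t in lborel. integrable lborel (\<lambda>s. case (t, s) of (t, s) \<Rightarrow> cmod (\<psi> t) * (indicator {0..T} s * \<Phi> s))"
        using \<Phi>_integrable by simp
      show "integrable lborel (\<lambda>t. \<integral>s. norm (case (t, s) of (t, s) \<Rightarrow> cmod (\<psi> t) * (indicator {0..T} s * \<Phi> s)) \<partial>lborel)"
        using \<psi> by (simp add: abs_mult)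
    qed measurable
    show "AE x in lborel \<Otimes>\<^sub>M lborel. norm (case_prod (J k) x) \<le> norm (case x of (t, s) \<Rightarrow> cmod (\<psi> t) * (indicator {0..T} s * \<Phi> s))"
      using J_le[OF k] by (intro AE_I2) (auto intro!: order_trans[OF _ abs_ge_self])
  qed measurable
  have "(\<integral>t. \<psi> t * duhamel t (\<nu> t) \<partial>lborel) = (\<integral>t. (\<integral>s. (\<Sum>k\<in>A. J k t s) \<partial>lborel) \<partial>lborel)"
  proof (intro Bochner_Integration.integral_cong refl)
    fix t
    have "\<psi> t * duhamel t (\<nu> t) = (\<integral>s. \<psi> t * (if 0 \<le> s \<and> s \<le> t then \<Sum>k\<in>A. K (t - s) (\<nu> t - k) * F s k else 0) \<partial>lborel)"
      unfolding duhamel_def K_def by simp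
    also have "\<dots> = (\<integral>s. (\<Sum>k\<in>A. J k t s) \<partial>lborel)"
      by (intro Bochner_Integration.integral_cong) (auto simp: J_def w_def sum_distrib_left mult.assoc)
    finally show "\<psi> t * duhamel t (\<nu> t) = \<dots>" .
  qed
  also have "\<dots> = (\<integral>s. (\<integral>t. (\<Sum>k\<in>A. J k t s) \<partial>lborel) \<partial>lborel)"
  proof (rule lborel_pair.Fubini_integral[symmetric])
    show "integrable (lborel \<Otimes>\<^sub>M lborel) (\<lambda>(t, s). \<Sum>k\<in>A. J k t s)"
      using Bochner_Integration.integrable_sum[of A "lborel \<Otimes>\<^sub>M lborel" "\<lambda>k. case_prod (J k)", OF J_int]
      by (simp add: case_prod_beta')
  qed
  also have "\<dots> = (\<integral>s. (\<Sum>k\<in>A. F s k * G s k) \<partial>lborel)"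
  proof (intro Bochner_Integration.integral_cong refl)
    fix s
    have "integrable lborel (\<lambda>t. J k t s)" for k
      unfolding J_def K_def by (intro integrable_mult_left kg_kernel_integrable w_int) measurable
    then have "(\<integral>t. (\<Sum>k\<in>A. J k t s) \<partial>lborel) = (\<Sum>k\<in>A. \<integral>t. J k t s \<partial>lborel)"
      by (intro Bochner_Integration.integral_sum)
    then show "(\<integral>t. (\<Sum>k\<in>A. J k t s) \<partial>lborel) = (\<Sum>k\<in>A. F s k * G s k)"
      by (simp add: J_def G_def mult.commute)
  qed
  also have "ennreal (cmod \<dots>) \<le> (\<integral>\<^sup>+s. ennreal (cmod (\<Sum>k\<in>A. F s k * G s k)) \<partial>lborel)"
    by (cases "integrable lborel (\<lambda>s. \<Sum>k\<in>A. F s k * G s k)")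
       (auto intro: integral_norm_bound_ennreal simp: not_integrable_integral_eq)
  also have "\<dots> \<le> (\<integral>\<^sup>+s. ennreal (\<Sum>k\<in>A. cmod (F s k) * cmod (G s k)) \<partial>lborel)"
    by (intro nn_integral_mono ennreal_leI order_trans[OF norm_sum]) (simp add: norm_mult)
  also note bound
  finally have "cmod (\<integral>t. \<psi> t * duhamel t (\<nu> t) \<partial>lborel) \<le> N * (C\<^sup>2 * P)"
    using nonneg P by (subst (asm) ennreal_le_iff) auto
  then show ?thesis by (simp add: mult_ac)
qed

definition E :: real where "E = C\<^sup>2 * (E1 + E2 + N)"

lemma E_nonneg: "0 \<le> E"
  using nonneg by (simp add: E_def)

lemma sol_l2_bound:
  assumes B: "finite B"
  shows "(\<Sum>n\<in>B. (cmod (sol t n))\<^sup>2) \<le> E\<^sup>2"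
proof -
  define X where "X = sqrt (\<Sum>n\<in>B. (cmod (sol t n))\<^sup>2)"
  have X0: "0 \<le> X" by (simp add: X_def sum_nonneg)
  have X2: "(\<Sum>n\<in>B. (cmod (sol t n))\<^sup>2) = X\<^sup>2" by (simp add: X_def sum_nonneg)
  \<comment> \<open>The solution is tested against its own conjugate, so the linear bound becomes
    X^2 at most E X and X cancels unless it is 0.\<close>
  define h where "h n = cnj (sol t n)" for n
  have h: "(\<Sum>n\<in>B. (cmod (h n))\<^sup>2) \<le> X\<^sup>2" by (simp add: h_def X2)
  have "complex_of_real (X\<^sup>2) = (\<Sum>n\<in>B. h n * sol t n)"
    unfolding X2[symmetric] of_real_sum complex_norm_square h_def by (simp add: mult.commute)
  also have "\<dots> = (\<Sum>n\<in>B. h n * wave 0 0 f t n) + (\<Sum>n\<in>B. h n * wave 1 (- pi / 2) g t n)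
      - (\<Sum>n\<in>B. h n * duhamel t n)"
    by (simp add: sol_def algebra_simps sum.distrib sum_subtractf)
  finally have "X\<^sup>2 = cmod ((\<Sum>n\<in>B. h n * wave 0 0 f t n) + (\<Sum>n\<in>B. h n * wave 1 (- pi / 2) g t n)
      - (\<Sum>n\<in>B. h n * duhamel t n))"
    by (metis abs_power2 norm_of_real)
  also have "\<dots> \<le> cmod (\<Sum>n\<in>B. h n * wave 0 0 f t n) + cmod (\<Sum>n\<in>B. h n * wave 1 (- pi / 2) g t n)
      + cmod (\<Sum>n\<in>B. h n * duhamel t n)"
    by (rule order_trans[OF norm_triangle_ineq4 add_right_mono[OF norm_triangle_ineq]])
  also have "\<dots> \<le> C\<^sup>2 * X * E1 + C\<^sup>2 * X * E2 + C\<^sup>2 * X * N"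
    by (intro add_mono wave_pairing_space duhamel_pairing_space B h X0 f_le g_le nonneg)
  also have "\<dots> = E * X" by (simp add: E_def algebra_simps)
  finally have "X * X \<le> E * X" by (simp add: power2_eq_square)
  then have "X \<le> E" using X0 E_nonneg by (cases "X = 0") (auto simp: mult_le_cancel_right)
  then show ?thesis unfolding X2 using X0 by (rule power_mono)
qed

lemma sol_sup_bound: "cmod (sol t n) \<le> E"
  using sol_l2_bound[of "{n}" t] E_nonneg by (intro power2_le_imp_le[of "cmod (sol t n)"]) auto

lemma sol_path_measurable [measurable]:
  assumes \<nu> [measurable]: "\<nu> \<in> measurable borel (count_space UNIV)"
  shows "(\<lambda>t. wave j \<theta> a t (\<nu> t)) \<in> borel_measurable borel"
    "(\<lambda>t. duhamel t (\<nu> t)) \<in> borel_measurable borel"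
    "(\<lambda>t. sol t (\<nu> t)) \<in> borel_measurable borel"
proof -
  show *: "(\<lambda>t. wave j \<theta> a t (\<nu> t)) \<in> borel_measurable borel" for j \<theta> a
    unfolding wave_def by measurable
  show **: "(\<lambda>t. duhamel t (\<nu> t)) \<in> borel_measurable borel"
    unfolding duhamel_def by (rule lborel.borel_measurable_lebesgue_integral) measurable
  show "(\<lambda>t. sol t (\<nu> t)) \<in> borel_measurable borel"
    unfolding sol_def by (intro borel_measurable_add borel_measurable_diff * **)
qed

lemma sol_strichartz_path:
  assumes \<nu> [measurable]: "\<nu> \<in> measurable borel (count_space UNIV)"
  shows "(\<integral>\<^sup>+t. ennreal (indicator {0..T} t * cmod (sol t (\<nu> t)) ^ 6) \<partial>lborel) \<le> ennreal (E ^ 6)"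
proof -
  define u where "u t = sol t (\<nu> t)" for t
  have u_meas [measurable]: "u \<in> borel_measurable borel" unfolding u_def by measurable
  have u_le: "cmod (u t) \<le> E" for t unfolding u_def by (rule sol_sup_bound)
  \<comment> \<open>Restricted to [0, T], this integral is finite a priori because the solution is
    bounded by E. Finiteness is what allows the cancellation of I^(5/6) at the end.\<close>
  define I where "I = (\<integral>t. indicator {0..T} t * cmod (u t) ^ 6 \<partial>lborel)"
  have const_int: "integrable lborel (\<lambda>t. indicator {0..T} t * c)" for c :: real
    by (intro integrable_mult_left integrable_real_indicator) (auto simp: emeasure_lborel_Icc_eq)
  have pow_int: "integrable lborel (\<lambda>t. indicator {0..T} t * cmod (u t) ^ m)" for m
    by (rule Bochner_Integration.integrable_bound[OF const_int[of "E ^ m"]])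
       (use u_le E_nonneg in \<open>auto intro!: AE_I2 power_mono split: split_indicator\<close>)
  have I0: "0 \<le> I" unfolding I_def by (intro integral_nonneg_AE) auto
  define \<psi> where "\<psi> t = complex_of_real (indicator {0..T} t * cmod (u t) ^ 4) * cnj (u t)" for t
  have \<psi>_meas [measurable]: "\<psi> \<in> borel_measurable borel" unfolding \<psi>_def by measurable
  have \<psi>_norm: "cmod (\<psi> t) = indicator {0..T} t * cmod (u t) ^ 5" for t
    by (simp add: \<psi>_def norm_mult norm_power eval_nat_numeral split: split_indicator)
  have \<psi>: "integrable lborel \<psi>"
    by (rule Bochner_Integration.integrable_bound[OF pow_int[of 5]]) (auto simp: \<psi>_norm)
  have \<psi>u: "\<psi> t * u t = complex_of_real (indicator {0..T} t * cmod (u t) ^ 6)" for t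
  proof -
    have "\<psi> t * u t = complex_of_real (indicator {0..T} t * cmod (u t) ^ 4) * complex_of_real ((cmod (u t))\<^sup>2)"
      unfolding complex_norm_square \<psi>_def by (simp add: mult_ac)
    also have "\<dots> = complex_of_real (indicator {0..T} t * cmod (u t) ^ 6)"
      unfolding of_real_mult[symmetric] by (simp add: eval_nat_numeral mult_ac)
    finally show ?thesis .
  qed
  \<comment> \<open>The test function has modulus |u|^5, so its 6/5-th power integrates to I, and P
    is its L^(6/5) norm. The pairing bound then reads I at most E I^(5/6), hence I at most
    E^6.\<close>
  define P where "P = I powr (5 / 6)"
  have P0: "0 \<le> P" by (simp add: P_def)
  have P: "(\<integral>\<^sup>+t. ennreal (cmod (\<psi> t) powr (6 / 5)) \<partial>lborel) \<le> ennreal (P powr (6 / 5))"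
  proof -
    have "(x ^ 5) powr (6 / 5) = x ^ 6" if "0 \<le> x" for x :: real
    proof (cases "x = 0")
      case False
      with that have "(x ^ 5) powr (6 / 5) = (x powr real 5) powr (6 / 5)" "x ^ 6 = x powr real 6"
        by (subst powr_realpow, auto)+
      then show ?thesis unfolding powr_powr by simp
    qed simp
    then have "(\<integral>\<^sup>+t. ennreal (cmod (\<psi> t) powr (6 / 5)) \<partial>lborel)
        = (\<integral>\<^sup>+t. ennreal (indicator {0..T} t * cmod (u t) ^ 6) \<partial>lborel)"
      by (intro nn_integral_cong) (simp add: \<psi>_norm split: split_indicator)
    also have "\<dots> = ennreal I"
      unfolding I_def by (rule nn_integral_eq_integral[OF pow_int]) auto
    also have "I = P powr (6 / 5)" unfolding P_def powr_powr using I0 by simp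
    finally show ?thesis by simp
  qed
  have T: "0 \<le> t \<and> t \<le> T" if "\<psi> t \<noteq> 0" for t
    using that by (auto simp: \<psi>_def split: split_indicator_asm)
  have bint: "integrable lborel (\<lambda>t. \<psi> t * z t)"
    if [measurable]: "z \<in> borel_measurable borel" and z: "\<And>t. cmod (z t) \<le> c" for z :: "real \<Rightarrow> complex" and c
  proof (rule Bochner_Integration.integrable_bound)
    show "integrable lborel (\<lambda>t. \<psi> t * complex_of_real c)" using \<psi> by simp
    show "AE t in lborel. norm (\<psi> t * z t) \<le> norm (\<psi> t * complex_of_real c)"
      using z by (intro AE_I2) (auto simp: norm_mult intro!: mult_left_mono order_trans[OF z abs_ge_self])
  qed measurable
  have wave_le: "cmod (wave j \<theta> a t n) \<le> (\<Sum>k\<in>A. cmod (a k))" for j \<theta> a t n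
    unfolding wave_def
    by (rule order_trans[OF norm_sum], rule sum_mono)
       (use mult_right_mono[OF kg_kernel_le_1 norm_ge_zero] in \<open>simp add: norm_mult\<close>)
  have i1: "integrable lborel (\<lambda>t. \<psi> t * wave j \<theta> a t (\<nu> t))" for j \<theta> a
    by (rule bint[OF _ wave_le]) measurable
  have i2: "integrable lborel (\<lambda>t. \<psi> t * u t)"
    by (rule bint[OF _ u_le]) measurable
  have "complex_of_real I = (\<integral>t. \<psi> t * u t \<partial>lborel)"
    unfolding I_def \<psi>u by (rule integral_complex_of_real[symmetric])
  \<comment> \<open>The Duhamel term is written as a difference of terms already known to be
    integrable, so linearity of the integral applies to it as well.\<close>
  moreover have "(\<integral>t. \<psi> t * duhamel t (\<nu> t) \<partial>lborel)
     = (\<integral>t. \<psi> t * wave 0 0 f t (\<nu> t) \<partial>lborel) + (\<integral>t. \<psi> t * wave 1 (- pi / 2) g t (\<nu> t) \<partial>lborel) - (\<integral>t. \<psi> t * u t \<partial>lborel)"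
  proof -
    have "\<psi> t * duhamel t (\<nu> t) = \<psi> t * wave 0 0 f t (\<nu> t) + \<psi> t * wave 1 (- pi / 2) g t (\<nu> t) - \<psi> t * u t" for t
      by (simp add: u_def sol_def algebra_simps)
    then show ?thesis using i1 i2 by simp
  qed
  ultimately have "complex_of_real I = (\<integral>t. \<psi> t * wave 0 0 f t (\<nu> t) \<partial>lborel) + (\<integral>t. \<psi> t * wave 1 (- pi / 2) g t (\<nu> t) \<partial>lborel)
     - (\<integral>t. \<psi> t * duhamel t (\<nu> t) \<partial>lborel)"
    by simp
  then have "I = cmod ((\<integral>t. \<psi> t * wave 0 0 f t (\<nu> t) \<partial>lborel) + (\<integral>t. \<psi> t * wave 1 (- pi / 2) g t (\<nu> t) \<partial>lborel)
     - (\<integral>t. \<psi> t * duhamel t (\<nu> t) \<partial>lborel))"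
    using I0 by (metis abs_of_nonneg norm_of_real)
  also have "\<dots> \<le> cmod (\<integral>t. \<psi> t * wave 0 0 f t (\<nu> t) \<partial>lborel) + cmod (\<integral>t. \<psi> t * wave 1 (- pi / 2) g t (\<nu> t) \<partial>lborel)
     + cmod (\<integral>t. \<psi> t * duhamel t (\<nu> t) \<partial>lborel)"
    by (rule order_trans[OF norm_triangle_ineq4 add_right_mono[OF norm_triangle_ineq]])
  also have "\<dots> \<le> C\<^sup>2 * P * E1 + C\<^sup>2 * P * E2 + C\<^sup>2 * P * N"
    by (intro add_mono wave_pairing_path duhamel_pairing_path[where T = T] \<psi> \<nu> P0 P f_le g_le nonneg)
       (use T in auto)
  also have "\<dots> = E * P" by (simp add: E_def algebra_simps)
  finally have IE: "I \<le> E * I powr (5 / 6)" by (simp add: P_def)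
  have "I \<le> E ^ 6"
  proof (cases "I = 0")
    case False
    then have Ipos: "0 < I" using I0 by simp
    have "I powr (1 / 6) * I powr (5 / 6) = I"
      using Ipos by (simp add: powr_add[symmetric])
    then have "I powr (1 / 6) * I powr (5 / 6) \<le> E * I powr (5 / 6)" using IE by simp
    then have "I powr (1 / 6) \<le> E" using Ipos by (simp add: mult_le_cancel_right)
    then have "(I powr (1 / 6)) ^ 6 \<le> E ^ 6" by (rule power_mono) simp
    moreover have "(I powr (1 / 6)) ^ 6 = I"
      using Ipos by (subst powr_realpow[symmetric]) (auto simp: powr_powr)
    ultimately show ?thesis by simp
  qed (use E_nonneg in simp)
  moreover have "(\<integral>\<^sup>+t. ennreal (indicator {0..T} t * cmod (u t) ^ 6) \<partial>lborel) = ennreal I"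
    unfolding I_def by (rule nn_integral_eq_integral[OF pow_int]) auto
  ultimately show ?thesis unfolding u_def by (simp add: ennreal_leI)
qed

end

section \<open>Strichartz estimates for general data\<close>

text \<open>Unconditional sums are limits along all finite sets of sites. The windows from -m to m
  are cofinal, so such a sum is also the limit of a sequence, as dominated convergence and Fatou's
  lemma require.\<close>

lemma filterlim_symmetric_intervals:
  "filterlim (\<lambda>m. {- int m..int m}) (finite_subsets_at_top UNIV) sequentially"
  unfolding filterlim_finite_subsets_at_top
proof (intro allI impI)
  fix X :: "int set"
  assume "finite X \<and> X \<subseteq> UNIV"
  then have "finite ((\<lambda>k. nat \<bar>k\<bar>) ` X)" by simp
  then obtain M where M: "\<And>k. k \<in> X \<Longrightarrow> nat \<bar>k\<bar> \<le> M"
    unfolding finite_nat_set_iff_bounded_le by auto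
  show "\<forall>\<^sub>F m in sequentially. finite {- int m..int m} \<and> X \<subseteq> {- int m..int m} \<and> {- int m..int m} \<subseteq> UNIV"
    using eventually_ge_at_top[of M]
  proof eventually_elim
    case (elim m)
    have "k \<in> {- int m..int m}" if "k \<in> X" for k using M[OF that] elim by auto
    then show ?case by auto
  qed
qed

lemma has_sum_symmetric_limit:
  "(f has_sum S) UNIV \<Longrightarrow> (\<lambda>m. \<Sum>k\<in>{- int m..int m}. f k) \<longlonglongrightarrow> S"
  unfolding has_sum_def using filterlim_compose[OF _ filterlim_symmetric_intervals] by blast

text \<open>The l^2 bound applied to a delta at 0 and read on the reflected window. With
  Cauchy-Schwarz it makes the series of a multiplier converge absolutely on l^2 data.\<close>

lemma multiplier_kernel_l2:
  assumes "m \<in> borel_measurable borel" "\<And>\<xi>. \<bar>m \<xi>\<bar> \<le> B" "finite A"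
  shows "(\<Sum>k\<in>A. (cmod (multiplier_kernel m (n - k)))\<^sup>2) \<le> B\<^sup>2"
  using multiplier_l2_finite[OF assms(1,2), of "{0}" "(\<lambda>k. n - k) ` A" "\<lambda>_. 1"] assms(3)
  by (simp add: sum.reindex inj_on_def)

lemma fourier_multiplier_partial_bound:
  assumes "m \<in> borel_measurable borel" and b: "\<And>\<xi>. \<bar>m \<xi>\<bar> \<le> B"
    and a: "(\<Sum>k\<in>A. (cmod (a k))\<^sup>2) \<le> E\<^sup>2" "0 \<le> E" and A: "finite A"
  shows "(\<Sum>k\<in>A. cmod (multiplier_kernel m (n - k) * a k)) \<le> B * E"
proof -
  have B0: "0 \<le> B" using b[of 0] by linarith
  have "cmod (\<Sum>k\<in>A. complex_of_real (cmod (multiplier_kernel m (n - k))) * complex_of_real (cmod (a k))) \<le> B * E"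
    using multiplier_kernel_l2[OF assms(1,2) A, of n] a B0 by (intro sum_mult_le_l2) auto
  then show ?thesis
    unfolding of_real_mult[symmetric] of_real_sum[symmetric] norm_of_real norm_mult by linarith
qed

text \<open>Stated by finite partial sums and a real bound, the form in which the finite estimates
  deliver and consume it; \<open>lp_norm_2_le_iff\<close> links it with
  \<open>lp_norm\<close>.\<close>

definition l2_le :: "(int \<Rightarrow> complex) \<Rightarrow> real \<Rightarrow> bool" where
  "l2_le a E \<longleftrightarrow> 0 \<le> E \<and> (\<forall>A. finite A \<longrightarrow> (\<Sum>k\<in>A. (cmod (a k))\<^sup>2) \<le> E\<^sup>2)"

lemma l2_leD:
  assumes "l2_le a E"
  shows "0 \<le> E" "finite A \<Longrightarrow> (\<Sum>k\<in>A. (cmod (a k))\<^sup>2) \<le> E\<^sup>2"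
  using assms by (auto simp: l2_le_def)

lemma fourier_multiplier_has_sum:
  assumes m: "m \<in> borel_measurable borel" "\<And>\<xi>. \<bar>m \<xi>\<bar> \<le> B" and a: "l2_le a E"
  shows "((\<lambda>k. multiplier_kernel m (n - k) * a k) has_sum fourier_multiplier m a n) UNIV"
    and "cmod (fourier_multiplier m a n) \<le> B * E"
proof -
  have le: "(\<Sum>k\<in>A. cmod (multiplier_kernel m (n - k) * a k)) \<le> B * E" if "finite A" for A
    by (rule fourier_multiplier_partial_bound[OF m l2_leD(2)[OF a that] l2_leD(1)[OF a] that])
  have "(\<lambda>k. cmod (multiplier_kernel m (n - k) * a k)) summable_on UNIV"
    by (rule nonneg_bdd_above_summable_on) (auto intro!: bdd_aboveI2 le)
  then have "(\<lambda>k. multiplier_kernel m (n - k) * a k) summable_on UNIV"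
    by (rule abs_summable_summable)
  then show hs: "((\<lambda>k. multiplier_kernel m (n - k) * a k) has_sum fourier_multiplier m a n) UNIV"
    unfolding fourier_multiplier_def by (rule has_sum_infsum)
  have "(\<lambda>j. cmod (\<Sum>k\<in>{- int j..int j}. multiplier_kernel m (n - k) * a k)) \<longlonglongrightarrow> cmod (fourier_multiplier m a n)"
    by (intro tendsto_norm has_sum_symmetric_limit hs)
  then show "cmod (fourier_multiplier m a n) \<le> B * E"
    by (rule LIMSEQ_le_const2) (intro exI[of _ 0] allI impI order_trans[OF norm_sum] le, simp)
qed

text \<open>Each term is at most B, so x^q is at most B^(q-p) x^p. This embedding of sequence spaces
  absorbs the slack in the admissibility conditions.\<close>

lemma sum_powr_embed:
  fixes x :: "'a \<Rightarrow> real"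
  assumes "(\<Sum>k\<in>A. x k powr p) \<le> B powr p" "0 < p" "p \<le> q" "0 \<le> B" "finite A" "\<And>k. 0 \<le> x k"
  shows "(\<Sum>k\<in>A. x k powr q) \<le> B powr q"
proof -
  have xB: "x k \<le> B" if "k \<in> A" for k
  proof -
    have "x k powr p \<le> (\<Sum>k\<in>A. x k powr p)" using assms that by (intro member_le_sum) auto
    also note assms(1)
    finally have "\<not> B < x k" using assms powr_less_mono2[of p B "x k"] by auto
    then show ?thesis by simp
  qed
  have "(\<Sum>k\<in>A. x k powr q) \<le> (\<Sum>k\<in>A. B powr (q - p) * x k powr p)"
  proof (rule sum_mono)
    fix k assume k: "k \<in> A"
    have "x k powr q = x k powr (q - p) * x k powr p" by (simp add: powr_add[symmetric])
    also have "\<dots> \<le> B powr (q - p) * x k powr p"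
      using assms xB[OF k] by (intro mult_right_mono powr_mono2) auto
    finally show "x k powr q \<le> B powr (q - p) * x k powr p" .
  qed
  also have "\<dots> = B powr (q - p) * (\<Sum>k\<in>A. x k powr p)" by (simp add: sum_distrib_left)
  also have "\<dots> \<le> B powr (q - p) * B powr p" using assms by (intro mult_left_mono) auto
  also have "\<dots> = B powr q" by (simp add: powr_add[symmetric])
  finally show ?thesis .
qed

text \<open>The same bounds as for finite data, required uniformly over all finite sets of sites, so
  that every window is an instance of \<open>kg_finite_data\<close> with the same constants.\<close>

locale kg_data =
  fixes f g :: "int \<Rightarrow> complex" and F :: "real \<Rightarrow> int \<Rightarrow> complex"
    and \<Phi> :: "real \<Rightarrow> real" and v N E1 E2 :: real
  assumes v: "0 \<le> v" "v \<le> 1" and nonneg: "0 \<le> N" "0 \<le> E1" "0 \<le> E2"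
    and F_meas [measurable]: "\<And>k. (\<lambda>s. F s k) \<in> borel_measurable borel"
    and \<Phi>_meas [measurable]: "\<Phi> \<in> borel_measurable borel" and \<Phi>_nonneg: "\<And>s. 0 \<le> \<Phi> s"
    and F_le: "\<And>s A. finite A \<Longrightarrow> (\<Sum>k\<in>A. cmod (F s k) powr (2 / (1 + v))) \<le> \<Phi> s powr (2 / (1 + v))"
    and \<Phi>_le: "(\<integral>\<^sup>+s. ennreal (\<Phi> s powr (6 / (6 - v))) \<partial>lborel) \<le> ennreal (N powr (6 / (6 - v)))"
    and f_le: "\<And>A. finite A \<Longrightarrow> (\<Sum>k\<in>A. (cmod (f k))\<^sup>2) \<le> E1\<^sup>2"
    and g_le: "\<And>A. finite A \<Longrightarrow> (\<Sum>k\<in>A. (cmod (g k))\<^sup>2) \<le> E2\<^sup>2"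
begin

lemma finite_data: "kg_finite_data {- int m..int m} f g F \<Phi> v N E1 E2"
  by unfold_locales (use v nonneg F_meas \<Phi>_meas \<Phi>_nonneg F_le \<Phi>_le f_le g_le in auto)

abbreviation K :: "real \<Rightarrow> int \<Rightarrow> complex" where "K \<equiv> kg_kernel 1 (- pi / 2)"
abbreviation sol_trunc :: "nat \<Rightarrow> real \<Rightarrow> int \<Rightarrow> complex" where
  "sol_trunc m \<equiv> kg_finite_data.sol {- int m..int m} f g F"

definition U :: "real \<Rightarrow> int \<Rightarrow> complex" where
  "U t n = fourier_multiplier (osc_symbol 0 0 t) f n + fourier_multiplier (osc_symbol 1 (- pi / 2) t) g n
     - (\<integral>s. (if 0 \<le> s \<and> s \<le> t then fourier_multiplier (osc_symbol 1 (- pi / 2) (t - s)) (F s) n else 0) \<partial>lborel)"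

definition Y :: real where "Y = strichartz_const\<^sup>2 * (E1 + E2 + N)"

lemma Y_nonneg: "0 \<le> Y"
  using nonneg by (simp add: Y_def)

lemma f_l2: "l2_le f E1" and g_l2: "l2_le g E2"
  using f_le g_le nonneg by (auto simp: l2_le_def)

lemma F_l2: "l2_le (F s) (\<Phi> s)"
  unfolding l2_le_def
proof (intro conjI \<Phi>_nonneg allI impI)
  fix A :: "int set" assume A: "finite A"
  have "(\<Sum>k\<in>A. cmod (F s k) powr 2) \<le> \<Phi> s powr 2"
    using v by (intro sum_powr_embed[OF F_le]) (auto simp: A \<Phi>_nonneg field_simps)
  then show "(\<Sum>k\<in>A. (cmod (F s k))\<^sup>2) \<le> (\<Phi> s)\<^sup>2"
    using \<Phi>_nonneg[of s] by (simp add: powr_numeral)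
qed

lemma fm_osc_limit:
  assumes a: "l2_le a X"
  shows "(\<lambda>m. \<Sum>k\<in>{- int m..int m}. kg_kernel j \<theta> t (n - k) * a k) \<longlonglongrightarrow> fourier_multiplier (osc_symbol j \<theta> t) a n"
    and "cmod (\<Sum>k\<in>{- int m..int m}. kg_kernel j \<theta> t (n - k) * a k) \<le> X"
proof -
  note fm = fourier_multiplier_has_sum[OF osc_symbol_measurable1 osc_symbol_bound a]
  show "(\<lambda>m. \<Sum>k\<in>{- int m..int m}. kg_kernel j \<theta> t (n - k) * a k) \<longlonglongrightarrow> fourier_multiplier (osc_symbol j \<theta> t) a n"
    unfolding kg_kernel_def by (rule has_sum_symmetric_limit[OF fm(1)])
  show "cmod (\<Sum>k\<in>{- int m..int m}. kg_kernel j \<theta> t (n - k) * a k) \<le> X"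
    unfolding kg_kernel_def
    using fourier_multiplier_partial_bound[OF osc_symbol_measurable1 osc_symbol_bound l2_leD(2)[OF a] l2_leD(1)[OF a], of "{- int m..int m}"]
    by (intro order_trans[OF norm_sum]) auto
qed

lemma fm_F_measurable [measurable]:
  "(\<lambda>s. if 0 \<le> s \<and> s \<le> t then fourier_multiplier (osc_symbol 1 (- pi / 2) (t - s)) (F s) n else 0) \<in> borel_measurable borel"
proof (rule borel_measurable_LIMSEQ_metric)
  show "(\<lambda>s. if 0 \<le> s \<and> s \<le> t then \<Sum>k\<in>{- int m..int m}. K (t - s) (n - k) * F s k else 0) \<in> borel_measurable borel" for m
    by measurable
  show "(\<lambda>m. if 0 \<le> s \<and> s \<le> t then \<Sum>k\<in>{- int m..int m}. K (t - s) (n - k) * F s k else 0)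
     \<longlonglongrightarrow> (if 0 \<le> s \<and> s \<le> t then fourier_multiplier (osc_symbol 1 (- pi / 2) (t - s)) (F s) n else 0)" for s
    using fm_osc_limit(1)[OF F_l2] by auto
qed

text \<open>Dominated convergence in s: the kernel has l^2 norm at most 1, so every truncated sum is
  bounded by the l^2 norm of F(s), hence by \<Phi>(s), which is integrable on [0, t].\<close>

lemma sol_trunc_limit: "(\<lambda>m. sol_trunc m t n) \<longlonglongrightarrow> U t n"
proof -
  have "(\<lambda>m. \<integral>s. (if 0 \<le> s \<and> s \<le> t then \<Sum>k\<in>{- int m..int m}. K (t - s) (n - k) * F s k else 0) \<partial>lborel)
     \<longlonglongrightarrow> (\<integral>s. (if 0 \<le> s \<and> s \<le> t then fourier_multiplier (osc_symbol 1 (- pi / 2) (t - s)) (F s) n else 0) \<partial>lborel)"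
  proof (rule integral_dominated_convergence)
    show "integrable lborel (\<lambda>s. indicator {0..t} s * \<Phi> s)"
      by (rule kg_finite_data.\<Phi>_integrable[OF finite_data])
    show "AE s in lborel. (\<lambda>m. if 0 \<le> s \<and> s \<le> t then \<Sum>k\<in>{- int m..int m}. K (t - s) (n - k) * F s k else 0)
     \<longlonglongrightarrow> (if 0 \<le> s \<and> s \<le> t then fourier_multiplier (osc_symbol 1 (- pi / 2) (t - s)) (F s) n else 0)"
      using fm_osc_limit(1)[OF F_l2] by auto
    show "AE s in lborel. norm (if 0 \<le> s \<and> s \<le> t then \<Sum>k\<in>{- int m..int m}. K (t - s) (n - k) * F s k else 0)
       \<le> indicator {0..t} s * \<Phi> s" for m
      using fm_osc_limit(2)[OF F_l2] by auto
  qed measurable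
  then show ?thesis
    unfolding kg_finite_data.sol_def[OF finite_data] kg_finite_data.wave_def[OF finite_data]
      kg_finite_data.duhamel_def[OF finite_data] U_def
    by (intro tendsto_add tendsto_diff fm_osc_limit(1)[OF f_l2] fm_osc_limit(1)[OF g_l2])
qed

lemma U_l2_bound:
  assumes "finite B"
  shows "(\<Sum>n\<in>B. (cmod (U t n))\<^sup>2) \<le> Y\<^sup>2"
proof (rule LIMSEQ_le_const2)
  show "(\<lambda>m. \<Sum>n\<in>B. (cmod (sol_trunc m t n))\<^sup>2) \<longlonglongrightarrow> (\<Sum>n\<in>B. (cmod (U t n))\<^sup>2)"
    by (intro tendsto_sum tendsto_power tendsto_norm sol_trunc_limit)
  show "\<exists>M. \<forall>m\<ge>M. (\<Sum>n\<in>B. (cmod (sol_trunc m t n))\<^sup>2) \<le> Y\<^sup>2"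
    using kg_finite_data.sol_l2_bound[OF finite_data assms]
    unfolding Y_def kg_finite_data.E_def[OF finite_data] by blast
qed

lemma U_measurable [measurable]: "(\<lambda>t. U t n) \<in> borel_measurable borel"
proof (rule borel_measurable_LIMSEQ_metric[OF _ sol_trunc_limit])
  show "(\<lambda>t. sol_trunc m t n) \<in> borel_measurable borel" for m
    using kg_finite_data.sol_path_measurable(3)[OF finite_data, of "\<lambda>_. n" m] by simp
qed

lemma U_strichartz_path:
  assumes \<nu> [measurable]: "\<nu> \<in> measurable borel (count_space UNIV)"
  shows "(\<integral>\<^sup>+t. ennreal (indicator {0..T} t * cmod (U t (\<nu> t)) ^ 6) \<partial>lborel) \<le> ennreal (Y ^ 6)"
proof -
  have [measurable]: "(\<lambda>t. sol_trunc m t (\<nu> t)) \<in> borel_measurable borel" for m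
    by (rule kg_finite_data.sol_path_measurable(3)[OF finite_data \<nu>])
  have "(\<lambda>m. ennreal (indicator {0..T} t * cmod (sol_trunc m t (\<nu> t)) ^ 6))
     \<longlonglongrightarrow> ennreal (indicator {0..T} t * cmod (U t (\<nu> t)) ^ 6)" for t
    by (intro tendsto_ennrealI tendsto_mult tendsto_const tendsto_power tendsto_norm sol_trunc_limit)
  from this have "(\<integral>\<^sup>+t. ennreal (indicator {0..T} t * cmod (U t (\<nu> t)) ^ 6) \<partial>lborel)
     = (\<integral>\<^sup>+t. liminf (\<lambda>m. ennreal (indicator {0..T} t * cmod (sol_trunc m t (\<nu> t)) ^ 6)) \<partial>lborel)"
    by (intro nn_integral_cong lim_imp_Liminf[symmetric]) auto
  also have "\<dots> \<le> liminf (\<lambda>m. \<integral>\<^sup>+t. ennreal (indicator {0..T} t * cmod (sol_trunc m t (\<nu> t)) ^ 6) \<partial>lborel)"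
    by (rule nn_integral_liminf) measurable
  also have "\<dots> \<le> liminf (\<lambda>m::nat. ennreal (Y ^ 6))"
    using kg_finite_data.sol_strichartz_path[OF finite_data \<nu>]
    unfolding Y_def kg_finite_data.E_def[OF finite_data] by (intro Liminf_mono) auto
  also have "\<dots> = ennreal (Y ^ 6)" by (simp add: Liminf_const)
  finally show ?thesis .
qed

text \<open>Replaces the supremum over all sites by a Borel function of time. The maximising site in
  the window from -m to m is a path, so the path estimate bounds its sixth power on [0, m]; these
  functions increase with m, and monotone convergence keeps the bound.\<close>

lemma U_maximal_function:
  obtains M where "M \<in> borel_measurable borel" "\<And>t. 0 \<le> M t" "\<And>t. M t \<le> Y"
    "\<And>t n. 0 \<le> t \<Longrightarrow> cmod (U t n) \<le> M t"
    "(\<integral>\<^sup>+t. ennreal (indicator {0..} t * M t ^ 6) \<partial>lborel) \<le> ennreal (Y ^ 6)"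
proof -
  have "\<exists>\<kappa>\<in>measurable borel (count_space UNIV). \<forall>s. \<kappa> s \<in> {- int m..int m} \<and>
      (\<forall>k\<in>{- int m..int m}. cmod (U s k) \<le> cmod (U s (\<kappa> s)))" for m
    by (rule exists_argmax) auto
  then obtain \<kappa> where \<kappa>_meas [measurable]: "\<And>m. \<kappa> m \<in> measurable borel (count_space UNIV)"
    and \<kappa>_mem: "\<And>m s. \<kappa> m s \<in> {- int m..int m}"
    and \<kappa>: "\<And>m s k. k \<in> {- int m..int m} \<Longrightarrow> cmod (U s k) \<le> cmod (U s (\<kappa> m s))"
    by metis
  have U\<kappa> [measurable]: "(\<lambda>t. U t (\<kappa> m t)) \<in> borel_measurable borel" for m
    by (rule measurable_compose_countable[of "\<lambda>k t. U t k"]) measurable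
  define G where "G m t = ennreal (indicator {0..real m} t * cmod (U t (\<kappa> m t)) ^ 6)" for m t
  have G_meas [measurable]: "G m \<in> borel_measurable borel" for m unfolding G_def by measurable
  have sup: "cmod (U t n) \<le> Y" for t n
    using U_l2_bound[of "{n}" t] Y_nonneg by (intro power2_le_imp_le[of "cmod (U t n)"]) auto
  have G_le: "G m t \<le> ennreal (Y ^ 6)" for m t
    unfolding G_def using sup Y_nonneg
    by (intro ennreal_leI) (auto split: split_indicator intro!: power_mono)
  have mono: "incseq G"
  proof (rule incseq_SucI, rule le_funI)
    fix m t
    have "cmod (U t (\<kappa> m t)) \<le> cmod (U t (\<kappa> (Suc m) t))"
      using \<kappa>_mem[of m t] by (intro \<kappa>) auto
    then show "G m t \<le> G (Suc m) t"
      unfolding G_def by (intro ennreal_leI) (auto split: split_indicator intro!: power_mono)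
  qed
  define S where "S t = (SUP m. G m t)" for t
  have S_meas [measurable]: "S \<in> borel_measurable borel" unfolding S_def by measurable
  have S_le: "S t \<le> ennreal (Y ^ 6)" for t unfolding S_def by (intro SUP_least G_le)
  then have S_fin: "S t < top" for t using le_less_trans ennreal_less_top by blast
  have S_int: "(\<integral>\<^sup>+t. S t \<partial>lborel) \<le> ennreal (Y ^ 6)"
  proof -
    have "(\<integral>\<^sup>+t. S t \<partial>lborel) = (SUP m. \<integral>\<^sup>+t. G m t \<partial>lborel)"
      unfolding S_def by (rule nn_integral_monotone_convergence_SUP[OF mono]) measurable
    also have "\<dots> \<le> ennreal (Y ^ 6)"
      unfolding G_def by (intro SUP_least U_strichartz_path) measurable
    finally show ?thesis .
  qed
  define M where "M t = enn2real (S t) powr (1 / 6)" for t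
  have M6: "M t ^ 6 = enn2real (S t)" for t
  proof (cases "enn2real (S t) = 0")
    case False
    then have "0 < enn2real (S t)" using enn2real_nonneg[of "S t"] by linarith
    then show ?thesis unfolding M_def by (subst powr_realpow[symmetric]) (auto simp: powr_powr)
  qed (simp add: M_def)
  have M0: "0 \<le> M t" for t by (simp add: M_def)
  \<comment> \<open>The rule speaks of the exponent \<open>Suc n\<close>, hence the argument
    5.\<close>
  have pow6: "x \<le> y" if "x ^ 6 \<le> y ^ 6" "0 \<le> y" for x y :: real
    using power_le_imp_le_base[of x 5 y] that by simp
  show thesis
  proof (rule that[of M])
    show "M \<in> borel_measurable borel" unfolding M_def by measurable
    show "0 \<le> M t" for t by (rule M0)
    have "enn2real (S t) \<le> Y ^ 6" for t
      using S_le[of t] Y_nonneg by (intro enn2real_leI) auto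
    then have "M t ^ 6 \<le> Y ^ 6" for t by (simp add: M6)
    then show "M t \<le> Y" for t using Y_nonneg pow6 by blast
    show "cmod (U t n) \<le> M t" if "0 \<le> t" for t n
    proof -
      \<comment> \<open>Large enough for the window to contain n and for the time cut-off to reach
        t.\<close>
      define m where "m = nat (max \<bar>n\<bar> \<lceil>t\<rceil>)"
      have m: "n \<in> {- int m..int m}" "t \<le> real m" unfolding m_def by (auto simp: le_max_iff_disj) linarith+
      have "ennreal (cmod (U t n) ^ 6) \<le> G m t"
        unfolding G_def using m that \<kappa>[OF m(1), of t] by (intro ennreal_leI) (auto intro!: power_mono)
      also have "\<dots> \<le> S t" unfolding S_def by (rule SUP_upper) simp
      also have "\<dots> = ennreal (M t ^ 6)" unfolding M6 using S_fin[of t] by simp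
      finally have "cmod (U t n) ^ 6 \<le> M t ^ 6" using M0[of t] by (subst (asm) ennreal_le_iff) auto
      then show ?thesis using M0[of t] by (rule pow6)
    qed
    have "(\<integral>\<^sup>+t. ennreal (indicator {0..} t * M t ^ 6) \<partial>lborel) \<le> (\<integral>\<^sup>+t. S t \<partial>lborel)"
      unfolding M6 using S_fin by (intro nn_integral_mono) (auto split: split_indicator)
    also note S_int
    finally show "(\<integral>\<^sup>+t. ennreal (indicator {0..} t * M t ^ 6) \<partial>lborel) \<le> ennreal (Y ^ 6)" .
  qed
qed

end

section \<open>Extended norms as bounds on finite sums, and Borel representatives\<close>

lemma ennreal_powr_le_iff:
  assumes "0 < s" "0 \<le> B"
  shows "ennreal_powr x s \<le> ennreal B \<longleftrightarrow> x \<le> ennreal (B powr (1 / s))"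
proof (cases x)
  case (real y)
  have "y powr s \<le> B \<longleftrightarrow> y \<le> B powr (1 / s)"
  proof
    assume "y powr s \<le> B"
    then have "(y powr s) powr (1 / s) \<le> B powr (1 / s)" using assms by (intro powr_mono2) auto
    then show "y \<le> B powr (1 / s)" using assms real by (simp add: powr_powr)
  next
    assume "y \<le> B powr (1 / s)"
    then have "y powr s \<le> (B powr (1 / s)) powr s" using assms real by (intro powr_mono2) auto
    then show "y powr s \<le> B" using assms by (simp add: powr_powr)
  qed
  then show ?thesis using real assms by (simp add: ennreal_powr_def)
qed (simp add: ennreal_powr_def top_unique)

lemma ennreal_powr_measurable [measurable (raw)]:
  assumes [measurable]: "f \<in> borel_measurable M"
  shows "(\<lambda>x. ennreal_powr (f x) s) \<in> borel_measurable M"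
  unfolding ennreal_powr_def by measurable

lemma infsum_ennreal_le_iff:
  fixes g :: "'a \<Rightarrow> ennreal"
  shows "infsum g UNIV \<le> B \<longleftrightarrow> (\<forall>A. finite A \<longrightarrow> sum g A \<le> B)"
  by (subst nonneg_infsum_complete) (auto simp: SUP_le_iff)

text \<open>A countable supremum in place of the one over all finite sets, which makes
  \<open>lp_norm\<close> measurable in time.\<close>

lemma infsum_int_ennreal:
  fixes g :: "int \<Rightarrow> ennreal"
  shows "infsum g UNIV = (SUP m. \<Sum>k\<in>{- int m..int m}. g k)"
proof (rule antisym)
  show "infsum g UNIV \<le> (SUP m. \<Sum>k\<in>{- int m..int m}. g k)"
    unfolding infsum_ennreal_le_iff
  proof (intro allI impI)
    fix A :: "int set" assume A: "finite A"
    then have "\<forall>\<^sub>F m in sequentially. A \<subseteq> {- int m..int m}"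
      using filterlim_symmetric_intervals unfolding filterlim_finite_subsets_at_top
      by (auto elim: eventually_mono)
    then obtain m where "A \<subseteq> {- int m..int m}" by (auto simp: eventually_sequentially)
    then have "sum g A \<le> (\<Sum>k\<in>{- int m..int m}. g k)" by (intro sum_mono2) auto
    also have "\<dots> \<le> (SUP m. \<Sum>k\<in>{- int m..int m}. g k)" by (rule SUP_upper) simp
    finally show "sum g A \<le> (SUP m. \<Sum>k\<in>{- int m..int m}. g k)" .
  qed
  show "(SUP m. \<Sum>k\<in>{- int m..int m}. g k) \<le> infsum g UNIV"
    using infsum_ennreal_le_iff[of g "infsum g UNIV"] by (intro SUP_least) simp
qed

lemma lp_norm_le_iff:
  assumes p: "p \<noteq> \<infinity>" "0 < enn2real p" and B: "0 \<le> B"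
  shows "lp_norm p a \<le> ennreal B \<longleftrightarrow>
    (\<forall>A. finite A \<longrightarrow> (\<Sum>n\<in>A. cmod (a n) powr enn2real p) \<le> B powr enn2real p)"
proof -
  have "lp_norm p a \<le> ennreal B \<longleftrightarrow>
     (\<Sum>\<^sub>\<infinity>n. ennreal (cmod (a n) powr enn2real p)) \<le> ennreal (B powr enn2real p)"
    using p B ennreal_powr_le_iff[of "1 / enn2real p" B] by (simp add: lp_norm_def)
  then show ?thesis
    unfolding infsum_ennreal_le_iff by (simp add: sum_ennreal ennreal_le_iff)
qed

lemma lp_norm_2_le_iff: "0 \<le> B \<Longrightarrow> lp_norm 2 a \<le> ennreal B \<longleftrightarrow> l2_le a B"
proof -
  assume B: "0 \<le> B"
  have "x powr 2 = x\<^sup>2" if "0 \<le> x" for x :: real using that by (simp add: powr_numeral)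
  then show ?thesis
    using lp_norm_le_iff[of 2 B a] B by (simp add: l2_le_def)
qed

lemma lp_norm_measurable:
  assumes [measurable]: "\<And>k. (\<lambda>s. F s k) \<in> borel_measurable M" and p: "p \<noteq> \<infinity>"
  shows "(\<lambda>s. lp_norm p (F s)) \<in> borel_measurable M"
  using p unfolding lp_norm_def infsum_int_ennreal by simp

lemma borel_representative:
  fixes h :: "real \<Rightarrow> complex"
  assumes [measurable]: "h \<in> borel_measurable lebesgue"
  shows "\<exists>h'\<in>borel_measurable borel. AE x in lborel. h x = h' x"
proof -
  have "(\<lambda>x. Re (h x)) \<in> borel_measurable (completion lborel)" "(\<lambda>x. Im (h x)) \<in> borel_measurable (completion lborel)"
    by measurable
  from this[THEN completion_ex_borel_measurable_real] obtain h1 h2 where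
    h: "h1 \<in> borel_measurable lborel" "AE x in lborel. Re (h x) = h1 x"
      "h2 \<in> borel_measurable lborel" "AE x in lborel. Im (h x) = h2 x" by blast
  note [measurable] = h(1,3)
  show ?thesis
  proof (intro bexI[of _ "\<lambda>x. complex_of_real (h1 x) + \<i> * complex_of_real (h2 x)"])
    show "AE x in lborel. h x = complex_of_real (h1 x) + \<i> * complex_of_real (h2 x)"
      using h(2,4) by eventually_elim (simp add: complex_eq_iff)
    show "(\<lambda>x. complex_of_real (h1 x) + \<i> * complex_of_real (h2 x)) \<in> borel_measurable borel"
      by measurable
  qed
qed

text \<open>The forcing is only Lebesgue measurable on t at least 0, and its space norm may be
  infinite on a null set. It is replaced by a Borel function that vanishes at the bad times. Since
  the sites are countable, one null set serves them all, and the bound on \<open>p\<close> lets the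
  l^p norm control the norm with exponent 2/(1+v).\<close>

lemma borel_reduction:
  fixes F :: "real \<Rightarrow> int \<Rightarrow> complex" and p b :: ennreal
  assumes F: "\<And>n. set_borel_measurable lebesgue {0..} (\<lambda>t. F t n)"
    and v: "0 \<le> v" "v \<le> 1"
    and b: "b \<noteq> \<infinity>" "enn2real b = 6 / (6 - v)"
    and p: "p \<noteq> \<infinity>" "0 < enn2real p" "enn2real p \<le> 2 / (1 + v)"
    and N: "mixed_norm b p F \<le> ennreal N" "0 \<le> N"
  obtains F' \<Phi> where "\<And>k. (\<lambda>s. F' s k) \<in> borel_measurable borel" "\<Phi> \<in> borel_measurable borel"
    "\<And>s. 0 \<le> \<Phi> s"
    "\<And>s A. finite A \<Longrightarrow> (\<Sum>k\<in>A. cmod (F' s k) powr (2 / (1 + v))) \<le> \<Phi> s powr (2 / (1 + v))"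
    "(\<integral>\<^sup>+s. ennreal (\<Phi> s powr (6 / (6 - v))) \<partial>lborel) \<le> ennreal (N powr (6 / (6 - v)))"
    "AE s in lborel. 0 \<le> s \<longrightarrow> F' s = F s"
proof -
  let ?b = "6 / (6 - v)"
  have b0: "0 < ?b" using v by simp
  have "\<exists>h'\<in>borel_measurable borel. AE x in lborel. indicator {0..} x *\<^sub>R F x n = h' x" for n
    using F[of n] unfolding set_borel_measurable_def by (rule borel_representative)
  then obtain F1' where F1': "\<And>n. F1' n \<in> borel_measurable borel"
    "\<And>n. AE x in lborel. indicator {0..} x *\<^sub>R F x n = F1' n x" by metis
  define F1 where "F1 s n = F1' n s" for s n
  have F1 [measurable]: "(\<lambda>s. F1 s n) \<in> borel_measurable borel" for n
    using F1'(1) by (simp add: F1_def)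
  have AE1: "AE s in lborel. \<forall>n. F1 s n = indicator {0..} s *\<^sub>R F s n"
  proof -
    have "AE s in lborel. F1 s n = indicator {0..} s *\<^sub>R F s n" for n
      using F1'(2)[of n] by eventually_elim (simp add: F1_def)
    then show ?thesis by (simp add: AE_all_countable)
  qed
  define \<Phi>0 where "\<Phi>0 s = lp_norm p (F1 s)" for s
  have \<Phi>0 [measurable]: "\<Phi>0 \<in> borel_measurable borel"
    unfolding \<Phi>0_def by (rule lp_norm_measurable[OF F1 p(1)])
  have int: "(\<integral>\<^sup>+s. ennreal_powr (\<Phi>0 s) ?b \<partial>lborel) \<le> ennreal (N powr ?b)"
  proof -
    have "lp_norm p (\<lambda>n. 0) \<le> ennreal 0" using p by (subst lp_norm_le_iff) auto
    then have lp0: "lp_norm p (\<lambda>n. 0) = 0" by simp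
    have "(\<integral>\<^sup>+s. ennreal_powr (\<Phi>0 s) ?b \<partial>lborel)
        = (\<integral>\<^sup>+s. ennreal_powr (lp_norm p (F s)) ?b * indicator {0..} s \<partial>lborel)"
    proof (rule nn_integral_cong_AE)
      show "AE s in lborel. ennreal_powr (\<Phi>0 s) ?b = ennreal_powr (lp_norm p (F s)) ?b * indicator {0..} s"
        using AE1
      proof eventually_elim
        case (elim s)
        then have "F1 s = (if 0 \<le> s then F s else (\<lambda>n. 0))" by auto
        then show ?case by (auto simp: \<Phi>0_def lp0 ennreal_powr_def)
      qed
    qed
    also have "\<dots> = (\<integral>\<^sup>+s. ennreal_powr (lp_norm p (F s)) ?b * indicator {0..} s \<partial>lebesgue)"
      by (rule nn_integral_completion[symmetric])
    also have "\<dots> \<le> ennreal (N powr ?b)"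
      using N b b0 ennreal_powr_le_iff[of "1 / ?b" N] by (simp add: mixed_norm_def)
    finally show ?thesis .
  qed
  have fin: "AE s in lborel. \<Phi>0 s \<noteq> \<infinity>"
  proof -
    have "AE s in lborel. ennreal_powr (\<Phi>0 s) ?b \<noteq> \<infinity>"
      using int by (intro nn_integral_PInf_AE) (auto simp: top_unique)
    then show ?thesis by eventually_elim (auto simp: ennreal_powr_def)
  qed
  \<comment> \<open>Setting F to 0 where its norm is infinite makes the real majorant \<Phi> valid
    at every time; \<open>enn2real\<close> gives \<Phi> the value 0 there.\<close>
  define F' where "F' s n = (if \<Phi>0 s = \<infinity> then 0 else F1 s n)" for s n
  define \<Phi> where "\<Phi> s = enn2real (\<Phi>0 s)" for s
  show thesis
  proof (rule that[of F' \<Phi>])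
    show "(\<lambda>s. F' s k) \<in> borel_measurable borel" for k unfolding F'_def by measurable
    show "\<Phi> \<in> borel_measurable borel" unfolding \<Phi>_def by measurable
    show "0 \<le> \<Phi> s" for s by (simp add: \<Phi>_def)
    show "(\<Sum>k\<in>A. cmod (F' s k) powr (2 / (1 + v))) \<le> \<Phi> s powr (2 / (1 + v))" if A: "finite A" for s A
    proof (cases "\<Phi>0 s = \<infinity>")
      case False
      then have "lp_norm p (F1 s) \<le> ennreal (\<Phi> s)"
        unfolding \<Phi>_def \<Phi>0_def by (simp add: less_top)
      then have "(\<Sum>k\<in>A. cmod (F1 s k) powr enn2real p) \<le> \<Phi> s powr enn2real p"
        using lp_norm_le_iff[OF p(1,2)] A by (simp add: \<Phi>_def)
      then show ?thesis
        using False p A by (simp add: F'_def) (rule sum_powr_embed[where p = "enn2real p"], auto simp: \<Phi>_def)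
    qed (simp add: F'_def)
    have "(\<integral>\<^sup>+s. ennreal (\<Phi> s powr ?b) \<partial>lborel) \<le> (\<integral>\<^sup>+s. ennreal_powr (\<Phi>0 s) ?b \<partial>lborel)"
      by (intro nn_integral_mono) (auto simp: ennreal_powr_def \<Phi>_def)
    also note int
    finally show "(\<integral>\<^sup>+s. ennreal (\<Phi> s powr ?b) \<partial>lborel) \<le> ennreal (N powr ?b)" .
    show "AE s in lborel. 0 \<le> s \<longrightarrow> F' s = F s"
      using AE1 fin by eventually_elim (auto simp: F'_def)
  qed
qed

lemma kg_cos_eq: "kg_cos t = fourier_multiplier (osc_symbol 0 0 t)"
  unfolding kg_cos_def by (rule arg_cong[where f = fourier_multiplier]) (auto simp: osc_symbol_def)

lemma kg_sin_eq: "kg_sin t = fourier_multiplier (osc_symbol 1 (- pi / 2) t)"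
proof -
  have "sin x = cos (x + - pi / 2)" for x :: real by (subst cos_add) simp
  then show ?thesis
    unfolding kg_sin_def by (intro arg_cong[where f = fourier_multiplier]) (auto simp: osc_symbol_def)
qed

context kg_data
begin

text \<open>The forcing enters only through a time integral, so changing it on a null set leaves the
  solution the same at every time and site.\<close>

lemma duhamel_solution_eq_U:
  assumes u: "kg_duhamel_solution f g F0 u" and F0: "AE s in lborel. 0 \<le> s \<longrightarrow> F s = F0 s" and t: "0 \<le> t"
  shows "u t n = U t n"
proof -
  let ?I = "\<lambda>s. if 0 \<le> s \<and> s \<le> t then fourier_multiplier (osc_symbol 1 (- pi / 2) (t - s)) (F s) n else 0"
  have I_meas: "?I \<in> borel_measurable lebesgue"
    using fm_F_measurable[of t n] by (simp add: measurable_completion)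
  have ae: "AE s in lebesgue. ?I s = indicator {0..t} s *\<^sub>R kg_sin (t - s) (F0 s) n"
    using AE_completion[OF F0] by eventually_elim (auto simp: kg_sin_eq)
  have "(LINT s:{0..t}|lebesgue. kg_sin (t - s) (F0 s) n) = (\<integral>s. ?I s \<partial>lebesgue)"
    unfolding set_lebesgue_integral_def
    by (rule integral_cong_AE[symmetric]) (rule I_meas, rule borel_measurable_AE[OF I_meas ae], rule ae)
  also have "\<dots> = (\<integral>s. ?I s \<partial>lborel)"
    by (rule integral_completion) simp
  finally show ?thesis
    using u t unfolding kg_duhamel_solution_def U_def by (simp add: kg_cos_eq kg_sin_eq)
qed

text \<open>
  Interpolation between the endpoints $(\infty, 2)$ and $(6, \infty)$; the slack in the
  admissibility condition is absorbed by the embedding of the $l^p$ spaces.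
\<close>

lemma strichartz_mixed_norm:
  assumes u: "\<And>t n. 0 \<le> t \<Longrightarrow> u t n = U t n"
    and w: "0 \<le> w" "w \<le> 1"
    and q: "q = \<infinity> \<and> w = 0 \<or> q \<noteq> \<infinity> \<and> 6 \<le> enn2real q \<and> w = 6 / enn2real q"
    and r: "r = \<infinity> \<or> r \<noteq> \<infinity> \<and> 0 < enn2real r \<and> 2 \<le> (1 - w) * enn2real r"
  shows "mixed_norm q r u \<le> ennreal Y"
proof -
  obtain M where M [measurable]: "M \<in> borel_measurable borel" and M0: "\<And>t. 0 \<le> M t" and MY: "\<And>t. M t \<le> Y"
    and UM: "\<And>t n. 0 \<le> t \<Longrightarrow> cmod (U t n) \<le> M t"
    and M6: "(\<integral>\<^sup>+t. ennreal (indicator {0..} t * M t ^ 6) \<partial>lborel) \<le> ennreal (Y ^ 6)"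
    by (rule U_maximal_function) blast
  have uM: "cmod (u t n) \<le> M t" if "0 \<le> t" for t n using UM u that by simp
  have lp: "lp_norm r (u t) \<le> ennreal (M t powr w * Y powr (1 - w))" if t: "0 \<le> t" for t
  proof (cases "M t = 0")
    \<comment> \<open>With \<open>0 powr w = 0\<close> the claimed bound is 0 here even for w = 0;
      it holds because \<open>u t\<close> vanishes.\<close>
    case True
    then have z: "u t n = 0" for n using uM[OF t, of n] by simp
    have "lp_norm r (u t) \<le> ennreal 0"
    proof (cases "r = \<infinity>")
      case False
      then show ?thesis using r by (subst lp_norm_le_iff) (auto simp: z)
    qed (simp add: lp_norm_def z)
    then show ?thesis by simp
  next
    case False
    then have pos: "0 < M t" "0 < Y" using M0[of t] MY[of t] by linarith+
    show ?thesis
    proof (cases "r = \<infinity>")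
      case True
      have "M t = M t powr w * M t powr (1 - w)" using pos by (simp add: powr_add[symmetric])
      also have "\<dots> \<le> M t powr w * Y powr (1 - w)" using pos MY w by (intro mult_left_mono powr_mono2) auto
      finally have "M t \<le> M t powr w * Y powr (1 - w)" .
      then show ?thesis
        using True uM[OF t] by (auto simp: lp_norm_def intro!: SUP_least ennreal_leI intro: order_trans)
    next
      case False
      with r have r': "r \<noteq> \<infinity>" "0 < enn2real r" "2 \<le> (1 - w) * enn2real r" by auto
      let ?r = "enn2real r"
      have r2: "2 \<le> ?r" using r' w mult_right_mono[of "1 - w" 1 ?r] by linarith
      have "(\<Sum>n\<in>A. cmod (u t n) powr ?r) \<le> (M t powr w * Y powr (1 - w)) powr ?r" if A: "finite A" for A
      proof -
        have "(\<Sum>n\<in>A. cmod (u t n) powr ?r) \<le> (\<Sum>n\<in>A. M t powr (?r - 2) * (cmod (u t n))\<^sup>2)"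
        proof (rule sum_mono)
          fix n
          have "cmod (u t n) powr ?r = cmod (u t n) powr (?r - 2) * cmod (u t n) powr 2"
            by (simp only: powr_add[symmetric]) simp
          also have "\<dots> \<le> M t powr (?r - 2) * cmod (u t n) powr 2"
            using r2 uM[OF t] by (intro mult_right_mono powr_mono2) auto
          also have "cmod (u t n) powr 2 = (cmod (u t n))\<^sup>2" by (simp add: powr_numeral)
          finally show "cmod (u t n) powr ?r \<le> M t powr (?r - 2) * (cmod (u t n))\<^sup>2" .
        qed
        also have "\<dots> \<le> M t powr (?r - 2) * Y\<^sup>2"
          unfolding sum_distrib_left[symmetric] using U_l2_bound[OF A, of t] u[OF t] by (intro mult_left_mono) auto
        \<comment> \<open>The exponent r - 2 is split so that exactly w r powers of M are kept for
          the time integral. The remaining (1-w) r - 2 powers have nonnegative exponent and are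
          bounded by Y.\<close>
        also have "\<dots> = M t powr (w * ?r) * M t powr ((1 - w) * ?r - 2) * Y powr 2"
        proof -
          have "w * ?r + ((1 - w) * ?r - 2) = ?r - 2" by (simp add: algebra_simps)
          then show ?thesis using pos by (simp only: powr_add[symmetric] powr_numeral)
        qed
        also have "\<dots> \<le> M t powr (w * ?r) * Y powr ((1 - w) * ?r - 2) * Y powr 2"
          using pos MY r' by (intro mult_right_mono mult_left_mono powr_mono2) auto
        also have "\<dots> = M t powr (w * ?r) * Y powr ((1 - w) * ?r)"
          using pos by (simp only: mult.assoc powr_add[symmetric]) simp
        also have "\<dots> = (M t powr w * Y powr (1 - w)) powr ?r"
          using pos by (simp add: powr_mult powr_powr)
        finally show ?thesis .
      qed
      then show ?thesis using r' by (subst lp_norm_le_iff) auto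
    qed
  qed
  show ?thesis
  proof (cases "q = \<infinity>")
    case True
    then have "w = 0" using q by simp
    have "lp_norm r (u t) \<le> ennreal Y" if "0 \<le> t" for t
    proof -
      have "M t powr w * Y powr (1 - w) \<le> Y"
        unfolding \<open>w = 0\<close> using M0[of t] Y_nonneg by (cases "M t = 0") auto
      then show ?thesis using lp[OF that] by (meson ennreal_leI order_trans)
    qed
    then show ?thesis using True by (auto simp: mixed_norm_def intro!: SUP_least)
  next
    case False
    let ?q = "enn2real q"
    have q6: "6 \<le> ?q" and wq: "w = 6 / ?q" using q False by auto
    have pt: "(M t powr w * Y powr (1 - w)) powr ?q = M t ^ 6 * Y powr (?q - 6)" for t
    proof -
      \<comment> \<open>Since w q = 6, raising to the power q leaves precisely the sixth power of M,
        whose integral is known.\<close>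
      have e: "w * ?q = 6" "(1 - w) * ?q = ?q - 6" using q6 by (simp_all add: wq field_simps)
      have "(M t powr w * Y powr (1 - w)) powr ?q = M t powr (w * ?q) * Y powr ((1 - w) * ?q)"
        using M0[of t] Y_nonneg by (simp add: powr_mult powr_powr)
      also have "\<dots> = M t ^ 6 * Y powr (?q - 6)"
        unfolding e using M0[of t] by (simp add: powr_numeral)
      finally show ?thesis .
    qed
    have "(\<integral>\<^sup>+t. ennreal_powr (lp_norm r (u t)) ?q * indicator {0..} t \<partial>lebesgue)
       \<le> (\<integral>\<^sup>+t. ennreal (Y powr (?q - 6)) * ennreal (indicator {0..} t * M t ^ 6) \<partial>lebesgue)"
    \<comment> \<open>\<open>nn_integral\<close> is monotone for arbitrary functions, so a pointwise
      comparison with the majorant is enough.\<close>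
    proof (intro nn_integral_mono)
      fix t :: real
      show "ennreal_powr (lp_norm r (u t)) ?q * indicator {0..} t \<le> ennreal (Y powr (?q - 6)) * ennreal (indicator {0..} t * M t ^ 6)"
      proof (cases "0 \<le> t")
        case True
        have "ennreal_powr (lp_norm r (u t)) ?q \<le> ennreal ((M t powr w * Y powr (1 - w)) powr ?q)"
          using lp[OF True] q6 by (subst ennreal_powr_le_iff) (auto simp: powr_powr)
        then show ?thesis using True M0 by (simp add: pt ennreal_mult mult.commute)
      qed simp
    qed
    also have "\<dots> = (\<integral>\<^sup>+t. ennreal (Y powr (?q - 6)) * ennreal (indicator {0..} t * M t ^ 6) \<partial>lborel)"
      by (rule nn_integral_completion)
    also have "\<dots> = ennreal (Y powr (?q - 6)) * (\<integral>\<^sup>+t. ennreal (indicator {0..} t * M t ^ 6) \<partial>lborel)"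
      by (rule nn_integral_cmult) measurable
    also have "\<dots> \<le> ennreal (Y powr (?q - 6)) * ennreal (Y ^ 6)"
      by (intro mult_left_mono M6) auto
    also have "\<dots> = ennreal (Y powr ?q)"
    proof (cases "Y = 0")
      case F: False
      then have "Y powr (?q - 6) * Y ^ 6 = Y powr (?q - 6) * Y powr 6"
        using Y_nonneg by (simp add: powr_numeral)
      also have "\<dots> = Y powr ?q" by (simp only: powr_add[symmetric]) simp
      finally show ?thesis using Y_nonneg by (simp add: ennreal_mult[symmetric])
    qed simp
    finally have "ennreal_powr (\<integral>\<^sup>+t. ennreal_powr (lp_norm r (u t)) ?q * indicator {0..} t \<partial>lebesgue) (1 / ?q) \<le> ennreal Y"
      using q6 Y_nonneg by (subst ennreal_powr_le_iff) auto
    then show ?thesis using False by (simp add: mixed_norm_def)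
  qed
qed

end

section \<open>Admissible and dual exponents in real form\<close>

lemma one_div_ennreal:
  fixes x :: ennreal
  assumes "x \<noteq> 0"
  shows "1 / x = ennreal (enn2real (1 / x))" "enn2real (1 / x) = (if x = \<infinity> then 0 else 1 / enn2real x)"
proof -
  have "1 / x = ennreal (if x = \<infinity> then 0 else 1 / enn2real x)"
  proof (cases x)
    case (real y)
    then have "0 < y" using assms by (cases "y = 0") auto
    then show ?thesis using real divide_ennreal[of 1 y] by simp
  qed (simp add: ennreal_divide_top)
  then show "enn2real (1 / x) = (if x = \<infinity> then 0 else 1 / enn2real x)" "1 / x = ennreal (enn2real (1 / x))"
    by (auto simp: enn2real_ennreal)
qed

text \<open>In terms of w = 6/q the admissibility condition becomes 1/r at most (1-w)/2. As 1/r is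
  nonnegative, w is at most 1, so q is at least 6. Infinite exponents contribute reciprocal
  0.\<close>

lemma admissible_exponents:
  fixes q r :: ennreal
  assumes q: "2 \<le> q" and r: "2 \<le> r" and adm: "1 / q + 1 / (3 * r) \<le> 1 / 6"
  obtains w where "0 \<le> w" "w \<le> 1" "w = 6 * enn2real (1 / q)" "enn2real (1 / r) \<le> (1 - w) / 2"
    "q = \<infinity> \<and> w = 0 \<or> q \<noteq> \<infinity> \<and> 6 \<le> enn2real q \<and> w = 6 / enn2real q"
    "r = \<infinity> \<or> r \<noteq> \<infinity> \<and> 0 < enn2real r \<and> 2 \<le> (1 - w) * enn2real r"
proof -
  have nz: "q \<noteq> 0" "r \<noteq> 0" "3 * r \<noteq> 0" using q r by auto
  have r3: "enn2real (1 / (3 * r)) = enn2real (1 / r) / 3"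
    unfolding one_div_ennreal(2)[OF nz(3)] one_div_ennreal(2)[OF nz(2)]
    by (auto simp: enn2real_mult ennreal_mult_eq_top_iff)
  have "ennreal (enn2real (1 / q) + enn2real (1 / (3 * r))) \<le> ennreal (1 / 6)"
  proof -
    have "(1 / 6 :: ennreal) = ennreal (1 / 6)" using divide_ennreal[of 1 6] by simp
    then show ?thesis using adm one_div_ennreal(1)[OF nz(1)] one_div_ennreal(1)[OF nz(3)] by simp
  qed
  then have le: "enn2real (1 / q) + enn2real (1 / r) / 3 \<le> 1 / 6"
    unfolding r3 by (subst (asm) ennreal_le_iff) auto
  define w where "w = 6 * enn2real (1 / q)"
  have w0: "0 \<le> w" by (simp add: w_def)
  have wr: "enn2real (1 / r) \<le> (1 - w) / 2" using le by (simp add: w_def)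
  have w1: "w \<le> 1" using order_trans[OF enn2real_nonneg wr] by simp
  have qpos: "0 < enn2real q" if "q \<noteq> \<infinity>"
    using that nz(1) by (simp add: enn2real_positive_iff less_top zero_less_iff_neq_zero)
  have rpos: "0 < enn2real r" if "r \<noteq> \<infinity>"
    using that nz(2) by (simp add: enn2real_positive_iff less_top zero_less_iff_neq_zero)
  show thesis
  proof (rule that[OF w0 w1 w_def wr])
    show "q = \<infinity> \<and> w = 0 \<or> q \<noteq> \<infinity> \<and> 6 \<le> enn2real q \<and> w = 6 / enn2real q"
      using w1 qpos one_div_ennreal(2)[OF nz(1)] by (auto simp: w_def field_simps)
    show "r = \<infinity> \<or> r \<noteq> \<infinity> \<and> 0 < enn2real r \<and> 2 \<le> (1 - w) * enn2real r"
      using wr rpos one_div_ennreal(2)[OF nz(2)] by (auto simp: field_simps)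
  qed
qed

text \<open>An exponent of at least 2 has reciprocal at most 1/2, which leaves at least 1/2 for the
  conjugate; so the conjugate is finite.\<close>

lemma dual_exponent:
  fixes x y :: ennreal
  assumes x: "2 \<le> x" and xy: "1 / x + 1 / y = 1"
  shows "y \<noteq> \<infinity>" "0 < enn2real y" "1 / enn2real y = 1 - enn2real (1 / x)"
proof -
  have x0: "x \<noteq> 0" using x by auto
  have y0: "y \<noteq> 0" using xy by (auto simp: ennreal_divide_eq_top_iff)
  have "enn2real (1 / x) \<le> 1 / 2"
  proof (cases "x = \<infinity>")
    case False
    have "enn2real 2 \<le> enn2real x" using x False by (intro enn2real_mono) (auto simp: less_top)
    then show ?thesis using False one_div_ennreal(2)[OF x0] by (simp add: frac_le)
  qed (simp add: one_div_ennreal(2)[OF x0])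
  moreover have "ennreal (enn2real (1 / x) + enn2real (1 / y)) = ennreal 1"
    using xy one_div_ennreal(1)[OF x0] one_div_ennreal(1)[OF y0] by simp
  then have sum: "enn2real (1 / x) + enn2real (1 / y) = 1"
    by (subst (asm) ennreal_inj) auto
  ultimately have pos: "enn2real (1 / y) > 0" by linarith
  then show yf: "y \<noteq> \<infinity>" using one_div_ennreal(2)[OF y0] by (auto split: if_splits)
  show "0 < enn2real y"
    using yf y0 by (simp add: enn2real_positive_iff less_top zero_less_iff_neq_zero)
  show "1 / enn2real y = 1 - enn2real (1 / x)"
    using sum one_div_ennreal(2)[OF y0] yf by simp
qed

text \<open>The constant is the same for all admissible pairs. An infinite right-hand side needs no
  argument; otherwise both norms on the right are real numbers and the locale applies to a Borel
  modification of F.\<close>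

theorem duhamel_strichartz:
  fixes q r qt rt qt' rt' :: ennreal
  assumes "2 \<le> q" "2 \<le> r" "2 \<le> qt" "2 \<le> rt"
    and adm: "1 / q + 1 / (3 * r) \<le> 1 / 6" "1 / qt + 1 / (3 * rt) \<le> 1 / 6"
    and dual: "1 / qt + 1 / qt' = 1" "1 / rt + 1 / rt' = 1"
    and F: "\<And>n. set_borel_measurable lebesgue {0..} (\<lambda>t. F t n)"
    and u: "kg_duhamel_solution f g F u"
  shows "mixed_norm q r u \<le>
    ennreal (2 * strichartz_const\<^sup>2) * ennreal_powr (\<Sum>\<^sub>\<infinity>n. ennreal ((cmod (f n))\<^sup>2 + (cmod (g n))\<^sup>2)) (1 / 2) +
    ennreal (2 * strichartz_const\<^sup>2) * mixed_norm qt' rt' F"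
proof (cases "ennreal_powr (\<Sum>\<^sub>\<infinity>n. ennreal ((cmod (f n))\<^sup>2 + (cmod (g n))\<^sup>2)) (1 / 2) = \<infinity> \<or> mixed_norm qt' rt' F = \<infinity>")
  case True
  have "0 < strichartz_const" using strichartz_const_ge_1 by linarith
  with True show ?thesis by (auto simp: ennreal_mult_top)
next
  case False
  let ?S = "\<Sum>\<^sub>\<infinity>n. ennreal ((cmod (f n))\<^sup>2 + (cmod (g n))\<^sup>2)"
  obtain X where X: "0 \<le> X" "ennreal_powr ?S (1 / 2) = ennreal X"
    using False by (cases "ennreal_powr ?S (1 / 2)") auto
  obtain N where N: "0 \<le> N" "mixed_norm qt' rt' F = ennreal N"
    using False by (cases "mixed_norm qt' rt' F") auto
  have "?S \<le> ennreal (X powr 2)"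
    using ennreal_powr_le_iff[of "1 / 2" X ?S] X by simp
  then have fg: "(\<Sum>n\<in>A. (cmod (f n))\<^sup>2 + (cmod (g n))\<^sup>2) \<le> X\<^sup>2" if "finite A" for A
    using that X(1) unfolding infsum_ennreal_le_iff
    by (auto simp: sum_ennreal powr_numeral simp del: ennreal_plus)
  have f_le: "(\<Sum>k\<in>A. (cmod (f k))\<^sup>2) \<le> X\<^sup>2" if "finite A" for A
    using fg[OF that] by (simp add: sum.distrib) (smt (verit) sum_nonneg zero_le_power2)
  have g_le: "(\<Sum>k\<in>A. (cmod (g k))\<^sup>2) \<le> X\<^sup>2" if "finite A" for A
    using fg[OF that] by (simp add: sum.distrib) (smt (verit) sum_nonneg zero_le_power2)
  obtain w where w: "0 \<le> w" "w \<le> 1"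
    "q = \<infinity> \<and> w = 0 \<or> q \<noteq> \<infinity> \<and> 6 \<le> enn2real q \<and> w = 6 / enn2real q"
    "r = \<infinity> \<or> r \<noteq> \<infinity> \<and> 0 < enn2real r \<and> 2 \<le> (1 - w) * enn2real r"
    by (rule admissible_exponents[OF assms(1,2) adm(1)]) blast
  obtain v where v: "0 \<le> v" "v \<le> 1" "v = 6 * enn2real (1 / qt)" "enn2real (1 / rt) \<le> (1 - v) / 2"
    by (rule admissible_exponents[OF assms(3,4) adm(2)]) blast
  note dq = dual_exponent[OF assms(3) dual(1)] and dr = dual_exponent[OF assms(4) dual(2)]
  have b: "enn2real qt' = 6 / (6 - v)"
  proof -
    have inv: "a = 6 / (6 - v)" if "1 / a = (6 - v) / 6" "0 < a" for a
      using that v(2) by (simp add: field_simps)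
    have "1 / enn2real qt' = (6 - v) / 6" using dq(3) v(3) by simp
    then show ?thesis using dq(2) by (rule inv)
  qed
  have p: "enn2real rt' \<le> 2 / (1 + v)"
  proof -
    have inv: "a \<le> 2 / (1 + v)" if "(1 + v) / 2 \<le> 1 / a" "0 < a" for a
      using that v(1) by (simp add: field_simps)
    have "(1 + v) / 2 \<le> 1 / enn2real rt'" using dr(3) v(4) by simp
    then show ?thesis using dr(2) by (rule inv)
  qed
  obtain F' \<Phi> where F': "\<And>k. (\<lambda>s. F' s k) \<in> borel_measurable borel" "\<Phi> \<in> borel_measurable borel"
    "\<And>s. 0 \<le> \<Phi> s"
    "\<And>s A. finite A \<Longrightarrow> (\<Sum>k\<in>A. cmod (F' s k) powr (2 / (1 + v))) \<le> \<Phi> s powr (2 / (1 + v))"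
    "(\<integral>\<^sup>+s. ennreal (\<Phi> s powr (6 / (6 - v))) \<partial>lborel) \<le> ennreal (N powr (6 / (6 - v)))"
    "AE s in lborel. 0 \<le> s \<longrightarrow> F' s = F s"
    by (rule borel_reduction[OF F v(1,2) dq(1) b dr(1,2) p eq_refl[OF N(2)] N(1)]) blast
  \<comment> \<open>The combined l^2 norm X bounds each of f and g, so it serves twice. The bound is
    then C^2 (2 X + N), whence the factor 2 in the final constant.\<close>
  interpret kg_data f g F' \<Phi> v N X X
    by unfold_locales (use v N X F' f_le g_le in auto)
  have "mixed_norm q r u \<le> ennreal Y"
    by (rule strichartz_mixed_norm[OF duhamel_solution_eq_U[OF u F'(6)] w])
  also have "\<dots> \<le> ennreal (2 * strichartz_const\<^sup>2 * X + 2 * strichartz_const\<^sup>2 * N)"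
    unfolding Y_def using X N by (intro ennreal_leI) (simp add: algebra_simps)
  also have "\<dots> = ennreal (2 * strichartz_const\<^sup>2) * ennreal X + ennreal (2 * strichartz_const\<^sup>2) * ennreal N"
    using X N by (simp add: ennreal_mult)
  finally show ?thesis unfolding X(2) N(2) .
qed

section \<open>The homogeneous equation\<close>

definition taylor_monom :: "nat \<Rightarrow> real \<Rightarrow> real" where
  "taylor_monom m t = t ^ m / fact m"

lemma taylor_monom_0 [simp]: "taylor_monom 0 t = 1"
  by (simp add: taylor_monom_def)

lemma taylor_monom_at_0 [simp]: "taylor_monom (Suc m) 0 = 0"
  by (simp add: taylor_monom_def)

lemma DERIV_taylor_monom:
  "(taylor_monom (Suc m) has_real_derivative taylor_monom m t) (at t within S)"
proof -
  have "((\<lambda>t. t ^ Suc m / fact (Suc m)) has_real_derivative (real (Suc m) * t ^ m) / fact (Suc m)) (at t within S)"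
    by (rule derivative_eq_intros refl)+ simp_all
  also have "(real (Suc m) * t ^ m) / fact (Suc m) = taylor_monom m t"
    by (simp add: taylor_monom_def del: of_nat_Suc)
  finally show ?thesis unfolding taylor_monom_def[abs_def] .
qed

lemma taylor_monom_vector_derivative:
  "((\<lambda>t. complex_of_real (taylor_monom (Suc m) t) * c) has_vector_derivative complex_of_real (taylor_monom m t) * c) (at t within S)"
  by (intro has_vector_derivative_mult_left has_vector_derivative_of_real)
     (simp add: has_real_derivative_iff_has_vector_derivative[symmetric] DERIV_taylor_monom)

text \<open>One time integration raises the order of a monomial bound by one. The derivative at 0 is
  one-sided, so the comparison uses continuity on the closed interval and derivatives only
  inside.\<close>

lemma taylor_integration_step:
  fixes y y' :: "real \<Rightarrow> complex"
  assumes y: "\<And>t. 0 \<le> t \<Longrightarrow> (y has_vector_derivative y' t) (at t within {0..})"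
    and y0: "y 0 = 0" and b: "\<And>t. 0 \<le> t \<Longrightarrow> t \<le> T \<Longrightarrow> cmod (y' t) \<le> B * taylor_monom m t"
    and t: "0 \<le> t" "t \<le> T"
  shows "cmod (y t) \<le> B * taylor_monom (Suc m) t"
proof (cases "t = 0")
  case False
  with t have tpos: "0 < t" by simp
  have "cmod (y t - y 0) \<le> B * taylor_monom (Suc m) t - B * taylor_monom (Suc m) 0"
  proof (rule differentiable_bound_general[OF tpos, where f' = y' and \<phi>' = "\<lambda>s. B * taylor_monom m s"])
    show "continuous_on {0..t} y"
      by (rule continuous_on_subset[of "{0..}"])
         (auto simp: continuous_on_eq_continuous_within intro: has_vector_derivative_continuous y)
    show "continuous_on {0..t} (\<lambda>s. B * taylor_monom (Suc m) s)"
      unfolding taylor_monom_def by (intro continuous_intros) simp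
    fix s assume s: "0 < s" "s < t"
    have "at s within {0..} = at s" using s by (intro at_within_interior) simp
    then show "(y has_vector_derivative y' s) (at s)" using y[of s] s by simp
    show "((\<lambda>s. B * taylor_monom (Suc m) s) has_vector_derivative B * taylor_monom m s) (at s)"
      unfolding has_real_derivative_iff_has_vector_derivative[symmetric]
      by (intro DERIV_cmult DERIV_taylor_monom)
    show "cmod (y' s) \<le> B * taylor_monom m s" using b[of s] s t by simp
  qed
  then show ?thesis using y0 by simp
qed (simp add: y0)

text \<open>The equation reads u'' = \<open>kg_operator\<close> u, and the symbol of this operator
  is minus the square of \<open>kg_symbol\<close>. Its norm on bounded sequences is at most 1 + 1 +
  3 = 5.\<close>

definition kg_operator :: "(int \<Rightarrow> complex) \<Rightarrow> int \<Rightarrow> complex" where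
  "kg_operator a n = discrete_laplacian a n - a n"

lemma kg_operator_eq: "kg_operator a n = a (n + 1) + a (n - 1) - 3 * a n"
  by (simp add: kg_operator_def discrete_laplacian_def)

lemma kg_operator_diff: "kg_operator a n - kg_operator b n = kg_operator (\<lambda>k. a k - b k) n"
  by (simp add: kg_operator_eq algebra_simps)

lemma kg_operator_bound:
  assumes "\<And>n. cmod (a n) \<le> B"
  shows "cmod (kg_operator a n) \<le> 5 * B"
proof -
  have "cmod (kg_operator a n) \<le> cmod (a (n + 1)) + cmod (a (n - 1)) + cmod (3 * a n)"
    unfolding kg_operator_eq by (rule order_trans[OF norm_triangle_ineq4 add_right_mono[OF norm_triangle_ineq]])
  also have "\<dots> \<le> B + B + 3 * B"
    using assms[of n] by (intro add_mono assms) (simp add: norm_mult)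
  finally show ?thesis by simp
qed

definition taylor_sum :: "(int \<Rightarrow> complex) \<Rightarrow> (int \<Rightarrow> complex) \<Rightarrow> nat \<Rightarrow> real \<Rightarrow> int \<Rightarrow> complex" where
  "taylor_sum f g k t n = (\<Sum>j<k. complex_of_real (taylor_monom (2 * j) t) * (kg_operator ^^ j) f n
     + complex_of_real (taylor_monom (2 * j + 1) t) * (kg_operator ^^ j) g n)"

lemma kg_operator_taylor_sum:
  "kg_operator (taylor_sum f g k t) n = (\<Sum>j<k. complex_of_real (taylor_monom (2 * j) t) * (kg_operator ^^ Suc j) f n
     + complex_of_real (taylor_monom (2 * j + 1) t) * (kg_operator ^^ Suc j) g n)"
  unfolding kg_operator_eq[of "taylor_sum f g k t"] taylor_sum_def
  by (simp add: kg_operator_eq sum.distrib sum_subtractf sum_distrib_left algebra_simps)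

text \<open>Two time derivatives turn \<open>taylor_sum\<close> of order k + 1 into
  \<open>kg_operator\<close> applied to the one of order k. The induction step therefore costs a
  factor 5 and two integrations. No smoothness beyond the equation is used; the bound M uniform in
  the site starts the induction.\<close>

lemma taylor_remainder:
  assumes u: "\<And>n t. 0 \<le> t \<Longrightarrow> ((\<lambda>s. u s n) has_vector_derivative v t n) (at t within {0..})"
    and v: "\<And>n t. 0 \<le> t \<Longrightarrow> ((\<lambda>s. v s n) has_vector_derivative kg_operator (u t) n) (at t within {0..})"
    and init: "\<And>n. u 0 n = f n" "\<And>n. v 0 n = g n"
    and M: "\<And>t n. 0 \<le> t \<Longrightarrow> t \<le> T \<Longrightarrow> cmod (u t n) \<le> M"
    and t: "0 \<le> t" "t \<le> T"
  shows "cmod (u t n - taylor_sum f g k t n) \<le> M * 5 ^ k * taylor_monom (2 * k) t"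
  using t
proof (induction k arbitrary: n t)
  case 0
  then show ?case using M by (simp add: taylor_sum_def)
next
  case (Suc k)
  \<comment> \<open>The time derivative of the Taylor sum of order \<open>Suc k\<close>, to be
    compared with v.\<close>
  define Q where "Q t n = g n + (\<Sum>j<k. complex_of_real (taylor_monom (2 * j + 1) t) * (kg_operator ^^ Suc j) f n
     + complex_of_real (taylor_monom (2 * j + 2) t) * (kg_operator ^^ Suc j) g n)" for t n
  have P: "taylor_sum f g (Suc k) t n = f n + complex_of_real (taylor_monom (Suc 0) t) * g n
      + (\<Sum>j<k. complex_of_real (taylor_monom (Suc (2 * j + 1)) t) * (kg_operator ^^ Suc j) f n
        + complex_of_real (taylor_monom (Suc (2 * j + 2)) t) * (kg_operator ^^ Suc j) g n)" for t n
    unfolding taylor_sum_def sum.lessThan_Suc_shift by simp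
  have dP: "((\<lambda>s. taylor_sum f g (Suc k) s n) has_vector_derivative Q t n) (at t within S)" for t n S
  proof -
    have "((\<lambda>s. taylor_sum f g (Suc k) s n) has_vector_derivative
       0 + complex_of_real (taylor_monom 0 t) * g n
      + (\<Sum>j<k. complex_of_real (taylor_monom (2 * j + 1) t) * (kg_operator ^^ Suc j) f n
        + complex_of_real (taylor_monom (2 * j + 2) t) * (kg_operator ^^ Suc j) g n)) (at t within S)"
      unfolding P
      by (intro has_vector_derivative_add has_vector_derivative_const has_vector_derivative_sum
          taylor_monom_vector_derivative)
    then show ?thesis by (simp add: Q_def)
  qed
  have dQ: "((\<lambda>s. Q s n) has_vector_derivative kg_operator (taylor_sum f g k t) n) (at t within S)" for t n S
  proof -
    have "((\<lambda>s. g n + (\<Sum>j<k. complex_of_real (taylor_monom (Suc (2 * j)) s) * (kg_operator ^^ Suc j) f n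
     + complex_of_real (taylor_monom (Suc (2 * j + 1)) s) * (kg_operator ^^ Suc j) g n)) has_vector_derivative
       0 + (\<Sum>j<k. complex_of_real (taylor_monom (2 * j) t) * (kg_operator ^^ Suc j) f n
     + complex_of_real (taylor_monom (2 * j + 1) t) * (kg_operator ^^ Suc j) g n)) (at t within S)"
      by (intro has_vector_derivative_add has_vector_derivative_const has_vector_derivative_sum
          taylor_monom_vector_derivative)
    then show ?thesis by (simp add: Q_def kg_operator_taylor_sum)
  qed
  have "cmod (kg_operator (u s) n - kg_operator (taylor_sum f g k s) n) \<le> (M * 5 ^ Suc k) * taylor_monom (2 * k) s"
    if "0 \<le> s" "s \<le> T" for s n
  proof -
    have "cmod (kg_operator (u s) n - kg_operator (taylor_sum f g k s) n) \<le> 5 * (M * 5 ^ k * taylor_monom (2 * k) s)"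
      unfolding kg_operator_diff by (rule kg_operator_bound) (rule Suc.IH[OF that])
    then show ?thesis by (simp add: mult_ac)
  qed
  note step2 = this
  have Q0: "Q 0 n = g n" for n by (simp add: Q_def)
  have step1: "cmod (v s n - Q s n) \<le> (M * 5 ^ Suc k) * taylor_monom (Suc (2 * k)) s" if "0 \<le> s" "s \<le> T" for s n
    by (rule taylor_integration_step[where y' = "\<lambda>s. kg_operator (u s) n - kg_operator (taylor_sum f g k s) n" and T = T])
       (use that step2 init in \<open>auto intro!: has_vector_derivative_diff v dQ simp: Q0\<close>)
  have P0: "taylor_sum f g (Suc k) 0 n = f n" for n by (simp add: P)
  have "cmod (u t n - taylor_sum f g (Suc k) t n) \<le> (M * 5 ^ Suc k) * taylor_monom (Suc (Suc (2 * k))) t"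
    by (rule taylor_integration_step[where y' = "\<lambda>s. v s n - Q s n" and T = T])
       (use Suc.prems step1 init in \<open>auto intro!: has_vector_derivative_diff u dP simp: P0\<close>)
  then show ?case by simp
qed

section \<open>Powers of the lattice operator as multipliers, and expansions of the
  propagators\<close>

lemma multiplier_kernel_linear:
  assumes [measurable]: "m1 \<in> borel_measurable borel" "m2 \<in> borel_measurable borel"
    and b: "\<And>\<xi>. \<bar>m1 \<xi>\<bar> \<le> B1" "\<And>\<xi>. \<bar>m2 \<xi>\<bar> \<le> B2"
  shows "multiplier_kernel (\<lambda>\<xi>. m1 \<xi> + c * m2 \<xi>) n = multiplier_kernel m1 n + complex_of_real c * multiplier_kernel m2 n"
proof -
  have i: "integrable circle_measure (\<lambda>\<xi>. complex_of_real (m \<xi>) * cis (of_int n * \<xi>))"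
    if [measurable]: "m \<in> borel_measurable borel" and "\<And>\<xi>. \<bar>m \<xi>\<bar> \<le> B" for m B
    using that by (intro circle_integrable_bounded[of _ B]) (auto simp: norm_mult)
  have "multiplier_kernel (\<lambda>\<xi>. m1 \<xi> + c * m2 \<xi>) n
     = (\<integral>\<xi>. complex_of_real (m1 \<xi>) * cis (of_int n * \<xi>) + complex_of_real c * (complex_of_real (m2 \<xi>) * cis (of_int n * \<xi>)) \<partial>circle_measure)"
    by (subst multiplier_kernel_circle) (auto intro!: Bochner_Integration.integral_cong simp: algebra_simps)
  also have "\<dots> = multiplier_kernel m1 n + complex_of_real c * multiplier_kernel m2 n"
    using i[OF assms(1) b(1)] i[OF assms(2) b(2)] by (simp add: multiplier_kernel_circle)
  finally show ?thesis .
qed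

lemma fourier_multiplier_linear:
  assumes m: "m1 \<in> borel_measurable borel" "m2 \<in> borel_measurable borel"
    and b: "\<And>\<xi>. \<bar>m1 \<xi>\<bar> \<le> B1" "\<And>\<xi>. \<bar>m2 \<xi>\<bar> \<le> B2" and a: "l2_le a E"
  shows "fourier_multiplier (\<lambda>\<xi>. m1 \<xi> + c * m2 \<xi>) a n = fourier_multiplier m1 a n + complex_of_real c * fourier_multiplier m2 a n"
proof -
  have "((\<lambda>k. multiplier_kernel m1 (n - k) * a k + complex_of_real c * (multiplier_kernel m2 (n - k) * a k))
     has_sum (fourier_multiplier m1 a n + complex_of_real c * fourier_multiplier m2 a n)) UNIV"
    by (intro has_sum_add has_sum_cmult_right fourier_multiplier_has_sum(1)[OF m(1) b(1) a]
        fourier_multiplier_has_sum(1)[OF m(2) b(2) a])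
  then show ?thesis
    unfolding fourier_multiplier_def[of "\<lambda>\<xi>. m1 \<xi> + c * m2 \<xi>"] multiplier_kernel_linear[OF m b]
    by (intro infsumI) (simp add: algebra_simps)
qed

text \<open>The symbol of the j-th power of \<open>kg_operator\<close>. Its bound 5^j comes from 3 -
  2 cos \<xi> being at most 5, the same growth rate as in the bound for the solution.\<close>

definition power_symbol :: "nat \<Rightarrow> real \<Rightarrow> real" where
  "power_symbol j \<xi> = (- ((kg_symbol \<xi>)\<^sup>2)) ^ j"

lemma power_symbol_measurable [measurable]: "power_symbol j \<in> borel_measurable borel"
  unfolding power_symbol_def[abs_def] by measurable

lemma kg_symbol_sq_le_5: "(kg_symbol \<xi>)\<^sup>2 \<le> 5"
  unfolding kg_symbol_sq using cos_ge_minus_one[of \<xi>] by linarith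

lemma power_symbol_bound: "\<bar>power_symbol j \<xi>\<bar> \<le> 5 ^ j"
  unfolding power_symbol_def power_abs using kg_symbol_sq_le_5 by (intro power_mono) auto

lemma power_symbol_kernel:
  "multiplier_kernel (power_symbol (Suc j)) n = kg_operator (multiplier_kernel (power_symbol j)) n"
proof -
  have i: "integrable circle_measure (\<lambda>\<xi>. complex_of_real (power_symbol j \<xi>) * cis (of_int n * \<xi>))" for n
    using power_symbol_bound by (intro circle_integrable_bounded[of _ "5 ^ j"]) (auto simp: norm_mult)
  have "complex_of_real (power_symbol (Suc j) \<xi>) * cis (of_int n * \<xi>)
     = complex_of_real (power_symbol j \<xi>) * cis (of_int (n + 1) * \<xi>)
     + complex_of_real (power_symbol j \<xi>) * cis (of_int (n - 1) * \<xi>)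
     - 3 * (complex_of_real (power_symbol j \<xi>) * cis (of_int n * \<xi>))" for \<xi>
  proof -
    have "complex_of_real ((kg_symbol \<xi>)\<^sup>2) * cis (of_int n * \<xi>)
       = 3 * cis (of_int n * \<xi>) - cis (of_int (n + 1) * \<xi>) - cis (of_int (n - 1) * \<xi>)"
      unfolding kg_symbol_square[symmetric] discrete_laplacian_def by (simp add: algebra_simps)
    moreover have "complex_of_real (power_symbol (Suc j) \<xi>) * z
      = - (complex_of_real (power_symbol j \<xi>) * (complex_of_real ((kg_symbol \<xi>)\<^sup>2) * z))" for z
      by (simp add: power_symbol_def mult_ac)
    ultimately show ?thesis by (simp only:) (simp add: algebra_simps)
  qed
  then have "multiplier_kernel (power_symbol (Suc j)) n = (\<integral>\<xi>. complex_of_real (power_symbol j \<xi>) * cis (of_int (n + 1) * \<xi>)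
     + complex_of_real (power_symbol j \<xi>) * cis (of_int (n - 1) * \<xi>)
     - 3 * (complex_of_real (power_symbol j \<xi>) * cis (of_int n * \<xi>)) \<partial>circle_measure)"
    by (simp only: multiplier_kernel_circle[OF power_symbol_measurable])
  also have "\<dots> = kg_operator (multiplier_kernel (power_symbol j)) n"
    unfolding kg_operator_eq multiplier_kernel_circle[OF power_symbol_measurable]
    using i by (simp only: Bochner_Integration.integral_add Bochner_Integration.integral_diff
        Bochner_Integration.integrable_add integrable_mult_right Bochner_Integration.integral_mult_right_zero)
  finally show ?thesis .
qed

lemma fourier_multiplier_power_symbol:
  assumes a: "l2_le a E"
  shows "fourier_multiplier (power_symbol j) a n = (kg_operator ^^ j) a n"
proof (induction j arbitrary: n)
  case 0
  have "multiplier_kernel (power_symbol 0) = multiplier_kernel (\<lambda>_. 1)"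
    by (rule arg_cong[where f = multiplier_kernel]) (auto simp: power_symbol_def)
  then have "fourier_multiplier (power_symbol 0) a n = (\<Sum>\<^sub>\<infinity>k. if k = n then a n else 0)"
    unfolding fourier_multiplier_def by (intro infsum_cong) (auto simp: multiplier_kernel_one)
  also have "\<dots> = (\<Sum>\<^sub>\<infinity>k\<in>{n}. a n)" by (rule infsum_cong_neutral) auto
  finally show ?case by simp
next
  case (Suc j)
  note hs = fourier_multiplier_has_sum(1)[OF power_symbol_measurable power_symbol_bound a, of j]
  have "((\<lambda>k. multiplier_kernel (power_symbol j) (n + 1 - k) * a k + multiplier_kernel (power_symbol j) (n - 1 - k) * a k
        + (- 3) * (multiplier_kernel (power_symbol j) (n - k) * a k))
     has_sum (fourier_multiplier (power_symbol j) a (n + 1) + fourier_multiplier (power_symbol j) a (n - 1)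
        + (- 3) * fourier_multiplier (power_symbol j) a n)) UNIV"
    by (intro has_sum_add has_sum_cmult_right hs)
  moreover have "multiplier_kernel (power_symbol (Suc j)) (n - k) * a k =
      multiplier_kernel (power_symbol j) (n + 1 - k) * a k + multiplier_kernel (power_symbol j) (n - 1 - k) * a k
        + (- 3) * (multiplier_kernel (power_symbol j) (n - k) * a k)" for k
    unfolding power_symbol_kernel kg_operator_eq by (simp add: algebra_simps)
  ultimately have "fourier_multiplier (power_symbol (Suc j)) a n = fourier_multiplier (power_symbol j) a (n + 1)
     + fourier_multiplier (power_symbol j) a (n - 1) - 3 * fourier_multiplier (power_symbol j) a n"
    unfolding fourier_multiplier_def[of "power_symbol (Suc j)"] by (intro infsumI) simp
  then show ?case by (simp add: Suc.IH kg_operator_eq)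
qed

lemma fourier_multiplier_poly:
  assumes a: "l2_le a E"
  shows "fourier_multiplier (\<lambda>\<xi>. \<Sum>j<k. c j * power_symbol j \<xi>) a n = (\<Sum>j<k. complex_of_real (c j) * (kg_operator ^^ j) a n)"
proof (induction k)
  case 0
  show ?case by (simp add: fourier_multiplier_def multiplier_kernel_def)
next
  case (Suc k)
  have "\<bar>\<Sum>j<k. c j * power_symbol j \<xi>\<bar> \<le> (\<Sum>j<k. \<bar>c j\<bar> * 5 ^ j)" for \<xi>
    by (rule order_trans[OF sum_abs]) (auto simp: abs_mult intro!: sum_mono mult_left_mono power_symbol_bound)
  then have "fourier_multiplier (\<lambda>\<xi>. (\<Sum>j<k. c j * power_symbol j \<xi>) + c k * power_symbol k \<xi>) a n
     = fourier_multiplier (\<lambda>\<xi>. \<Sum>j<k. c j * power_symbol j \<xi>) a n + complex_of_real (c k) * fourier_multiplier (power_symbol k) a n"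
    by (intro fourier_multiplier_linear[OF _ _ _ power_symbol_bound a]) measurable
  then show ?case by (simp add: Suc.IH fourier_multiplier_power_symbol[OF a])
qed

text \<open>A uniform approximation of the symbol by a polynomial in its square becomes an
  approximation of the operator, since a multiplier with symbol bounded by R maps l^2 data to values
  of size at most R E.\<close>

lemma fourier_multiplier_taylor:
  assumes a: "l2_le a E" and m: "m \<in> borel_measurable borel" "\<And>\<xi>. \<bar>m \<xi>\<bar> \<le> B"
    and r: "\<And>\<xi>. \<bar>m \<xi> - (\<Sum>j<k. c j * power_symbol j \<xi>)\<bar> \<le> R"
  shows "cmod (fourier_multiplier m a n - (\<Sum>j<k. complex_of_real (c j) * (kg_operator ^^ j) a n)) \<le> R * E"
proof -
  define p where "p \<xi> = (\<Sum>j<k. c j * power_symbol j \<xi>)" for \<xi>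
  have pb: "\<bar>p \<xi>\<bar> \<le> (\<Sum>j<k. \<bar>c j\<bar> * 5 ^ j)" for \<xi>
    unfolding p_def
    by (rule order_trans[OF sum_abs]) (auto simp: abs_mult intro!: sum_mono mult_left_mono power_symbol_bound)
  have [measurable]: "p \<in> borel_measurable borel" unfolding p_def by measurable
  have "fourier_multiplier (\<lambda>\<xi>. m \<xi> + (- 1) * p \<xi>) a n = fourier_multiplier m a n + complex_of_real (- 1) * fourier_multiplier p a n"
    by (rule fourier_multiplier_linear[OF m(1) _ m(2) pb a]) measurable
  then have "fourier_multiplier m a n - fourier_multiplier p a n = fourier_multiplier (\<lambda>\<xi>. m \<xi> - p \<xi>) a n"
    by simp
  moreover have "cmod (fourier_multiplier (\<lambda>\<xi>. m \<xi> - p \<xi>) a n) \<le> R * E"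
    by (rule fourier_multiplier_has_sum(2)[OF _ _ a]) (use m(1) r in \<open>auto simp: p_def\<close>)
  moreover have "fourier_multiplier p a n = (\<Sum>j<k. complex_of_real (c j) * (kg_operator ^^ j) a n)"
    unfolding p_def by (rule fourier_multiplier_poly[OF a])
  ultimately show ?thesis by simp
qed

lemma cos_taylor:
  fixes x :: real
  shows "\<bar>cos x - (\<Sum>j<k. (- 1) ^ j * x ^ (2 * j) / fact (2 * j))\<bar> \<le> \<bar>x\<bar> ^ (2 * k) / fact (2 * k)"
proof -
  have eq: "(\<Sum>m<2 * k. cos_coeff m * x ^ m) = (\<Sum>j<k. (- 1) ^ j * x ^ (2 * j) / fact (2 * j))"
    by (induction k) (auto simp: cos_coeff_def)
  obtain s where "cos x = (\<Sum>m<2 * k. cos_coeff m * x ^ m) + (cos (s + 1 / 2 * real (2 * k) * pi) / fact (2 * k)) * x ^ (2 * k)"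
    using Maclaurin_cos_expansion[of x "2 * k"] by blast
  then have "\<bar>cos x - (\<Sum>j<k. (- 1) ^ j * x ^ (2 * j) / fact (2 * j))\<bar>
      = \<bar>cos (s + 1 / 2 * real (2 * k) * pi)\<bar> * (\<bar>x\<bar> ^ (2 * k) / fact (2 * k))"
    unfolding eq by (simp add: abs_mult power_abs)
  also have "\<dots> \<le> 1 * (\<bar>x\<bar> ^ (2 * k) / fact (2 * k))"
    by (intro mult_right_mono abs_cos_le_one) auto
  finally show ?thesis by simp
qed

text \<open>Stopping at the even order 2k, rather than at 2k + 1, gives the sine the same remainder
  as the cosine.\<close>

lemma sin_taylor:
  fixes x :: real
  shows "\<bar>sin x - (\<Sum>j<k. (- 1) ^ j * x ^ (2 * j + 1) / fact (2 * j + 1))\<bar> \<le> \<bar>x\<bar> ^ (2 * k) / fact (2 * k)"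
proof -
  have eq: "(\<Sum>m<2 * k. sin_coeff m * x ^ m) = (\<Sum>j<k. (- 1) ^ j * x ^ (2 * j + 1) / fact (2 * j + 1))"
    by (induction k) (auto simp: sin_coeff_def)
  obtain s where "sin x = (\<Sum>m<2 * k. sin_coeff m * x ^ m) + (sin (s + 1 / 2 * real (2 * k) * pi) / fact (2 * k)) * x ^ (2 * k)"
    using Maclaurin_sin_expansion2[of x "2 * k"] by blast
  then have "\<bar>sin x - (\<Sum>j<k. (- 1) ^ j * x ^ (2 * j + 1) / fact (2 * j + 1))\<bar>
      = \<bar>sin (s + 1 / 2 * real (2 * k) * pi)\<bar> * (\<bar>x\<bar> ^ (2 * k) / fact (2 * k))"
    unfolding eq by (simp add: abs_mult power_abs)
  also have "\<dots> \<le> 1 * (\<bar>x\<bar> ^ (2 * k) / fact (2 * k))"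
    by (intro mult_right_mono abs_sin_le_one) auto
  finally show ?thesis by simp
qed

lemma symbol_power_bound: "\<bar>t * kg_symbol \<xi>\<bar> ^ (2 * k) / fact (2 * k) \<le> 5 ^ k * taylor_monom (2 * k) t"
proof -
  have "\<bar>t * kg_symbol \<xi>\<bar> ^ (2 * k) = t ^ (2 * k) * ((kg_symbol \<xi>)\<^sup>2) ^ k"
    by (simp add: power_mult power_mult_distrib)
  also have "\<dots> \<le> t ^ (2 * k) * 5 ^ k"
    using kg_symbol_sq_le_5 by (intro mult_left_mono power_mono) (auto simp: power_mult)
  finally show ?thesis by (simp add: taylor_monom_def divide_right_mono mult.commute)
qed

lemma kg_cos_taylor:
  assumes a: "l2_le a E"
  shows "cmod (kg_cos t a n - (\<Sum>j<k. complex_of_real (taylor_monom (2 * j) t) * (kg_operator ^^ j) a n))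
    \<le> 5 ^ k * taylor_monom (2 * k) t * E"
  unfolding kg_cos_eq
proof (rule fourier_multiplier_taylor[OF a osc_symbol_measurable1 osc_symbol_bound])
  fix \<xi>
  have "osc_symbol 0 0 t \<xi> = cos (t * kg_symbol \<xi>)" by (simp add: osc_symbol_def)
  moreover have "taylor_monom (2 * j) t * power_symbol j \<xi> = (- 1) ^ j * (t * kg_symbol \<xi>) ^ (2 * j) / fact (2 * j)" for j
    unfolding taylor_monom_def power_symbol_def power_minus[of "(kg_symbol \<xi>)\<^sup>2"] by (simp add: power_mult power_mult_distrib)
  ultimately show "\<bar>osc_symbol 0 0 t \<xi> - (\<Sum>j<k. taylor_monom (2 * j) t * power_symbol j \<xi>)\<bar> \<le> 5 ^ k * taylor_monom (2 * k) t"
    using order_trans[OF cos_taylor symbol_power_bound] by simp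
qed

lemma kg_sin_taylor:
  assumes a: "l2_le a E"
  shows "cmod (kg_sin t a n - (\<Sum>j<k. complex_of_real (taylor_monom (2 * j + 1) t) * (kg_operator ^^ j) a n))
    \<le> 5 ^ k * taylor_monom (2 * k) t * E"
  unfolding kg_sin_eq
proof (rule fourier_multiplier_taylor[OF a osc_symbol_measurable1 osc_symbol_bound])
  fix \<xi>
  let ?w = "kg_symbol \<xi>"
  have w: "1 \<le> ?w" "?w \<noteq> 0" using kg_symbol_ge_1 kg_symbol_nz by auto
  have "osc_symbol 1 (- pi / 2) t \<xi> = sin (t * ?w) / ?w"
    unfolding osc_symbol_def by (subst cos_add) simp
  moreover have "taylor_monom (2 * j + 1) t * power_symbol j \<xi> = ((- 1) ^ j * (t * ?w) ^ (2 * j + 1) / fact (2 * j + 1)) / ?w" for j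
    unfolding taylor_monom_def power_symbol_def power_minus[of "?w\<^sup>2"] using w(2)
    by (simp add: power_mult power_mult_distrib)
  ultimately have eq: "osc_symbol 1 (- pi / 2) t \<xi> - (\<Sum>j<k. taylor_monom (2 * j + 1) t * power_symbol j \<xi>)
     = (sin (t * ?w) - (\<Sum>j<k. (- 1) ^ j * (t * ?w) ^ (2 * j + 1) / fact (2 * j + 1))) / ?w"
    by (simp only: sum_divide_distrib diff_divide_distrib)
  \<comment> \<open>Division by \<open>kg_symbol\<close>, which is at least 1, does not enlarge the
    error.\<close>
  have "\<bar>(sin (t * ?w) - (\<Sum>j<k. (- 1) ^ j * (t * ?w) ^ (2 * j + 1) / fact (2 * j + 1))) / ?w\<bar>
     \<le> \<bar>sin (t * ?w) - (\<Sum>j<k. (- 1) ^ j * (t * ?w) ^ (2 * j + 1) / fact (2 * j + 1))\<bar> / 1"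
    unfolding abs_divide using w by (intro frac_le) auto
  also have "\<dots> \<le> 5 ^ k * taylor_monom (2 * k) t"
    using order_trans[OF sin_taylor symbol_power_bound] by simp
  finally show "\<bar>osc_symbol 1 (- pi / 2) t \<xi> - (\<Sum>j<k. taylor_monom (2 * j + 1) t * power_symbol j \<xi>)\<bar> \<le> 5 ^ k * taylor_monom (2 * k) t" unfolding eq .
qed

lemma taylor_remainder_tendsto_0: "(\<lambda>k. 5 ^ k * taylor_monom (2 * k) t) \<longlonglongrightarrow> 0"
proof -
  have "(\<lambda>n. inverse (fact n) * (sqrt 5 * t) ^ n) \<longlonglongrightarrow> 0"
    by (rule summable_LIMSEQ_zero) (rule summable_exp)
  moreover have "filterlim (\<lambda>k::nat. 2 * k) sequentially sequentially"
    by (rule filterlim_subseq) (simp add: strict_mono_def)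
  ultimately have "(\<lambda>k. inverse (fact (2 * k)) * (sqrt 5 * t) ^ (2 * k)) \<longlonglongrightarrow> 0"
    by (rule filterlim_compose)
  moreover have "inverse (fact (2 * k)) * (sqrt 5 * t) ^ (2 * k) = 5 ^ k * taylor_monom (2 * k) t" for k
  proof -
    have "(sqrt 5 * t) ^ (2 * k) = ((sqrt 5 * t)\<^sup>2) ^ k" by (rule power_mult)
    also have "\<dots> = 5 ^ k * t ^ (2 * k)" by (simp add: power_mult_distrib power_mult[of t 2 k])
    finally show ?thesis by (simp add: taylor_monom_def divide_inverse mult_ac)
  qed
  ultimately show ?thesis by simp
qed

text \<open>Solutions and propagators have the same Taylor expansion in time; this is where the bound on
  the $l^2$ norm of the solution is needed.\<close>

lemma homogeneous_solution_eq:
  assumes sol: "kg_homogeneous_solution f g u" and f: "l2_le f E1" and g: "l2_le g E2" and t: "0 \<le> t"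
  shows "u t n = kg_cos t f n + kg_sin t g n"
proof -
  obtain v w where u: "\<And>n t. 0 \<le> t \<Longrightarrow> ((\<lambda>s. u s n) has_vector_derivative v t n) (at t within {0..})"
    and v: "\<And>n t. 0 \<le> t \<Longrightarrow> ((\<lambda>s. v s n) has_vector_derivative w t n) (at t within {0..})"
    and w: "\<And>n t. 0 \<le> t \<Longrightarrow> w t n - discrete_laplacian (u t) n + u t n = 0"
    and init: "\<And>n. u 0 n = f n" "\<And>n. v 0 n = g n"
    and bdd: "(SUP t\<in>{0..t}. lp_norm 2 (u t)) < \<infinity>"
    using sol t unfolding kg_homogeneous_solution_def by metis
  have v': "((\<lambda>s. v s n) has_vector_derivative kg_operator (u t) n) (at t within {0..})" if "0 \<le> t" for n t
  proof -
    have "w t n = kg_operator (u t) n" using w[OF that, of n] by (simp add: kg_operator_def algebra_simps)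
    then show ?thesis using v[OF that, of n] by simp
  qed
  obtain M where M: "0 \<le> M" "(SUP t\<in>{0..t}. lp_norm 2 (u t)) = ennreal M"
    using bdd by (cases "SUP t\<in>{0..t}. lp_norm 2 (u t)") auto
  have uM: "cmod (u s n) \<le> M" if "0 \<le> s" "s \<le> t" for s n
  proof -
    have "lp_norm 2 (u s) \<le> ennreal M"
      unfolding M(2)[symmetric] using that by (intro SUP_upper) auto
    then have "l2_le (u s) M" using lp_norm_2_le_iff M(1) by blast
    from l2_leD(2)[OF this, of "{n}"] show ?thesis
      using M(1) by (intro power2_le_imp_le[of "cmod (u s n)"]) auto
  qed
  \<comment> \<open>The solution and both propagators differ from their common Taylor polynomial by
    multiples of the same remainder, which tends to 0 because the factorial outgrows the
    power.\<close>
  have "cmod (u t n - (kg_cos t f n + kg_sin t g n)) \<le> (M + E1 + E2) * (5 ^ k * taylor_monom (2 * k) t)" for k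
  proof -
    let ?F = "\<Sum>j<k. complex_of_real (taylor_monom (2 * j) t) * (kg_operator ^^ j) f n"
    let ?G = "\<Sum>j<k. complex_of_real (taylor_monom (2 * j + 1) t) * (kg_operator ^^ j) g n"
    have "taylor_sum f g k t n = ?F + ?G" by (simp add: taylor_sum_def sum.distrib)
    then have "u t n - (kg_cos t f n + kg_sin t g n)
       = (u t n - taylor_sum f g k t n) - (kg_cos t f n - ?F) - (kg_sin t g n - ?G)"
      by simp
    then have "cmod (u t n - (kg_cos t f n + kg_sin t g n))
       = cmod ((u t n - taylor_sum f g k t n) - (kg_cos t f n - ?F) - (kg_sin t g n - ?G))"
      by (rule arg_cong)
    also have "\<dots> \<le> cmod (u t n - taylor_sum f g k t n) + cmod (kg_cos t f n - ?F) + cmod (kg_sin t g n - ?G)"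
      by (rule order_trans[OF norm_triangle_ineq4 add_right_mono[OF norm_triangle_ineq4]])
    also have "\<dots> \<le> M * 5 ^ k * taylor_monom (2 * k) t + 5 ^ k * taylor_monom (2 * k) t * E1 + 5 ^ k * taylor_monom (2 * k) t * E2"
      by (intro add_mono kg_cos_taylor[OF f] kg_sin_taylor[OF g] taylor_remainder[OF u v' init uM t order_refl])
    finally show ?thesis by (simp add: algebra_simps)
  qed
  moreover have "(\<lambda>k. (M + E1 + E2) * (5 ^ k * taylor_monom (2 * k) t)) \<longlonglongrightarrow> (M + E1 + E2) * 0"
    by (intro tendsto_mult tendsto_const taylor_remainder_tendsto_0)
  ultimately have "cmod (u t n - (kg_cos t f n + kg_sin t g n)) \<le> (M + E1 + E2) * 0"
    by (intro LIMSEQ_le_const) auto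
  then show ?thesis by simp
qed

text \<open>The l^2 bound provides convergence of the series; its size comes from the pointwise
  kernel bound and the l^1 norm, passed through symmetric partial sums.\<close>

lemma kg_kernel_l1_linfty:
  assumes a: "l2_le a E" and X: "lp_norm 1 a \<le> ennreal X" "0 \<le> X" and t: "0 < t"
  shows "cmod (fourier_multiplier (osc_symbol j \<theta> t) a n) \<le> 2 * osc_const * t powr (- 1 / 3) * X"
proof -
  have l1: "(\<Sum>k\<in>A. cmod (a k)) \<le> X" if "finite A" for A
    using lp_norm_le_iff[of 1 X a] X that by simp
  have "(\<lambda>m. cmod (\<Sum>k\<in>{- int m..int m}. multiplier_kernel (osc_symbol j \<theta> t) (n - k) * a k))
      \<longlonglongrightarrow> cmod (fourier_multiplier (osc_symbol j \<theta> t) a n)"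
    by (intro tendsto_norm has_sum_symmetric_limit
        fourier_multiplier_has_sum(1)[OF osc_symbol_measurable1 osc_symbol_bound a])
  moreover have "cmod (\<Sum>k\<in>{- int m..int m}. multiplier_kernel (osc_symbol j \<theta> t) (n - k) * a k)
      \<le> 2 * osc_const * t powr (- 1 / 3) * X" for m
  proof -
    have "cmod (\<Sum>k\<in>{- int m..int m}. multiplier_kernel (osc_symbol j \<theta> t) (n - k) * a k)
       \<le> (\<Sum>k\<in>{- int m..int m}. 2 * osc_const * t powr (- 1 / 3) * cmod (a k))"
    proof (rule order_trans[OF norm_sum sum_mono])
      fix k
      have "cmod (multiplier_kernel (osc_symbol j \<theta> t) (n - k)) \<le> 2 * osc_const * decay t"
        by (rule dispersive_estimate)
      also have "\<dots> \<le> 2 * osc_const * t powr (- 1 / 3)"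
        using decay_le_powr[of t] t osc_const_ge_1 by simp
      finally show "cmod (multiplier_kernel (osc_symbol j \<theta> t) (n - k) * a k) \<le> 2 * osc_const * t powr (- 1 / 3) * cmod (a k)"
        unfolding norm_mult by (rule mult_right_mono) simp
    qed
    also have "\<dots> \<le> 2 * osc_const * t powr (- 1 / 3) * X"
      unfolding sum_distrib_left[symmetric] using osc_const_ge_1 by (intro mult_left_mono l1) auto
    finally show ?thesis .
  qed
  ultimately show ?thesis by (intro LIMSEQ_le_const2) auto
qed

text \<open>Once identified with the propagators, u is a Duhamel solution with zero forcing, so the
  l^2 bound is the estimate at the endpoint (\<infinity>, 2). The decay in time comes from the
  kernel bound.\<close>

lemma homogeneous_estimates:
  assumes fg: "lp_norm 2 f < \<infinity>" "lp_norm 2 g < \<infinity>" and sol: "kg_homogeneous_solution f g u" and t: "0 < t"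
  shows "lp_norm 2 (u t) \<le> ennreal (2 * strichartz_const\<^sup>2) * (lp_norm 2 f + lp_norm 2 g)"
    and "lp_norm \<infinity> (u t) \<le> ennreal (2 * strichartz_const\<^sup>2 * t powr (- 1 / 3)) * (lp_norm 1 f + lp_norm 1 g)"
proof -
  obtain E1 where E1: "0 \<le> E1" "lp_norm 2 f = ennreal E1" using fg(1) by (cases "lp_norm 2 f") auto
  obtain E2 where E2: "0 \<le> E2" "lp_norm 2 g = ennreal E2" using fg(2) by (cases "lp_norm 2 g") auto
  have f: "l2_le f E1" and g: "l2_le g E2"
    using lp_norm_2_le_iff E1 E2 by (metis order_refl)+
  note eq = homogeneous_solution_eq[OF sol f g]
  have "kg_duhamel_solution f g (\<lambda>_ _. 0) u"
    unfolding kg_duhamel_solution_def using eq by (simp add: kg_sin_def fourier_multiplier_def)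
  then have "mixed_norm \<infinity> 2 u \<le>
    ennreal (2 * strichartz_const\<^sup>2) * ennreal_powr (\<Sum>\<^sub>\<infinity>n. ennreal ((cmod (f n))\<^sup>2 + (cmod (g n))\<^sup>2)) (1 / 2) +
    ennreal (2 * strichartz_const\<^sup>2) * mixed_norm 1 2 (\<lambda>_ _. 0)"
  proof (rule duhamel_strichartz[where qt = \<infinity> and rt = 2, rotated -1])
    show "1 / \<infinity> + 1 / (3 * 2) \<le> (1 / 6 :: ennreal)" "1 / \<infinity> + 1 / (3 * 2) \<le> (1 / 6 :: ennreal)"
      "1 / \<infinity> + 1 / 1 = (1 :: ennreal)"
      by simp_all
    have "(1 / 2 :: ennreal) = ennreal (1 / 2)" using divide_ennreal[of 1 2] by simp
    then have "1 / 2 + 1 / 2 = ennreal (1 / 2) + ennreal (1 / 2)" by (simp only:)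
    also have "\<dots> = 1" by (subst ennreal_plus[symmetric]) auto
    finally show "1 / 2 + 1 / 2 = (1 :: ennreal)" .
  qed (auto simp: set_borel_measurable_def)
  also have "mixed_norm 1 2 (\<lambda>_ _. 0) = 0"
  proof -
    have "lp_norm 2 (\<lambda>_. 0) = 0"
      using lp_norm_2_le_iff[of 0 "\<lambda>_. 0"] by (simp add: l2_le_def)
    then show ?thesis by (simp add: mixed_norm_def ennreal_powr_def)
  qed
  also have "ennreal_powr (\<Sum>\<^sub>\<infinity>n. ennreal ((cmod (f n))\<^sup>2 + (cmod (g n))\<^sup>2)) (1 / 2) \<le> ennreal (E1 + E2)"
  proof -
    have "(\<Sum>n\<in>A. (cmod (f n))\<^sup>2 + (cmod (g n))\<^sup>2) \<le> (E1 + E2) powr 2" if "finite A" for A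
    proof -
      have "(\<Sum>n\<in>A. (cmod (f n))\<^sup>2 + (cmod (g n))\<^sup>2) \<le> E1\<^sup>2 + E2\<^sup>2"
        unfolding sum.distrib by (intro add_mono l2_leD(2) f g that)
      also have "\<dots> \<le> (E1 + E2)\<^sup>2" using E1 E2 by (simp add: power2_sum)
      finally show ?thesis using E1 E2 by (simp add: powr_numeral)
    qed
    then have "(\<Sum>\<^sub>\<infinity>n. ennreal ((cmod (f n))\<^sup>2 + (cmod (g n))\<^sup>2)) \<le> ennreal ((E1 + E2) powr 2)"
      unfolding infsum_ennreal_le_iff by (auto simp: sum_ennreal ennreal_leI simp del: ennreal_plus)
    then show ?thesis using E1 E2 by (subst ennreal_powr_le_iff) auto
  qed
  finally have "mixed_norm \<infinity> 2 u \<le> ennreal (2 * strichartz_const\<^sup>2) * (lp_norm 2 f + lp_norm 2 g)"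
    using E1 E2 by (simp add: mult_left_mono)
  moreover have "lp_norm 2 (u t) \<le> mixed_norm \<infinity> 2 u"
    unfolding mixed_norm_def using t by (auto intro!: SUP_upper)
  ultimately show "lp_norm 2 (u t) \<le> ennreal (2 * strichartz_const\<^sup>2) * (lp_norm 2 f + lp_norm 2 g)"
    by (rule order_trans[rotated])
  show "lp_norm \<infinity> (u t) \<le> ennreal (2 * strichartz_const\<^sup>2 * t powr (- 1 / 3)) * (lp_norm 1 f + lp_norm 1 g)"
  proof (cases "lp_norm 1 f = \<infinity> \<or> lp_norm 1 g = \<infinity>")
    case True
    have "0 < strichartz_const" using strichartz_const_ge_1 by linarith
    with True t show ?thesis by (auto simp: ennreal_mult_top)
  next
    case False
    obtain X1 where X1: "0 \<le> X1" "lp_norm 1 f = ennreal X1" using False by (cases "lp_norm 1 f") auto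
    obtain X2 where X2: "0 \<le> X2" "lp_norm 1 g = ennreal X2" using False by (cases "lp_norm 1 g") auto
    have "cmod (u t n) \<le> 2 * strichartz_const\<^sup>2 * t powr (- 1 / 3) * (X1 + X2)" for n
    proof -
      have "cmod (u t n) \<le> cmod (kg_cos t f n) + cmod (kg_sin t g n)"
        using eq[of t n] t by (simp add: norm_triangle_ineq)
      also have "\<dots> \<le> 2 * osc_const * t powr (- 1 / 3) * X1 + 2 * osc_const * t powr (- 1 / 3) * X2"
        unfolding kg_cos_eq kg_sin_eq
        using X1 X2 by (intro add_mono kg_kernel_l1_linfty[OF f _ _ t] kg_kernel_l1_linfty[OF g _ _ t]) auto
      also have "\<dots> = 2 * osc_const * (t powr (- 1 / 3) * (X1 + X2))" by (simp add: algebra_simps)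
      \<comment> \<open>The square of \<open>strichartz_const\<close> is 20
        \<open>osc_const\<close>, so one constant serves both estimates.\<close>
      also have "\<dots> \<le> 2 * strichartz_const\<^sup>2 * (t powr (- 1 / 3) * (X1 + X2))"
        unfolding strichartz_const_sq using osc_const_ge_1 X1 X2 by (intro mult_right_mono) auto
      finally show ?thesis by (simp add: mult.assoc)
    qed
    then have "lp_norm \<infinity> (u t) \<le> ennreal (2 * strichartz_const\<^sup>2 * t powr (- 1 / 3) * (X1 + X2))"
      unfolding lp_norm_def by (auto intro!: SUP_least ennreal_leI)
    also have "\<dots> = ennreal (2 * strichartz_const\<^sup>2 * t powr (- 1 / 3)) * (lp_norm 1 f + lp_norm 1 g)"
      unfolding X1 X2 using X1 X2 by (simp add: ennreal_mult)
    finally show ?thesis .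
  qed
qed

theorem theorem2:
  shows "(\<exists>C::real. 0 < C \<and>
      (\<forall>f g u. lp_norm 2 f < \<infinity> \<longrightarrow> lp_norm 2 g < \<infinity> \<longrightarrow> kg_homogeneous_solution f g u \<longrightarrow>
        (\<forall>t>0.
          lp_norm 2 (u t) \<le> ennreal C * (lp_norm 2 f + lp_norm 2 g) \<and>
          lp_norm \<infinity> (u t) \<le> ennreal (C * t powr (- 1 / 3)) * (lp_norm 1 f + lp_norm 1 g)))) \<and>
    (\<forall>q r qt rt qt' rt' :: ennreal.
      2 \<le> q \<longrightarrow> 2 \<le> r \<longrightarrow> 2 \<le> qt \<longrightarrow> 2 \<le> rt \<longrightarrow>
      1 / q + 1 / (3 * r) \<le> 1 / 6 \<longrightarrow> 1 / qt + 1 / (3 * rt) \<le> 1 / 6 \<longrightarrow>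
      1 / qt + 1 / qt' = 1 \<longrightarrow> 1 / rt + 1 / rt' = 1 \<longrightarrow>
      (\<exists>C::real. 0 < C \<and>
        (\<forall>f g F u. lp_norm 2 f < \<infinity> \<longrightarrow> lp_norm 2 g < \<infinity> \<longrightarrow>
          (\<forall>n. set_borel_measurable lebesgue {0..} (\<lambda>t. F t n)) \<longrightarrow>
          mixed_norm qt' rt' F < \<infinity> \<longrightarrow> kg_duhamel_solution f g F u \<longrightarrow>
          mixed_norm q r u \<le>
            ennreal C * ennreal_powr (\<Sum>\<^sub>\<infinity>n. ennreal ((cmod (f n))\<^sup>2 + (cmod (g n))\<^sup>2)) (1 / 2) +
            ennreal C * mixed_norm qt' rt' F)))"
proof (intro conjI allI impI)
  have "0 < strichartz_const" using strichartz_const_ge_1 by linarith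
  then have pos: "0 < 2 * strichartz_const\<^sup>2" by simp
  show "\<exists>C::real. 0 < C \<and>
      (\<forall>f g u. lp_norm 2 f < \<infinity> \<longrightarrow> lp_norm 2 g < \<infinity> \<longrightarrow> kg_homogeneous_solution f g u \<longrightarrow>
        (\<forall>t>0.
          lp_norm 2 (u t) \<le> ennreal C * (lp_norm 2 f + lp_norm 2 g) \<and>
          lp_norm \<infinity> (u t) \<le> ennreal (C * t powr (- 1 / 3)) * (lp_norm 1 f + lp_norm 1 g)))"
    using pos homogeneous_estimates by (intro exI[of _ "2 * strichartz_const\<^sup>2"]) blast
  fix q r qt rt qt' rt' :: ennreal
  assume exponents: "2 \<le> q" "2 \<le> r" "2 \<le> qt" "2 \<le> rt"
    "1 / q + 1 / (3 * r) \<le> 1 / 6" "1 / qt + 1 / (3 * rt) \<le> 1 / 6"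
    "1 / qt + 1 / qt' = 1" "1 / rt + 1 / rt' = 1"
  show "\<exists>C::real. 0 < C \<and>
        (\<forall>f g F u. lp_norm 2 f < \<infinity> \<longrightarrow> lp_norm 2 g < \<infinity> \<longrightarrow>
          (\<forall>n. set_borel_measurable lebesgue {0..} (\<lambda>t. F t n)) \<longrightarrow>
          mixed_norm qt' rt' F < \<infinity> \<longrightarrow> kg_duhamel_solution f g F u \<longrightarrow>
          mixed_norm q r u \<le>
            ennreal C * ennreal_powr (\<Sum>\<^sub>\<infinity>n. ennreal ((cmod (f n))\<^sup>2 + (cmod (g n))\<^sup>2)) (1 / 2) +
            ennreal C * mixed_norm qt' rt' F)"
    using pos duhamel_strichartz[OF exponents]
    by (intro exI[of _ "2 * strichartz_const\<^sup>2"]) blast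
qed

end
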